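(* Let $\sigma$ be a symmetric matrix mean with interpolational path $(\sigma_t)_{t\in[0,1]}$. Let $A,B\in\mathcal{M}_n$ be two accretive matrices and let $0\le t\le 1$. Then $$\mathfrak{R}(A\nabla_t B)\le \mathfrak{R}(A\sigma_t B)+2R\Big(\mathfrak{R}(A\nabla B)-(\mathfrak{R}A)\,\sigma\,(\mathfrak{R}B)\Big),$$ where $R=\max\{t,1-t\}$.
   Context: $\mathcal{M}_n$ is the algebra of complex $n\times n$ matrices; $\mathfrak{R}A=\frac{A+A^*}{2}$; inequalities between Hermitian matrices are in the Loewner (positive semidefinite) order. $A$ is accretive if $\mathfrak{R}A>0$ (positive definite). $A\nabla_tB=(1-t)A+tB$ and $\nabla=\nabla_{1/2}$. Matrix means. For a matrix monotone function $f:(0,\infty)\to(0,\infty)$ with $f(1)=1$, the associated matrix mean is $A\sigma_f B=A^{1/2}f(A^{-1/2}BA^{-1/2})A^{1/2}$, for $A,B$ strictly positive and, more generally, for $A,B$ accretive. In the accretive case $A^{1/2}$ is the principal square root, $A^{-1/2}BA^{-1/2}$ has no eigenvalue in $(-\infty,0]$, $f$ is extended analytically to $\mathbb{C}\setminus(-\infty,0]$, and for a matrix $X$ with no eigenvalue in $(-\infty,0]$, $f(X)=\frac{1}{2\pi i}\int_\Gamma f(z)(zI-X)^{-1}dz$ with $\Gamma$ a simple closed curve in the domain of analyticity surrounding the eigenvalues of $X$. Interpolational path. Let $\sigma$ be a symmetric mean ($A\sigma B=B\sigma A$ for all strictly positive $A,B$). A family of means $(\sigma_t)_{t\in[0,1]}$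 is an interpolational path for $\sigma$ if for all strictly positive $A,B$: (c1) $A\sigma_0B=A$, $A\sigma_1B=B$, $A\sigma_{1/2}B=A\sigma B$; (c2) $(A\sigma_\alpha B)\sigma(A\sigma_\beta B)=A\sigma_{\frac{\alpha+\beta}{2}}B$ for all $\alpha,\beta\in[0,1]$; (c3) $\alpha\mapsto A\sigma_\alpha B$ is norm continuous on $[0,1]$. For accretive $A,B$, $A\sigma_tB$ is given by the formula above with the matrix monotone function representing $\sigma_t$. *)

theory Defs
  imports
    "HOL-Complex_Analysis.Complex_Analysis"
    "Jordan_Normal_Form.Schur_Decomposition"
begin

text \<open>
  Matrices are those of \<open>Jordan_Normal_Form\<close>: the dimension is a number, as it must be for
  matrix monotonicity, which speaks about matrices of every size.  The order symbol of that
  library on matrices is entrywise and is not used; the Loewner order is defined here.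
\<close>

hide_const (open) Finite_Cartesian_Product.mat

definition hermitian :: "complex mat \<Rightarrow> bool" where
  "hermitian A \<longleftrightarrow> mat_adjoint A = A"

definition pos_semidef :: "nat \<Rightarrow> complex mat \<Rightarrow> bool" where
  "pos_semidef n A \<longleftrightarrow> A \<in> carrier_mat n n \<and> hermitian A \<and>
     (\<forall>v \<in> carrier_vec n. 0 \<le> Re ((A *\<^sub>v v) \<bullet>c v))"

text \<open>Positive definite matrices are called strictly positive.\<close>

definition pos_def :: "nat \<Rightarrow> complex mat \<Rightarrow> bool" where
  "pos_def n A \<longleftrightarrow> A \<in> carrier_mat n n \<and> hermitian A \<and>
     (\<forall>v \<in> carrier_vec n. v \<noteq> 0\<^sub>v n \<longrightarrow> 0 < Re ((A *\<^sub>v v) \<bullet>c v))"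

definition loewner_le :: "nat \<Rightarrow> complex mat \<Rightarrow> complex mat \<Rightarrow> bool" where
  "loewner_le n A B \<longleftrightarrow> A \<in> carrier_mat n n \<and> B \<in> carrier_mat n n \<and>
     hermitian A \<and> hermitian B \<and> pos_semidef n (B - A)"

definition re_mat :: "complex mat \<Rightarrow> complex mat" where
  "re_mat A = (1 / 2) \<cdot>\<^sub>m (A + mat_adjoint A)"

definition accretive :: "nat \<Rightarrow> complex mat \<Rightarrow> bool" where
  "accretive n A \<longleftrightarrow> A \<in> carrier_mat n n \<and> pos_def n (re_mat A)"

definition wt_arith_mean :: "real \<Rightarrow> complex mat \<Rightarrow> complex mat \<Rightarrow> complex mat" where
  "wt_arith_mean t A B = complex_of_real (1 - t) \<cdot>\<^sub>m A + complex_of_real t \<cdot>\<^sub>m B"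

abbreviation arith_mean :: "complex mat \<Rightarrow> complex mat \<Rightarrow> complex mat" where
  "arith_mean \<equiv> wt_arith_mean (1 / 2)"

text \<open>Meaningful for invertible matrices only.\<close>

definition inv_mat :: "complex mat \<Rightarrow> complex mat" where
  "inv_mat A = the (mat_inverse A)"

definition op_norm :: "complex mat \<Rightarrow> real" where
  "op_norm A =
     (SUP v \<in> {v \<in> carrier_vec (dim_col A). Re (v \<bullet>c v) \<le> 1}. sqrt (Re ((A *\<^sub>v v) \<bullet>c (A *\<^sub>v v))))"


subsection \<open>Functions of Hermitian matrices and means of strictly positive matrices\<close>

text \<open>
  \<open>f(A) = U diag(f(d\<^sub>0),\<dots>) U\<^sup>*\<close> where \<open>A = U diag(d\<^sub>0,\<dots>) U\<^sup>*\<close> with \<open>U\<close> unitary and \<open>d\<close> real.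
  The result does not depend on the chosen diagonalisation.
\<close>

definition herm_fun :: "(real \<Rightarrow> real) \<Rightarrow> complex mat \<Rightarrow> complex mat" where
  "herm_fun f A =
     (SOME X. \<exists>U d. U \<in> carrier_mat (dim_row A) (dim_row A) \<and>
        U * mat_adjoint U = 1\<^sub>m (dim_row A) \<and>
        A = U * mat_diag (dim_row A) (\<lambda>i. complex_of_real (d i)) * mat_adjoint U \<and>
        X = U * mat_diag (dim_row A) (\<lambda>i. complex_of_real (f (d i))) * mat_adjoint U)"

text \<open>A function on \<open>(0,\<infinity>)\<close> is a \<open>real \<Rightarrow> real\<close> function whose values elsewhere are irrelevant.\<close>

definition matrix_monotone :: "(real \<Rightarrow> real) \<Rightarrow> bool" where
  "matrix_monotone f \<longleftrightarrow>
     (\<forall>n A B. pos_def n A \<and> pos_def n B \<and> loewner_le n A B \<longrightarrow>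
        loewner_le n (herm_fun f A) (herm_fun f B))"

definition mean_function :: "(real \<Rightarrow> real) \<Rightarrow> bool" where
  "mean_function f \<longleftrightarrow> (\<forall>x>0. f x > 0) \<and> f 1 = 1 \<and> matrix_monotone f"

definition pos_mean :: "(real \<Rightarrow> real) \<Rightarrow> complex mat \<Rightarrow> complex mat \<Rightarrow> complex mat" where
  "pos_mean f A B =
     (let S = herm_fun sqrt A; T = inv_mat S in S * herm_fun f (T * B * T) * S)"

definition symmetric_mean :: "(real \<Rightarrow> real) \<Rightarrow> bool" where
  "symmetric_mean f \<longleftrightarrow> mean_function f \<and>
     (\<forall>n A B. pos_def n A \<and> pos_def n B \<longrightarrow> pos_mean f A B = pos_mean f B A)"

text \<open>
  The mean \<open>\<sigma>\<close> and the means \<open>\<sigma>\<^sub>t\<close> are given by their representing functions \<open>f\<close> and \<open>g t\<close>.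
\<close>

definition interpolational_path :: "(real \<Rightarrow> real) \<Rightarrow> (real \<Rightarrow> real \<Rightarrow> real) \<Rightarrow> bool" where
  "interpolational_path f g \<longleftrightarrow>
     (\<forall>t \<in> {0..1}. mean_function (g t)) \<and>
     (\<forall>n A B. pos_def n A \<and> pos_def n B \<longrightarrow>
        pos_mean (g 0) A B = A \<and> pos_mean (g 1) A B = B \<and>
        pos_mean (g (1 / 2)) A B = pos_mean f A B \<and>
        (\<forall>a \<in> {0..1}. \<forall>b \<in> {0..1}.
           pos_mean f (pos_mean (g a) A B) (pos_mean (g b) A B) =
           pos_mean (g ((a + b) / 2)) A B) \<and>
        (\<forall>a \<in> {0..1}.
           ((\<lambda>b. op_norm (pos_mean (g b) A B - pos_mean (g a) A B)) \<longlongrightarrow> 0) (at a within {0..1})))"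


subsection \<open>Holomorphic functional calculus and means of accretive matrices\<close>

text \<open>The domain is the complex plane without \<open>(-\<infinity>,0]\<close>; the extension is unique there.\<close>

definition analytic_ext :: "(real \<Rightarrow> real) \<Rightarrow> complex \<Rightarrow> complex" where
  "analytic_ext f =
     (SOME F. F holomorphic_on (- \<real>\<^sub>\<le>\<^sub>0) \<and> (\<forall>x>0. F (complex_of_real x) = complex_of_real (f x)))"

text \<open>
  The curve is traversed counterclockwise; as it lies in the simply connected slit plane, so does
  its interior.
\<close>

definition surrounds_eigenvalues :: "(real \<Rightarrow> complex) \<Rightarrow> complex mat \<Rightarrow> bool" where
  "surrounds_eigenvalues \<gamma> X \<longleftrightarrow>
     valid_path \<gamma> \<and> simple_path \<gamma> \<and> pathfinish \<gamma> = pathstart \<gamma> \<and>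
     path_image \<gamma> \<subseteq> - \<real>\<^sub>\<le>\<^sub>0 \<and>
     (\<forall>k. eigenvalue X k \<longrightarrow> k \<notin> path_image \<gamma> \<and> winding_number \<gamma> k = 1)"

text \<open>
  For \<open>X\<close> without eigenvalues in \<open>(-\<infinity>,0]\<close> and \<open>F\<close> holomorphic on the slit plane such a curve
  exists and, by Cauchy's theorem, the integral (taken entrywise) does not depend on it.
\<close>

definition hol_fun :: "(complex \<Rightarrow> complex) \<Rightarrow> complex mat \<Rightarrow> complex mat" where
  "hol_fun F X =
     (let n = dim_row X; \<gamma> = (SOME \<gamma>. surrounds_eigenvalues \<gamma> X)
      in mat n n (\<lambda>(i, j). 1 / (2 * complex_of_real pi * \<i>) *
           contour_integral \<gamma> (\<lambda>z. F z * (inv_mat (z \<cdot>\<^sub>m 1\<^sub>m n - X) $$ (i, j)))))"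

text \<open>The unique square root with spectrum in the open right half-plane.\<close>

definition principal_sqrt :: "complex mat \<Rightarrow> complex mat" where
  "principal_sqrt A =
     (SOME S. S \<in> carrier_mat (dim_row A) (dim_row A) \<and> S * S = A \<and>
        (\<forall>k. eigenvalue S k \<longrightarrow> 0 < Re k))"

definition acc_mean :: "(real \<Rightarrow> real) \<Rightarrow> complex mat \<Rightarrow> complex mat \<Rightarrow> complex mat" where
  "acc_mean f A B =
     (let S = principal_sqrt A; T = inv_mat S in S * hol_fun (analytic_ext f) (T * B * T) * S)"

end

(*
  For positive definite matrices P, Q a simultaneous diagonalisation by congruence reduces
  P nabla_t Q <= P sigma_t Q + 2R (P nabla Q - P sigma Q) to numbers; there it follows because
  t |-> g_t(x) is midpoint convex (a symmetric mean lies below the arithmetic one) and continuous.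
  It remains to see Re (A sigma_t B) >= (Re A) sigma_t (Re B) for accretive A, B.  For a weighted
  harmonic mean A (sA + (1-s)B)^-1 B this is Cauchy-Schwarz applied to a splitting of the quadratic
  form.  A general mean is a limit of convex combinations of harmonic means, which is a weak form of
  Loewner's theorem and is obtained without an integral representation: matrix monotonicity, tested
  on a diagonal matrix and a rank one perturbation with interlacing spectrum, makes certain divided
  differences of a^2 f nonnegative; hence the functional that evaluates f on finitely many nodes is
  nonnegative on polynomials nonnegative on [0,oo), so f cannot be separated from the kernels
  x / (s + (1-s)x) on the nodes.  Montel's theorem turns the approximants into locally uniform
  approximation of the analytic extension, and the Cauchy integral passes to the limit.
*)
theory Submission
  imports Defs "Jordan_Normal_Form.Spectral_Radius"
begin

section \<open>Adjoints and unitary matrices\<close>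

text \<open>The rank one test leaves a whole polynomial \<open>a\<close> free, and this is what
  produces squares. On the half-line squares alone do not generate the nonnegative polynomials: the
  multiples \<open>X b^2\<close> are needed as well. Both kinds are obtained on the same odd set of
  nodes, by adding one more node and sending it to 0 or to infinity. Kernels and polynomials meet in
  the substitution \<open>u = s / (1 - s)\<close>: clearing denominators in a combination of kernels
  leaves a polynomial in \<open>u \<ge> 0\<close>. The node 1, where \<open>f\<close> and all
  kernels equal 1, turns affine into linear separation. Several notions are given by choice
  (\<open>herm_fun\<close>, \<open>analytic_ext\<close>, the curve in \<open>hol_fun\<close>,
  \<open>principal_sqrt\<close>), so each needs an existence proof before anything is known about
  it. The two estimates fit together because one congruence diagonalises both real parts and all
  their means. The factor \<open>2 R\<close> arises from evaluating at 1/2 the chord of the scalar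
  path between \<open>t\<close> and the farther end of the interval.\<close>

lemma mat_adjoint_dim [simp]:
  "dim_row (mat_adjoint A) = dim_col A" "dim_col (mat_adjoint A) = dim_row A"
  by (auto simp: mat_adjoint_def)

lemma mat_adjoint_carrier [simp]: "mat_adjoint A \<in> carrier_mat n m \<longleftrightarrow> A \<in> carrier_mat m n"
  by (metis carrier_matD carrier_matI mat_adjoint_dim)

lemma mat_adjoint_index [simp]:
  fixes A :: "complex mat"
  assumes "i < dim_col A" "j < dim_row A"
  shows "mat_adjoint A $$ (i, j) = cnj (A $$ (j, i))"
  using assms by (simp add: mat_adjoint_def mat_of_rows_def)

lemma mat_adjoint_adjoint [simp]: "mat_adjoint (mat_adjoint A) = (A :: complex mat)"
  by (rule eq_matI) auto

lemma mat_adjoint_mult: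
  fixes A B :: "complex mat"
  assumes "A \<in> carrier_mat n m" "B \<in> carrier_mat m k"
  shows "mat_adjoint (A * B) = mat_adjoint B * mat_adjoint A"
  using assms by (intro eq_matI) (auto simp: scalar_prod_def mult.commute)

lemma mat_adjoint_add:
  fixes A B :: "complex mat"
  assumes "A \<in> carrier_mat n m" "B \<in> carrier_mat n m"
  shows "mat_adjoint (A + B) = mat_adjoint A + mat_adjoint B"
  using assms by (intro eq_matI) auto

lemma mat_adjoint_minus:
  fixes A B :: "complex mat"
  assumes "A \<in> carrier_mat n m" "B \<in> carrier_mat n m"
  shows "mat_adjoint (A - B) = mat_adjoint A - mat_adjoint B"
  using assms by (intro eq_matI) auto

lemma mat_adjoint_smult: "mat_adjoint (c \<cdot>\<^sub>m A) = cnj c \<cdot>\<^sub>m mat_adjoint (A :: complex mat)"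
  by (intro eq_matI) auto

lemma mat_adjoint_one [simp]: "mat_adjoint (1\<^sub>m n) = (1\<^sub>m n :: complex mat)"
  by (intro eq_matI) auto

lemma mat_adjoint_diag [simp]: "mat_adjoint (mat_diag n d) = mat_diag n (\<lambda>i. cnj (d i))"
  by (intro eq_matI) (auto simp: mat_diag_def)

lemma mult_mat_vec_cscalar:
  fixes A :: "complex mat"
  assumes A: "A \<in> carrier_mat n m" and v: "v \<in> carrier_vec m" and w: "w \<in> carrier_vec n"
  shows "(A *\<^sub>v v) \<bullet>c w = v \<bullet>c (mat_adjoint A *\<^sub>v w)"
proof -
  have "(A *\<^sub>v v) \<bullet>c w = (\<Sum>i<n. \<Sum>j<m. A $$ (i,j) * v $ j * cnj (w $ i))"
    using assms by (simp add: scalar_prod_def atLeast0LessThan sum_distrib_right)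
  also have "\<dots> = (\<Sum>j<m. \<Sum>i<n. A $$ (i,j) * v $ j * cnj (w $ i))"
    by (rule sum.swap)
  also have "\<dots> = v \<bullet>c (mat_adjoint A *\<^sub>v w)"
    using assms by (simp add: scalar_prod_def atLeast0LessThan sum_distrib_left mult_ac)
  finally show ?thesis .
qed

lemma cscalar_prod_swap:
  fixes v w :: "complex vec"
  assumes "v \<in> carrier_vec n" "w \<in> carrier_vec n"
  shows "w \<bullet>c v = cnj (v \<bullet>c w)"
  using assms by (simp add: scalar_prod_def mult.commute)

lemma cscalar_prod_self:
  fixes v :: "complex vec"
  assumes "v \<in> carrier_vec n"
  shows "v \<bullet>c v = complex_of_real (\<Sum>i<n. (cmod (v $ i))\<^sup>2)"
  using assms by (simp add: scalar_prod_def complex_norm_square[symmetric] atLeast0LessThan)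

lemma cscalar_prod_self_pos:
  fixes v :: "complex vec"
  assumes "v \<in> carrier_vec n" "v \<noteq> 0\<^sub>v n"
  shows "0 < Re (v \<bullet>c v)"
proof -
  have "\<exists>i<n. v $ i \<noteq> 0"
    using assms by (metis carrier_vecD eq_vecI index_zero_vec(1) index_zero_vec(2))
  then show ?thesis
    using assms(1) by (auto simp: cscalar_prod_self intro!: sum_pos2)
qed

lemma hermitian_index:
  assumes "hermitian A" "A \<in> carrier_mat n n" "i < n" "j < n"
  shows "A $$ (i, j) = cnj (A $$ (j, i))"
  using assms mat_adjoint_index[of i A j] by (simp add: hermitian_def)

section \<open>Unitary matrices with a prescribed first column\<close>

definition unitary_mat :: "nat \<Rightarrow> complex mat \<Rightarrow> bool" where
  "unitary_mat n U \<longleftrightarrow> U \<in> carrier_mat n n \<and> U * mat_adjoint U = 1\<^sub>m n"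

lemma unitary_matD:
  assumes "unitary_mat n U"
  shows "U \<in> carrier_mat n n" "U * mat_adjoint U = 1\<^sub>m n" "mat_adjoint U * U = 1\<^sub>m n"
proof -
  show U: "U \<in> carrier_mat n n" and *: "U * mat_adjoint U = 1\<^sub>m n"
    using assms unfolding unitary_mat_def by blast+
  have "mat_adjoint U \<in> carrier_mat n n" using U by simp
  from mat_mult_left_right_inverse[OF U this *] show "mat_adjoint U * U = 1\<^sub>m n" .
qed

lemma unitary_mat_mult:
  assumes "unitary_mat n U" "unitary_mat n V"
  shows "unitary_mat n (U * V)"
proof -
  note U = unitary_matD[OF assms(1)] and V = unitary_matD[OF assms(2)]
  have aU: "mat_adjoint U \<in> carrier_mat n n" and aV: "mat_adjoint V \<in> carrier_mat n n"
    using U V by auto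
  have "U * V * mat_adjoint (U * V) = U * V * (mat_adjoint V * mat_adjoint U)"
    by (simp only: mat_adjoint_mult[OF U(1) V(1)])
  also have "\<dots> = U * (V * mat_adjoint V * mat_adjoint U)"
    by (simp only: assoc_mult_mat[OF U(1) V(1) mult_carrier_mat[OF aV aU]] assoc_mult_mat[OF V(1) aV aU])
  also have "\<dots> = 1\<^sub>m n" unfolding V(2) left_mult_one_mat[OF aU] by (rule U(2))
  finally show ?thesis using mult_carrier_mat[OF U(1) V(1)] unfolding unitary_mat_def by blast
qed

text \<open>Gram-Schmidt leaves the first vector of a basis unchanged. So \<open>v\<close> is
  completed to a basis, which is orthogonalised and then normalised to give the columns of
  \<open>W\<close>.\<close>

lemma exists_unitary_first_col:
  fixes v :: "complex vec"
  assumes v: "v \<in> carrier_vec n" and v0: "v \<noteq> 0\<^sub>v n"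
  shows "\<exists>W c. unitary_mat n W \<and> col W 0 = c \<cdot>\<^sub>v v \<and> c \<noteq> 0"
proof -
  interpret cof_vec_space n "TYPE(complex)" .
  have n: "0 < n" using v v0 by (cases n) auto
  define b where "b = basis_completion v"
  from basis_completion[OF v v0, folded b_def]
  have dist_b: "distinct b" and indep: "\<not> lin_dep (set b)" and b: "set b \<subseteq> carrier_vec n"
    and hdb: "hd b = v" and len_b: "length b = n" by auto
  define ws where "ws = gram_schmidt n b"
  from gram_schmidt_result[OF b dist_b indep ws_def]
  have ws: "set ws \<subseteq> carrier_vec n" "corthogonal ws" "length ws = n"
    by (auto simp: len_b)
  obtain bs where "b = v # bs" using hdb len_b n by (cases b) auto
  with gram_schmidt_hd[OF v, of bs] ws(3) n have ws0: "ws ! 0 = v"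
    by (metis hd_conv_nth length_greater_0_conv ws_def)
  define nr where "nr i = sqrt (Re (ws ! i \<bullet>c ws ! i))" for i
  have wsc: "ws ! i \<in> carrier_vec n" if "i < n" for i using ws that by auto
  have ort: "ws ! i \<bullet>c ws ! j = 0 \<longleftrightarrow> i \<noteq> j" if "i < n" "j < n" for i j
    using corthogonalD[OF ws(2)] ws(3) that by auto
  have pos: "0 < Re (ws ! i \<bullet>c ws ! i)" if "i < n" for i
    using cscalar_prod_self_pos[OF wsc[OF that]] ort[OF that that] wsc[OF that]
    by (metis conjugate_zero_vec scalar_prod_right_zero)
  have sq: "ws ! i \<bullet>c ws ! i = complex_of_real (nr i) * complex_of_real (nr i)" if "i < n" for i
    using pos[OF that] cscalar_prod_self[OF wsc[OF that]]
    by (simp add: nr_def flip: of_real_mult)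
  have nrpos: "0 < nr i" if "i < n" for i using pos[OF that] by (simp add: nr_def)
  define W where "W = Matrix.mat n n (\<lambda>(k, i). ws ! i $ k / complex_of_real (nr i))"
  have W: "W \<in> carrier_mat n n" by (simp add: W_def)
  have "mat_adjoint W * W = 1\<^sub>m n"
  proof (rule eq_matI)
    fix i j assume "i < dim_row (1\<^sub>m n :: complex mat)" "j < dim_col (1\<^sub>m n :: complex mat)"
    then have ij: "i < n" "j < n" by auto
    have "(mat_adjoint W * W) $$ (i, j) =
       (\<Sum>k<n. cnj (ws ! i $ k) / nr i * (ws ! j $ k / nr j))"
      using ij W by (simp add: scalar_prod_def W_def atLeast0LessThan)
    also have "\<dots> = (ws ! j \<bullet>c ws ! i) / (complex_of_real (nr i) * nr j)"
      using wsc[OF ij(1)] wsc[OF ij(2)]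
      by (simp add: scalar_prod_def atLeast0LessThan sum_divide_distrib mult.commute)
    also have "\<dots> = 1\<^sub>m n $$ (i, j)"
      using ort[OF ij(2,1)] sq[OF ij(1)] nrpos[OF ij(1)] ij by (cases "i = j") auto
    finally show "(mat_adjoint W * W) $$ (i, j) = 1\<^sub>m n $$ (i, j)" .
  qed (auto simp: W_def)
  then have "W * mat_adjoint W = 1\<^sub>m n"
    using mat_mult_left_right_inverse[of "mat_adjoint W" n W] W by auto
  moreover have "col W 0 = (1 / complex_of_real (nr 0)) \<cdot>\<^sub>v v"
    using v n ws0 by (intro eq_vecI) (auto simp: W_def)
  moreover have "1 / complex_of_real (nr 0) \<noteq> 0" using nrpos[OF n] by simp
  ultimately show ?thesis using W unfolding unitary_mat_def by blast
qed

section \<open>Spectral theorem\<close>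

lemma mat_adjoint_block_diag:
  fixes A D :: "complex mat"
  assumes "A \<in> carrier_mat n n" "D \<in> carrier_mat m m"
  shows "mat_adjoint (four_block_mat A (0\<^sub>m n m) (0\<^sub>m m n) D) =
    four_block_mat (mat_adjoint A) (0\<^sub>m n m) (0\<^sub>m m n) (mat_adjoint D)"
  using assms by (intro eq_matI) auto

lemma mult_block_diag:
  fixes A A' D D' :: "complex mat"
  assumes "A \<in> carrier_mat n n" "D \<in> carrier_mat m m" "A' \<in> carrier_mat n n" "D' \<in> carrier_mat m m"
  shows "four_block_mat A (0\<^sub>m n m) (0\<^sub>m m n) D * four_block_mat A' (0\<^sub>m n m) (0\<^sub>m m n) D' =
    four_block_mat (A * A') (0\<^sub>m n m) (0\<^sub>m m n) (D * D')"
proof -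
  have "A * A' \<in> carrier_mat n n" "D * D' \<in> carrier_mat m m" using assms by auto
  with assms show ?thesis
    by (subst mult_four_block_mat[where ?nr1.0 = n and ?n1.0 = n and ?n2.0 = m and ?nr2.0 = m
          and ?nc1.0 = n and ?nc2.0 = m]) simp_all
qed

lemma hermitian_conj:
  assumes "hermitian A" "A \<in> carrier_mat n n" "W \<in> carrier_mat n m"
  shows "hermitian (mat_adjoint W * A * W)"
proof -
  have W': "mat_adjoint W \<in> carrier_mat m n" using assms by simp
  have "mat_adjoint (mat_adjoint W * A * W) = mat_adjoint W * (mat_adjoint A * W)"
    by (simp add: mat_adjoint_mult[OF mult_carrier_mat[OF W' assms(2)] assms(3)]
        mat_adjoint_mult[OF W' assms(2)])
  also have "\<dots> = mat_adjoint W * A * W"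
    using assms(1) assoc_mult_mat[OF W' assms(2,3)] by (simp add: hermitian_def)
  finally show ?thesis by (simp add: hermitian_def)
qed

text \<open>Induction on the size: a unitary \<open>W\<close> whose first column is an eigenvector
  reduces the first column of \<open>A'\<close> to the eigenvalue followed by zeros. Hermitian
  symmetry clears the first row too, and the remaining block \<open>B\<close> is Hermitian of size
  \<open>n\<close>.\<close>

theorem hermitian_spectral:
  assumes "A \<in> carrier_mat n n" "hermitian A"
  shows "\<exists>U d. unitary_mat n U \<and>
    A = U * mat_diag n (\<lambda>i. complex_of_real (d i)) * mat_adjoint U"
  using assms
proof (induction n arbitrary: A)
  case 0
  have "unitary_mat 0 (1\<^sub>m 0)" by (auto simp: unitary_mat_def)
  moreover have "A = 1\<^sub>m 0 * mat_diag 0 (\<lambda>i. complex_of_real (0::real)) * mat_adjoint (1\<^sub>m 0)"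
    using 0 by (intro eq_matI) auto
  ultimately show ?case by (intro exI[of _ "1\<^sub>m 0"] exI[of _ "\<lambda>_. 0"]) blast
next
  case (Suc n)
  note A = Suc.prems(1)
  obtain e where "e \<in> spectrum A" using spectrum_non_empty[OF A] by auto
  then obtain v where v: "v \<in> carrier_vec (Suc n)" "v \<noteq> 0\<^sub>v (Suc n)" "A *\<^sub>v v = e \<cdot>\<^sub>v v"
    using A unfolding spectrum_def eigenvalue_def eigenvector_def by auto
  obtain W c where W: "unitary_mat (Suc n) W" "col W 0 = c \<cdot>\<^sub>v v" "c \<noteq> 0"
    using exists_unitary_first_col[OF v(1,2)] by blast
  note Wc = unitary_matD(1)[OF W(1)]
  have W': "mat_adjoint W \<in> carrier_mat (Suc n) (Suc n)" using Wc by simp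
  define A' where "A' = mat_adjoint W * A * W"
  have A': "A' \<in> carrier_mat (Suc n) (Suc n)"
    unfolding A'_def using A Wc W' by (meson mult_carrier_mat)
  have hA': "hermitian A'" unfolding A'_def by (rule hermitian_conj[OF Suc.prems(2) A Wc])
  have "A * W \<in> carrier_mat (Suc n) (Suc n)" using A Wc by (rule mult_carrier_mat)
  have c0: "A' $$ (i, 0) = (if i = 0 then e else 0)" if i: "i < Suc n" for i
  proof -
    have "col (A * W) 0 = A *\<^sub>v col W 0"
      using col_mult2[OF A Wc, of 0] by simp
    also have "\<dots> = c \<cdot>\<^sub>v (A *\<^sub>v v)"
      unfolding W(2) by (rule mult_mat_vec[OF A v(1)])
    also have "\<dots> = e \<cdot>\<^sub>v col W 0" unfolding v(3) W(2) by (simp add: smult_smult_assoc mult.commute)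
    finally have *: "col (A * W) 0 = e \<cdot>\<^sub>v col W 0" .
    have "A' $$ (i, 0) = (mat_adjoint W * (A * W)) $$ (i, 0)"
      unfolding A'_def by (simp only: assoc_mult_mat[OF W' A Wc])
    also have "\<dots> = row (mat_adjoint W) i \<bullet> col (A * W) 0"
      using i Wc A by simp
    also have "\<dots> = e * (row (mat_adjoint W) i \<bullet> col W 0)"
      unfolding * using Wc by (intro scalar_prod_smult_distrib[of _ "Suc n"] carrier_vecI) simp_all
    also have "row (mat_adjoint W) i \<bullet> col W 0 = (mat_adjoint W * W) $$ (i, 0)"
      using i Wc by simp
    also have "\<dots> = (if i = 0 then 1 else 0)"
      unfolding unitary_matD(3)[OF W(1)] using i by simp
    finally show ?thesis by simp
  qed
  have r0: "A' $$ (0, i) = (if i = 0 then cnj e else 0)" if i: "i < Suc n" for i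
    using hermitian_index[OF hA' A', of 0 i] c0[OF i] i by simp
  \<comment> \<open>The corner entry of \<open>A'\<close> is \<open>e\<close> by its column and
    \<open>cnj e\<close> by its row, so the eigenvalue is real.\<close>
  have e: "complex_of_real (Re e) = e" and ce: "cnj e = e"
    using c0[of 0] r0[of 0] by (simp_all add: complex_eq_iff)
  define B where "B = Matrix.mat n n (\<lambda>(i, j). A' $$ (Suc i, Suc j))"
  have B: "B \<in> carrier_mat n n" by (simp add: B_def)
  have "hermitian B" unfolding hermitian_def
  proof (rule eq_matI)
    fix i j assume "i < dim_row B" "j < dim_col B"
    then show "mat_adjoint B $$ (i, j) = B $$ (i, j)"
      using hermitian_index[OF hA' A', of "Suc i" "Suc j"] by (simp add: B_def)
  qed (auto simp: B_def)
  then obtain V d where V: "unitary_mat n V"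
    and BV: "B = V * mat_diag n (\<lambda>i. complex_of_real (d i)) * mat_adjoint V"
    using Suc.IH[OF B] by blast
  note Vc = unitary_matD(1)[OF V]
  have V': "mat_adjoint V \<in> carrier_mat n n" using Vc by simp
  define E where "E = mat_diag 1 (\<lambda>i. complex_of_real (Re e))"
  have E: "E \<in> carrier_mat 1 1" by (simp add: E_def)
  define D where "D = mat_diag n (\<lambda>i. complex_of_real (d i))"
  have D: "D \<in> carrier_mat n n" by (simp add: D_def)
  define blk :: "complex mat \<Rightarrow> complex mat \<Rightarrow> complex mat"
    where "blk X Y = four_block_mat X (0\<^sub>m 1 n) (0\<^sub>m n 1) Y" for X Y
  define d' where "d' i = (if i = 0 then Re e else d (i - 1))" for i
  have one: "1\<^sub>m 1 \<in> carrier_mat 1 (1::nat)" by simp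
  have "A' = blk E B"
    unfolding blk_def E_def using A' c0 r0 e ce
    by (intro eq_matI) (auto simp: B_def mat_diag_def)
  also have "\<dots> = blk (1\<^sub>m 1) V * blk E D * mat_adjoint (blk (1\<^sub>m 1) V)"
    unfolding blk_def mat_adjoint_block_diag[OF one Vc] mult_block_diag[OF one Vc E D]
    using mult_block_diag[OF mult_carrier_mat[OF one E] mult_carrier_mat[OF Vc D] one V'] E BV
    by (simp add: D_def)
  also have "blk E D = mat_diag (Suc n) (\<lambda>i. complex_of_real (d' i))"
    unfolding blk_def E_def D_def
    by (intro eq_matI) (auto simp: mat_diag_def d'_def)
  finally have A'eq: "A' = blk (1\<^sub>m 1) V * mat_diag (Suc n) (\<lambda>i. complex_of_real (d' i)) *
    mat_adjoint (blk (1\<^sub>m 1) V)" .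
  have blkV: "unitary_mat (Suc n) (blk (1\<^sub>m 1) V)"
  proof -
    have "blk (1\<^sub>m 1) V * mat_adjoint (blk (1\<^sub>m 1) V) = blk (1\<^sub>m 1) (1\<^sub>m n)"
      unfolding blk_def mat_adjoint_block_diag[OF one Vc]
      using mult_block_diag[OF one Vc one V'] unitary_matD(2)[OF V] by simp
    also have "\<dots> = 1\<^sub>m (Suc n)" unfolding blk_def by (intro eq_matI) auto
    finally show ?thesis using Vc unfolding unitary_mat_def blk_def
      by (metis four_block_carrier_mat one plus_1_eq_Suc)
  qed
  define X where "X = blk (1\<^sub>m 1) V"
  define F where "F = mat_diag (Suc n) (\<lambda>i. complex_of_real (d' i))"
  have F: "F \<in> carrier_mat (Suc n) (Suc n)" by (simp add: F_def)
  have Xc: "X \<in> carrier_mat (Suc n) (Suc n)" using unitary_matD(1)[OF blkV] by (simp add: X_def)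
  have X': "mat_adjoint X \<in> carrier_mat (Suc n) (Suc n)" using Xc by simp
  have "A = (W * mat_adjoint W) * A * (W * mat_adjoint W)"
    using A by (simp add: unitary_matD(2)[OF W(1)])
  also have "\<dots> = W * A' * mat_adjoint W"
    unfolding A'_def
    using A W' Wc X' Xc F
    by (simp add: assoc_mult_mat[of _ "Suc n" "Suc n" _ "Suc n" _ "Suc n"] mult_carrier_mat[of _ "Suc n" "Suc n"])
  also have "\<dots> = W * (X * F * mat_adjoint X) * mat_adjoint W"
    unfolding A'eq X_def F_def ..
  also have "\<dots> = (W * X) * F * (mat_adjoint X * mat_adjoint W)"
    using A W' Wc X' Xc F
    by (simp add: assoc_mult_mat[of _ "Suc n" "Suc n" _ "Suc n" _ "Suc n"] mult_carrier_mat[of _ "Suc n" "Suc n"])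
  also have "mat_adjoint X * mat_adjoint W = mat_adjoint (W * X)"
    by (rule mat_adjoint_mult[OF Wc Xc, symmetric])
  finally have "A = (W * X) * F * mat_adjoint (W * X)" .
  then show ?case
    using unitary_mat_mult[OF W(1) blkV] unfolding X_def F_def by blast
qed

section \<open>Quadratic forms and functions of Hermitian matrices\<close>

text \<open>The real part makes the form blind to the skew-Hermitian part: \<open>A\<close> and
  \<open>re_mat A\<close> have the same form. Loewner inequalities between real parts can therefore
  be checked on the accretive matrices themselves.\<close>

definition qform :: "complex mat \<Rightarrow> complex vec \<Rightarrow> real" where
  "qform A v = Re ((A *\<^sub>v v) \<bullet>c v)"

lemma qform_add:
  assumes "A \<in> carrier_mat n n" "B \<in> carrier_mat n n" "v \<in> carrier_vec n"
  shows "qform (A + B) v = qform A v + qform B v"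
  using assms add_scalar_prod_distrib[of "A *\<^sub>v v" n "B *\<^sub>v v" "conjugate v"]
  by (simp add: qform_def add_mult_distrib_mat_vec[of _ n n])

lemma qform_smult:
  assumes "A \<in> carrier_mat n n" "v \<in> carrier_vec n"
  shows "qform (complex_of_real c \<cdot>\<^sub>m A) v = c * qform A v"
proof -
  have "(complex_of_real c \<cdot>\<^sub>m A) *\<^sub>v v = complex_of_real c \<cdot>\<^sub>v (A *\<^sub>v v)"
    using assms by (intro eq_vecI) (auto simp: scalar_prod_def sum_distrib_left mult_ac)
  then show ?thesis
    using assms smult_scalar_prod_distrib[of "A *\<^sub>v v" n "conjugate v" "complex_of_real c"]
    by (simp add: qform_def)
qed

lemma qform_minus:
  assumes "A \<in> carrier_mat n n" "B \<in> carrier_mat n n" "v \<in> carrier_vec n"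
  shows "qform (A - B) v = qform A v - qform B v"
proof -
  have "A - B = A + complex_of_real (- 1) \<cdot>\<^sub>m B" using assms by (intro eq_matI) auto
  then show ?thesis
    using qform_add[of A n "complex_of_real (- 1) \<cdot>\<^sub>m B" v] qform_smult[of B n v "- 1"] assms by simp
qed

lemma qform_adjoint:
  assumes "A \<in> carrier_mat n n" "v \<in> carrier_vec n"
  shows "qform (mat_adjoint A) v = qform A v"
proof -
  have A': "mat_adjoint A \<in> carrier_mat n n" using assms by simp
  have "(mat_adjoint A *\<^sub>v v) \<bullet>c v = v \<bullet>c (A *\<^sub>v v)"
    using mult_mat_vec_cscalar[OF A' assms(2,2)] by simp
  also have "\<dots> = cnj ((A *\<^sub>v v) \<bullet>c v)"
    using assms by (intro cscalar_prod_swap[of _ n]) auto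
  finally show ?thesis by (simp add: qform_def)
qed

lemma re_mat_carrier [simp]: "A \<in> carrier_mat n n \<Longrightarrow> re_mat A \<in> carrier_mat n n"
  by (simp add: re_mat_def)

lemma hermitian_re_mat:
  assumes "A \<in> carrier_mat n n"
  shows "hermitian (re_mat A)"
  using assms unfolding hermitian_def re_mat_def by (intro eq_matI) auto

lemma qform_re_mat:
  assumes "A \<in> carrier_mat n n" "v \<in> carrier_vec n"
  shows "qform (re_mat A) v = qform A v"
proof -
  have A': "mat_adjoint A \<in> carrier_mat n n" using assms by simp
  have "re_mat A = complex_of_real (1/2) \<cdot>\<^sub>m (A + mat_adjoint A)" by (simp add: re_mat_def)
  then show ?thesis
    using qform_smult[OF add_carrier_mat[OF A', of A] assms(2), of "1/2"] qform_add[OF assms(1) A' assms(2)]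
      qform_adjoint[OF assms] by simp
qed

lemma loewner_leI:
  assumes "A \<in> carrier_mat n n" "B \<in> carrier_mat n n" "hermitian A" "hermitian B"
    and "\<And>v. v \<in> carrier_vec n \<Longrightarrow> qform A v \<le> qform B v"
  shows "loewner_le n A B"
  unfolding loewner_le_def pos_semidef_def
  using assms qform_minus[of B n A] mat_adjoint_minus[of B n n A]
  by (auto simp: hermitian_def simp flip: qform_def)

lemma loewner_leD:
  assumes "loewner_le n A B" "v \<in> carrier_vec n"
  shows "qform A v \<le> qform B v"
  using assms qform_minus[of B n A v]
  unfolding loewner_le_def pos_semidef_def qform_def[symmetric] by auto

text \<open>\<open>G\<close> is an arbitrary square matrix. With unitary \<open>G\<close> this is a
  spectral decomposition, with invertible \<open>G\<close> a diagonalisation by congruence; the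
  quadratic form has the same formula in both cases.\<close>

definition cdiag :: "nat \<Rightarrow> complex mat \<Rightarrow> (nat \<Rightarrow> real) \<Rightarrow> complex mat" where
  "cdiag n G d = G * mat_diag n (\<lambda>i. complex_of_real (d i)) * mat_adjoint G"

lemma cdiag_carrier [simp]:
  assumes "G \<in> carrier_mat n n"
  shows "cdiag n G d \<in> carrier_mat n n"
proof -
  have "mat_adjoint G \<in> carrier_mat n n" using assms by simp
  then show ?thesis using assms unfolding cdiag_def by (meson mat_diag_dim mult_carrier_mat)
qed

lemma hermitian_cdiag:
  assumes G: "G \<in> carrier_mat n n"
  shows "hermitian (cdiag n G d)"
proof -
  have "hermitian (mat_diag n (\<lambda>i. complex_of_real (d i)))" by (simp add: hermitian_def)
  from hermitian_conj[OF this mat_diag_dim, of "mat_adjoint G" n] show ?thesis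
    using G by (simp add: cdiag_def)
qed

lemma qform_conj:
  assumes "A \<in> carrier_mat n n" "G \<in> carrier_mat n n" "v \<in> carrier_vec n"
  shows "qform (G * A * mat_adjoint G) v = qform A (mat_adjoint G *\<^sub>v v)"
proof -
  have G': "mat_adjoint G \<in> carrier_mat n n" using assms by simp
  define w where "w = mat_adjoint G *\<^sub>v v"
  have w: "w \<in> carrier_vec n" unfolding w_def using G' assms(3) by (rule mult_mat_vec_carrier)
  have Aw: "A *\<^sub>v w \<in> carrier_vec n" using assms(1) w by (rule mult_mat_vec_carrier)
  have "(G * A * mat_adjoint G) *\<^sub>v v = G *\<^sub>v (A *\<^sub>v w)"
    unfolding w_def
    by (simp only: assoc_mult_mat_vec[OF mult_carrier_mat[OF assms(2,1)] G' assms(3)]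
        assoc_mult_mat_vec[OF assms(2,1) mult_mat_vec_carrier[OF G' assms(3)]])
  then show ?thesis
    using mult_mat_vec_cscalar[OF assms(2) Aw assms(3)] by (simp add: qform_def w_def)
qed

lemma qform_diag:
  assumes "w \<in> carrier_vec n"
  shows "qform (mat_diag n (\<lambda>i. complex_of_real (d i))) w = (\<Sum>i<n. d i * (cmod (w $ i))\<^sup>2)"
proof -
  have "mat_diag n (\<lambda>i. complex_of_real (d i)) *\<^sub>v w = Matrix.vec n (\<lambda>i. complex_of_real (d i) * w $ i)"
    using assms
    by (intro eq_vecI) (auto simp: mat_diag_def scalar_prod_def if_distrib[of "\<lambda>x. x * _"] sum.delta cong: if_cong)
  moreover have "complex_of_real (d i) * w $ i * cnj (w $ i) = complex_of_real (d i * (cmod (w $ i))\<^sup>2)" for i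
    using complex_norm_square[of "w $ i"] by (simp add: mult.assoc)
  ultimately show ?thesis
    using assms by (simp add: qform_def scalar_prod_def atLeast0LessThan del: of_real_mult flip: of_real_sum)
qed

lemma qform_cdiag:
  assumes "G \<in> carrier_mat n n" "v \<in> carrier_vec n"
  shows "qform (cdiag n G d) v = (\<Sum>i<n. d i * (cmod ((mat_adjoint G *\<^sub>v v) $ i))\<^sup>2)"
proof -
  have "mat_adjoint G *\<^sub>v v \<in> carrier_vec n" using assms by (intro mult_mat_vec_carrier[of _ n n]) auto
  then show ?thesis unfolding cdiag_def
    by (subst qform_conj[OF mat_diag_dim assms]) (simp add: qform_diag)
qed

lemma hermitian_cdiag_exists:
  assumes "A \<in> carrier_mat n n" "hermitian A"
  shows "\<exists>U d. unitary_mat n U \<and> A = cdiag n U d"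
  using hermitian_spectral[OF assms] by (simp add: cdiag_def)

lemma cdiag_cong:
  assumes "\<And>i. i < n \<Longrightarrow> d i = e i"
  shows "cdiag n G d = cdiag n G e"
proof -
  have "mat_diag n (\<lambda>i. complex_of_real (d i)) = mat_diag n (\<lambda>i. complex_of_real (e i))"
    using assms by (intro eq_matI) (auto simp: mat_diag_def)
  then show ?thesis by (simp add: cdiag_def)
qed

lemma pos_def_cdiag_pos:
  assumes "pos_def n (cdiag n U d)" "unitary_mat n U" "i < n"
  shows "0 < d i"
proof -
  note U = unitary_matD[OF assms(2)]
  have U': "mat_adjoint U \<in> carrier_mat n n" using U(1) by simp
  define v where "v = U *\<^sub>v unit_vec n i"
  have v: "v \<in> carrier_vec n" unfolding v_def using U(1) by simp
  have "mat_adjoint U *\<^sub>v v = unit_vec n i"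
    unfolding v_def using assoc_mult_mat_vec[OF U' U(1), of "unit_vec n i"] U(3) by simp
  moreover have "v \<noteq> 0\<^sub>v n"
  proof
    assume "v = 0\<^sub>v n"
    then have "mat_adjoint U *\<^sub>v v = 0\<^sub>v n"
      using carrier_matD[OF U(1)] by (intro eq_vecI) (auto simp: scalar_prod_def)
    with \<open>mat_adjoint U *\<^sub>v v = unit_vec n i\<close> have "unit_vec n i $ i = (0\<^sub>v n :: complex vec) $ i" by simp
    then show False using assms(3) by simp
  qed
  ultimately have "0 < (\<Sum>j<n. d j * (cmod (unit_vec n i $ j :: complex))\<^sup>2)"
    using assms(1) v qform_cdiag[OF U(1) v, of d] unfolding pos_def_def qform_def[symmetric] by auto
  also have "\<dots> = (\<Sum>j<n. if j = i then d i else 0)"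
    using assms(3) by (intro sum.cong) auto
  finally show ?thesis using assms(3) by simp
qed

lemma pos_def_cdiag_exists:
  assumes "pos_def n A"
  shows "\<exists>U d. unitary_mat n U \<and> A = cdiag n U d \<and> (\<forall>i. 0 < d i)"
proof -
  have A: "A \<in> carrier_mat n n" "hermitian A" using assms by (auto simp: pos_def_def)
  obtain U d where U: "unitary_mat n U" "A = cdiag n U d"
    using hermitian_cdiag_exists[OF A] by blast
  \<comment> \<open>The values beyond the size of the matrix are set to 1, so that positivity holds
    for every index without a bound on \<open>i\<close>.\<close>
  have "A = cdiag n U (\<lambda>i. if i < n then d i else 1)" unfolding U(2) by (rule cdiag_cong) simp
  moreover have "0 < (if i < n then d i else 1)" for i
    using pos_def_cdiag_pos[OF _ U(1)] assms U(2) by auto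
  ultimately show ?thesis using U(1) by blast
qed

text \<open>\<open>W = V^H U\<close> intertwines the two diagonals, that is
  \<open>W(i,j) d_j = e_i W(i,j)\<close>. Where an entry is non-zero the two eigenvalues agree, so
  \<open>W\<close> intertwines the diagonals after applying \<open>f\<close> as well. This makes the
  choice in \<open>herm_fun\<close> harmless.\<close>

lemma cdiag_fun_unique:
  assumes U: "unitary_mat n U" and V: "unitary_mat n V" and eq: "cdiag n U d = cdiag n V e"
  shows "cdiag n U (\<lambda>i. f (d i)) = cdiag n V (\<lambda>i. f (e i))"
proof -
  note U = unitary_matD[OF U] and V = unitary_matD[OF V]
  have U': "mat_adjoint U \<in> carrier_mat n n" and V': "mat_adjoint V \<in> carrier_mat n n"
    using U V by auto
  note carr = U(1) V(1) U' V' mat_diag_dim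
  define dg where "dg h = mat_diag n (\<lambda>i. complex_of_real (h i))" for h
  have dg: "dg h \<in> carrier_mat n n" for h by (simp add: dg_def)
  define W where "W = mat_adjoint V * U"
  have W: "W \<in> carrier_mat n n" unfolding W_def using V' U(1) by (rule mult_carrier_mat)
  note assocs = assoc_mult_mat[of _ n n _ n _ n] mult_carrier_mat[of _ n n]
  have cU: "cdiag n U h = U * dg h * mat_adjoint U" for h by (simp add: cdiag_def dg_def)
  have cV: "cdiag n V h = V * dg h * mat_adjoint V" for h by (simp add: cdiag_def dg_def)
  have 1: "mat_adjoint V * cdiag n U h * U = W * dg h" for h
  proof -
    have "mat_adjoint V * cdiag n U h * U = W * dg h * (mat_adjoint U * U)"
      unfolding cU W_def using carr dg by (simp add: assocs)
    then show ?thesis unfolding U(3) right_mult_one_mat[OF mult_carrier_mat[OF W dg]] .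
  qed
  have 2: "mat_adjoint V * cdiag n V h * U = dg h * W" for h
  proof -
    have "mat_adjoint V * cdiag n V h * U = (mat_adjoint V * V) * (dg h * W)"
      unfolding cV W_def using carr dg by (simp add: assocs)
    then show ?thesis unfolding V(3) left_mult_one_mat[OF mult_carrier_mat[OF dg W]] .
  qed
  have 3: "W * dg d = dg e * W" using 1[of d] 2[of e] eq by simp
  have "W * dg (\<lambda>i. f (d i)) = dg (\<lambda>i. f (e i)) * W"
  proof (rule eq_matI)
    fix i j assume "i < dim_row (dg (\<lambda>i. f (e i)) * W)" "j < dim_col (dg (\<lambda>i. f (e i)) * W)"
    then have ij: "i < n" "j < n"
      using carrier_matD[OF W] carrier_matD[OF dg[of "\<lambda>i. f (e i)"]] by simp_all
    have "W $$ (i, j) * complex_of_real (d j) = complex_of_real (e i) * W $$ (i, j)"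
      using arg_cong[OF 3, of "\<lambda>M. M $$ (i, j)"] ij
      unfolding dg_def mat_diag_mult_right[OF W] mat_diag_mult_left[OF W] by simp
    then have "W $$ (i, j) = 0 \<or> d j = e i"
      by (metis mult.commute mult_cancel_left of_real_eq_iff)
    then show "(W * dg (\<lambda>i. f (d i))) $$ (i, j) = (dg (\<lambda>i. f (e i)) * W) $$ (i, j)"
      using ij unfolding dg_def mat_diag_mult_right[OF W] mat_diag_mult_left[OF W] by auto
  qed (use carrier_matD[OF W] carrier_matD[OF dg] in simp_all)
  then have *: "mat_adjoint V * cdiag n U (\<lambda>i. f (d i)) * U = mat_adjoint V * cdiag n V (\<lambda>i. f (e i)) * U"
    using 1 2 by simp
  have undo: "V * (mat_adjoint V * X * U) * mat_adjoint U = X" if X: "X \<in> carrier_mat n n" for X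
  proof -
    have "V * (mat_adjoint V * X * U) * mat_adjoint U = (V * mat_adjoint V) * X * (U * mat_adjoint U)"
      using carr X by (simp add: assocs)
    then show ?thesis using X by (simp add: U(2) V(2))
  qed
  show ?thesis
    using arg_cong[OF *, of "\<lambda>M. V * M * mat_adjoint U"] undo[OF cdiag_carrier[OF U(1)]]
      undo[OF cdiag_carrier[OF V(1)]] by simp
qed

lemma herm_fun_altdef:
  assumes "dim_row A = n"
  shows "herm_fun f A =
    (SOME X. \<exists>V e. unitary_mat n V \<and> A = cdiag n V e \<and> X = cdiag n V (\<lambda>i. f (e i)))"
  unfolding herm_fun_def unitary_mat_def cdiag_def assms conj_assoc ..

lemma herm_fun_cdiag:
  assumes "unitary_mat n U"
  shows "herm_fun f (cdiag n U d) = cdiag n U (\<lambda>i. f (d i))"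
proof -
  have dim: "dim_row (cdiag n U d) = n" using cdiag_carrier[OF unitary_matD(1)[OF assms], of d] by auto
  let ?P = "\<lambda>X. \<exists>V e. unitary_mat n V \<and> cdiag n U d = cdiag n V e \<and> X = cdiag n V (\<lambda>i. f (e i))"
  have "herm_fun f (cdiag n U d) = (SOME X. ?P X)"
    by (rule herm_fun_altdef[OF dim])
  moreover
  have "?P (cdiag n U (\<lambda>i. f (d i)))" using assms by blast
  then have "?P (SOME X. ?P X)" by (rule someI[of ?P])
  ultimately have "?P (herm_fun f (cdiag n U d))" by simp
  then show ?thesis using cdiag_fun_unique[OF assms] by metis
qed

lemma mult_cdiag_unitary:
  assumes "unitary_mat n U"
  shows "cdiag n U d * cdiag n U e = cdiag n U (\<lambda>i. d i * e i)"
proof -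
  note U = unitary_matD[OF assms]
  have U': "mat_adjoint U \<in> carrier_mat n n" using U by auto
  note assocs = assoc_mult_mat[of _ n n _ n _ n] mult_carrier_mat[of _ n n]
  let ?d = "\<lambda>h. mat_diag n (\<lambda>i. complex_of_real (h i))"
  have "cdiag n U d * cdiag n U e = U * ?d d * (mat_adjoint U * U) * ?d e * mat_adjoint U"
    unfolding cdiag_def using U(1) U' by (simp add: assocs)
  also have "\<dots> = U * (?d d * ?d e) * mat_adjoint U"
    unfolding U(3) using U(1) U'
    by (simp add: assocs left_mult_one_mat[of _ n n] right_mult_one_mat[of _ n n] del: mat_diag_diag)
  finally show ?thesis by (simp add: cdiag_def)
qed

lemma cdiag_unitary_one:
  assumes "unitary_mat n U"
  shows "cdiag n U (\<lambda>i. 1) = 1\<^sub>m n"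
  using unitary_matD[OF assms] by (simp add: cdiag_def)

lemma inv_mat_eqI:
  assumes "A \<in> carrier_mat n n" "B \<in> carrier_mat n n" "A * B = 1\<^sub>m n"
  shows "inv_mat A = B"
proof -
  have BA: "B * A = 1\<^sub>m n" using assms by (rule mat_mult_left_right_inverse)
  have "A \<in> Units (ring_mat TYPE(complex) n ())"
    unfolding Units_def ring_mat_def using assms BA by auto
  then obtain C where C: "mat_inverse A = Some C"
    using mat_inverse(1)[OF assms(1), of "()"] by (cases "mat_inverse A") auto
  note C' = mat_inverse(2)[OF assms(1) C]
  have "C = (B * A) * C" unfolding BA using C' by (simp add: left_mult_one_mat[of _ n n])
  also have "\<dots> = B * (A * C)" using assms C' by (intro assoc_mult_mat) auto
  also have "\<dots> = B" using C' assms(2) by simp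
  finally show ?thesis by (simp add: inv_mat_def C)
qed

lemma inv_mat_injective:
  assumes A: "A \<in> carrier_mat n n" and inj: "\<And>v. v \<in> carrier_vec n \<Longrightarrow> A *\<^sub>v v = 0\<^sub>v n \<Longrightarrow> v = 0\<^sub>v n"
  shows "inv_mat A \<in> carrier_mat n n" "A * inv_mat A = 1\<^sub>m n" "inv_mat A * A = 1\<^sub>m n"
proof -
  have "det A \<noteq> 0" using det_0_iff_vec_prod_zero[OF A] inj by blast
  from det_non_zero_imp_unit[OF A this, of "()"]
  obtain B where B: "B \<in> carrier_mat n n" "A * B = 1\<^sub>m n"
    unfolding Units_def ring_mat_def by auto
  show "inv_mat A \<in> carrier_mat n n" "A * inv_mat A = 1\<^sub>m n" "inv_mat A * A = 1\<^sub>m n"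
    unfolding inv_mat_eqI[OF A B] using B mat_mult_left_right_inverse[OF A B] by auto
qed

section \<open>Means of positive definite matrices\<close>

lemma cdiag_mult:
  assumes "S \<in> carrier_mat n n" "V \<in> carrier_mat n n"
  shows "S * cdiag n V d * mat_adjoint S = cdiag n (S * V) d"
proof -
  have "mat_adjoint S \<in> carrier_mat n n" "mat_adjoint V \<in> carrier_mat n n" using assms by auto
  then show ?thesis
    using assms unfolding cdiag_def mat_adjoint_mult[OF assms]
    by (simp add: assoc_mult_mat[of _ n n _ n _ n] mult_carrier_mat[of _ n n])
qed

lemma pos_def_conj:
  assumes B: "pos_def n B" and T: "T \<in> carrier_mat n n" and S: "S \<in> carrier_mat n n"
    and inv: "S * mat_adjoint T = 1\<^sub>m n"
  shows "pos_def n (T * B * mat_adjoint T)"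
proof -
  have T': "mat_adjoint T \<in> carrier_mat n n" using T by simp
  have Bc: "B \<in> carrier_mat n n" "hermitian B" using B by (auto simp: pos_def_def)
  have "hermitian (T * B * mat_adjoint T)" using hermitian_conj[OF Bc(2,1) T'] by simp
  moreover have "T * B * mat_adjoint T \<in> carrier_mat n n"
    using T T' Bc by (meson mult_carrier_mat)
  moreover have "0 < qform (T * B * mat_adjoint T) v"
    if v: "v \<in> carrier_vec n" "v \<noteq> 0\<^sub>v n" for v
  proof -
    have w: "mat_adjoint T *\<^sub>v v \<in> carrier_vec n" using T' v(1) by (rule mult_mat_vec_carrier)
    have "mat_adjoint T *\<^sub>v v \<noteq> 0\<^sub>v n"
    proof
      assume 0: "mat_adjoint T *\<^sub>v v = 0\<^sub>v n"
      have "v = S *\<^sub>v (mat_adjoint T *\<^sub>v v)"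
        using assoc_mult_mat_vec[OF S T' v(1)] inv v(1) by simp
      also have "\<dots> = 0\<^sub>v n" unfolding 0 using carrier_matD[OF S] by (intro eq_vecI) (auto simp: scalar_prod_def)
      finally show False using v(2) by simp
    qed
    moreover have "\<forall>w \<in> carrier_vec n. w \<noteq> 0\<^sub>v n \<longrightarrow> 0 < qform B w"
      using B unfolding pos_def_def qform_def by (elim conjE)
    ultimately show ?thesis
      unfolding qform_conj[OF Bc(1) T v(1)] using w by simp
  qed
  ultimately show ?thesis unfolding pos_def_def qform_def by blast
qed

lemma pos_def_cdiag:
  assumes "unitary_mat n U" "\<And>i. i < n \<Longrightarrow> 0 < d i"
  shows "pos_def n (cdiag n U d)"
proof -
  note U = unitary_matD[OF assms(1)]
  have "0 < qform (cdiag n U d) v" if v: "v \<in> carrier_vec n" "v \<noteq> 0\<^sub>v n" for v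
  proof -
    have U': "mat_adjoint U \<in> carrier_mat n n" using U by simp
    define w where "w = mat_adjoint U *\<^sub>v v"
    have w: "w \<in> carrier_vec n" unfolding w_def using U' v(1) by (rule mult_mat_vec_carrier)
    have "w \<noteq> 0\<^sub>v n"
    proof
      assume 0: "w = 0\<^sub>v n"
      have "v = U *\<^sub>v w"
        using assoc_mult_mat_vec[OF U(1) U' v(1)] U(2) v(1) by (simp add: w_def)
      also have "\<dots> = 0\<^sub>v n" unfolding 0 using carrier_matD[OF U(1)] by (intro eq_vecI) (auto simp: scalar_prod_def)
      finally show False using v(2) by simp
    qed
    then obtain i where "i < n" "w $ i \<noteq> 0"
      using w by (metis carrier_vecD eq_vecI index_zero_vec(1) index_zero_vec(2))
    then have "0 < (\<Sum>i<n. d i * (cmod (w $ i))\<^sup>2)"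
      using assms(2) by (intro sum_pos2[of _ i]) (auto simp: less_imp_le)
    then show ?thesis using qform_cdiag[OF U(1) v(1), of d] by (simp add: w_def)
  qed
  then show ?thesis
    using hermitian_cdiag[OF U(1)] cdiag_carrier[OF U(1)] unfolding pos_def_def qform_def by blast
qed

lemma pos_def_sqrt:
  assumes U: "unitary_mat n U" and a: "\<And>i. 0 < a i"
  shows "herm_fun sqrt (cdiag n U a) = cdiag n U (\<lambda>i. sqrt (a i))"
    and "inv_mat (cdiag n U (\<lambda>i. sqrt (a i))) = cdiag n U (\<lambda>i. 1 / sqrt (a i))"
    and "cdiag n U (\<lambda>i. sqrt (a i)) * cdiag n U (\<lambda>i. 1 / sqrt (a i)) = 1\<^sub>m n"
proof -
  note Uc = cdiag_carrier[OF unitary_matD(1)[OF U]]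
  have nz: "sqrt (a i) \<noteq> 0" for i using a[of i] by simp
  show "herm_fun sqrt (cdiag n U a) = cdiag n U (\<lambda>i. sqrt (a i))"
    by (rule herm_fun_cdiag[OF U])
  show *: "cdiag n U (\<lambda>i. sqrt (a i)) * cdiag n U (\<lambda>i. 1 / sqrt (a i)) = 1\<^sub>m n"
    unfolding mult_cdiag_unitary[OF U] using cdiag_unitary_one[OF U] nz by simp
  show "inv_mat (cdiag n U (\<lambda>i. sqrt (a i))) = cdiag n U (\<lambda>i. 1 / sqrt (a i))"
    by (rule inv_mat_eqI[OF Uc Uc *])
qed

text \<open>Simultaneous diagonalisation by congruence turns the mean into a scalar operation.\<close>

lemma pos_mean_cdiag:
  assumes "pos_def n A" "pos_def n B"
  obtains G H d where "G \<in> carrier_mat n n" "H \<in> carrier_mat n n" "G * H = 1\<^sub>m n"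
    "\<And>i. 0 < d i" "A = cdiag n G (\<lambda>i. 1)" "B = cdiag n G d"
    "\<And>f. pos_mean f A B = cdiag n G (\<lambda>i. f (d i))"
proof -
  obtain U a where U: "unitary_mat n U" and A: "A = cdiag n U a" and a: "\<And>i. 0 < a i"
    using pos_def_cdiag_exists[OF assms(1)] by blast
  note Uc = unitary_matD(1)[OF U]
  define S T where "S = cdiag n U (\<lambda>i. sqrt (a i))" and "T = cdiag n U (\<lambda>i. 1 / sqrt (a i))"
  note sq = pos_def_sqrt[of n U a, OF U a, folded A S_def T_def]
  have S: "S \<in> carrier_mat n n" "mat_adjoint S = S" and T: "T \<in> carrier_mat n n" "mat_adjoint T = T"
    using cdiag_carrier[OF Uc] hermitian_cdiag[OF Uc] unfolding S_def T_def hermitian_def by auto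
  have TS: "T * S = 1\<^sub>m n" using mat_mult_left_right_inverse[OF S(1) T(1) sq(3)] .
  have Bc: "B \<in> carrier_mat n n" using assms(2) by (simp add: pos_def_def)
  have "pos_def n (T * B * mat_adjoint T)"
    using pos_def_conj[OF assms(2) T(1) S(1)] sq(3) T(2) by simp
  then obtain V d where V: "unitary_mat n V" and TBT: "T * B * T = cdiag n V d" and d: "\<And>i. 0 < d i"
    using pos_def_cdiag_exists T(2) by metis
  note Vc = unitary_matD(1)[OF V]
  have V': "mat_adjoint V \<in> carrier_mat n n" using Vc by simp
  note assocs = assoc_mult_mat[of _ n n _ n _ n] mult_carrier_mat[of _ n n]
    left_mult_one_mat[of _ n n] right_mult_one_mat[of _ n n]
  \<comment> \<open>With \<open>S = A^(1/2)\<close> and \<open>T B T = V diag(d) V^H\<close>,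
    congruence by \<open>S V\<close> carries the identity to \<open>A\<close>,
    \<open>diag(d)\<close> to \<open>B\<close> and \<open>diag(f(d))\<close> to the mean, for all
    \<open>f\<close> at once.\<close>
  define G where "G = S * V"
  have G: "G \<in> carrier_mat n n" unfolding G_def using S(1) Vc by (rule mult_carrier_mat)
  have conj: "S * cdiag n V e * S = cdiag n G e" for e
    using cdiag_mult[OF S(1) Vc, of e] S(2) by (simp add: G_def)
  have "B = (S * T) * B * (T * S)" using Bc by (simp add: sq(3) TS assocs)
  also have "\<dots> = S * (T * B * T) * S" using S(1) T(1) Bc by (simp add: assocs)
  finally have B: "B = cdiag n G d" unfolding TBT conj .
  have "A = S * S"
    unfolding A S_def mult_cdiag_unitary[OF U] using a by (simp add: less_imp_le)
  also have "\<dots> = S * cdiag n V (\<lambda>i. 1) * S" using S(1) by (simp add: cdiag_unitary_one[OF V] assocs)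
  finally have A1: "A = cdiag n G (\<lambda>i. 1)" unfolding conj .
  have "G * (mat_adjoint V * T) = S * (V * mat_adjoint V) * T"
    unfolding G_def using S(1) T(1) Vc V' by (simp add: assocs)
  also have "\<dots> = 1\<^sub>m n" using S(1) sq(3) by (simp add: unitary_matD(2)[OF V] assocs)
  finally have GH: "G * (mat_adjoint V * T) = 1\<^sub>m n" .
  have "pos_mean f A B = cdiag n G (\<lambda>i. f (d i))" for f
    unfolding pos_mean_def Let_def sq(1,2) TBT herm_fun_cdiag[OF V] conj ..
  then show thesis
    using that[OF G mult_carrier_mat[OF V' T(1)] GH d A1 B] by blast
qed

lemma pos_mean_commuting:
  assumes U: "unitary_mat n U" and a: "\<And>i. 0 < a i"
  shows "pos_mean f (cdiag n U a) (cdiag n U b) = cdiag n U (\<lambda>i. a i * f (b i / a i))"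
proof -
  have *: "1 / sqrt (a i) * b i * (1 / sqrt (a i)) = b i / a i" "sqrt (a i) * c * sqrt (a i) = a i * c" for i c
    using a[of i] by (simp_all add: field_simps)
  show ?thesis
    unfolding pos_mean_def Let_def pos_def_sqrt(1,2)[of n U a, OF U a] mult_cdiag_unitary[OF U]
      herm_fun_cdiag[OF U] * ..
qed

section \<open>Scalar consequences drawn from matrices of size one\<close>

definition mat1 :: "real \<Rightarrow> complex mat" where
  "mat1 x = cdiag 1 (1\<^sub>m 1) (\<lambda>_. x)"

lemma unitary_mat_one: "unitary_mat n (1\<^sub>m n)"
  by (simp add: unitary_mat_def)

lemma mat1_index [simp]: "mat1 x $$ (0, 0) = complex_of_real x"
  by (simp add: mat1_def cdiag_def mat_diag_def)

lemma mat1_carrier [simp]: "mat1 x \<in> carrier_mat 1 1"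
  by (simp add: mat1_def)

lemma mat1_inject [simp]: "mat1 x = mat1 y \<longleftrightarrow> x = y"
  using mat1_index of_real_eq_iff by metis

lemma pos_def_mat1: "0 < x \<Longrightarrow> pos_def 1 (mat1 x)"
  unfolding mat1_def by (rule pos_def_cdiag[OF unitary_mat_one])

lemma pos_mean_mat1: "0 < x \<Longrightarrow> pos_mean f (mat1 x) (mat1 y) = mat1 (x * f (y / x))"
  unfolding mat1_def by (rule pos_mean_commuting[OF unitary_mat_one])

lemma op_norm_mat1: "\<bar>x - y\<bar> \<le> op_norm (mat1 x - mat1 y)"
proof -
  let ?M = "mat1 x - mat1 y"
  let ?F = "\<lambda>v. sqrt (Re ((?M *\<^sub>v v) \<bullet>c (?M *\<^sub>v v)))"
  let ?S = "{v \<in> carrier_vec (dim_col ?M). Re (v \<bullet>c v) \<le> 1}"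
  have dim: "dim_row (mat1 z) = 1" "dim_col (mat1 z) = 1" for z using mat1_carrier[of z] by auto
  have F: "?F v = \<bar>x - y\<bar> * cmod (v $ 0)" if "v \<in> carrier_vec 1" for v
  proof -
    have Mv: "?M *\<^sub>v v \<in> carrier_vec 1" using dim by (intro carrier_vecI) simp
    have "(?M *\<^sub>v v) $ 0 = complex_of_real (x - y) * v $ 0"
      using that dim by (simp add: scalar_prod_def row_def)
    then show ?thesis
      unfolding cscalar_prod_self[OF Mv] by (simp add: norm_mult flip: of_real_diff)
  qed
  have "bdd_above (?F ` ?S)"
  proof (rule bdd_aboveI2)
    fix v assume v: "v \<in> ?S"
    then have v1: "v \<in> carrier_vec 1" using dim by simp
    have "(cmod (v $ 0))\<^sup>2 \<le> 1" using v cscalar_prod_self[OF v1] by simp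
    then have "cmod (v $ 0) \<le> 1" by (simp add: abs_square_le_1[of "cmod (v $ 0)", simplified])
    then show "?F v \<le> \<bar>x - y\<bar>" unfolding F[OF v1] by (simp add: mult_left_le)
  qed
  moreover have "unit_vec 1 0 \<in> ?S" using dim by simp
  ultimately have "?F (unit_vec 1 0) \<le> op_norm ?M"
    unfolding op_norm_def by (rule cSUP_upper[rotated])
  then show ?thesis using F[of "unit_vec 1 0"] by simp
qed

lemma symmetric_mean_scalar:
  assumes "symmetric_mean f" "0 < x"
  shows "f x = x * f (1 / x)"
proof -
  have "pos_mean f (mat1 1) (mat1 x) = pos_mean f (mat1 x) (mat1 1)"
    using assms pos_def_mat1[of 1] pos_def_mat1[of x] unfolding symmetric_mean_def by simp
  then show ?thesis using assms(2) by (simp add: pos_mean_mat1)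
qed

lemma interpolational_path_scalar:
  assumes "interpolational_path f g" "0 < x"
  shows "g 0 x = 1" "g 1 x = x" "g (1/2) x = f x"
    and "\<And>a. a \<in> {0..1} \<Longrightarrow> 0 < g a x"
    and "\<And>a b. a \<in> {0..1} \<Longrightarrow> b \<in> {0..1} \<Longrightarrow> g ((a + b) / 2) x = g a x * f (g b x / g a x)"
    and "continuous_on {0..1} (\<lambda>t. g t x)"
proof -
  have m: "pos_mean h (mat1 1) (mat1 x) = mat1 (h x)" for h
    by (simp add: pos_mean_mat1)
  have path: "mat1 (g 0 x) = mat1 1" "mat1 (g 1 x) = mat1 x" "mat1 (g (1 / 2) x) = mat1 (f x)"
    "\<And>a b. a \<in> {0..1} \<Longrightarrow> b \<in> {0..1} \<Longrightarrow> pos_mean f (mat1 (g a x)) (mat1 (g b x)) = mat1 (g ((a + b) / 2) x)"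
    "\<And>a. a \<in> {0..1} \<Longrightarrow> ((\<lambda>b. op_norm (mat1 (g b x) - mat1 (g a x))) \<longlongrightarrow> 0) (at a within {0..1})"
    using assms pos_def_mat1[of 1] pos_def_mat1[of x]
    unfolding interpolational_path_def m[symmetric] by auto
  show "g 0 x = 1" "g 1 x = x" "g (1/2) x = f x" using path(1-3) by simp_all
  show pos: "0 < g a x" if "a \<in> {0..1}" for a
    using assms that unfolding interpolational_path_def mean_function_def by blast
  show "g ((a + b) / 2) x = g a x * f (g b x / g a x)" if "a \<in> {0..1}" "b \<in> {0..1}" for a b
    using path(4)[OF that] pos[OF that(1)] by (simp add: pos_mean_mat1)
  show "continuous_on {0..1} (\<lambda>t. g t x)"
    unfolding continuous_on_def
  proof
    fix a :: real assume "a \<in> {0..1}"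
    from path(5)[OF this] have "((\<lambda>b. g b x - g a x) \<longlongrightarrow> 0) (at a within {0..1})"
      by (rule Lim_null_comparison[rotated]) (simp add: op_norm_mat1)
    then show "((\<lambda>t. g t x) \<longlongrightarrow> g a x) (at a within {0..1})"
      using Lim_null by blast
  qed
qed

section \<open>Rank one perturbations with interlacing spectrum\<close>

text \<open>\<open>R\<close> is the Lagrange interpolant of \<open>P\<close> at \<open>N\<close>
  nodes; both have degree below \<open>N\<close>, so they coincide. Pulling the nodal polynomial out
  of each basis polynomial leaves the partial fractions of the quotient. The \<open>if\<close> in
  the products encodes the omission of one index.\<close>

lemma lagrange_partial_fractions:
  fixes y :: "nat \<Rightarrow> real"
  assumes inj: "inj_on y {..<N}" and deg: "degree P < N" and z: "\<And>i. i < N \<Longrightarrow> z \<noteq> y i"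
  shows "poly P z = (\<Prod>k<N. z - y k) *
    (\<Sum>i<N. poly P (y i) / ((\<Prod>k<N. if k = i then 1 else y i - y k) * (z - y i)))"
proof -
  define D where "D i = (\<Prod>k<N. if k = i then 1 else y i - y k)" for i
  define L where "L i = (\<Prod>k<N. if k = i then 1 else [:- y k, 1:])" for i
  define R where "R = (\<Sum>i<N. Polynomial.smult (poly P (y i) / D i) (L i))"
  have D: "D i \<noteq> 0" if "i < N" for i
    using inj that by (auto simp: D_def inj_on_def)
  have pL: "poly (L i) u = (\<Prod>k<N. if k = i then 1 else u - y k)" for i u
    unfolding L_def poly_prod by (intro prod.cong) auto
  have Lij: "poly (L i) (y j) = (if i = j then D i else 0)" if "i < N" "j < N" for i j
    using that by (auto simp: pL D_def)
  have degL: "degree (L i) \<le> N - 1" if "i < N" for i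
  proof -
    have "degree (L i) \<le> (\<Sum>k<N. degree (if k = i then 1 else [:- y k, 1:]))"
      unfolding L_def using degree_prod_sum_le[of "{..<N}" "\<lambda>k. if k = i then 1 else [:- y k, 1:]"]
      by (simp add: o_def)
    also have "\<dots> = (\<Sum>k\<in>{..<N} - {i}. 1)"
      using that by (subst sum.remove[of _ i]) auto
    finally show ?thesis using that by simp
  qed
  have degR: "degree R \<le> N - 1"
    unfolding R_def using degL by (intro degree_sum_le) (auto intro: order_trans[OF degree_smult_le])
  have "P = R"
  proof (rule poly_eqI_degree[of "y ` {..<N}"])
    fix u assume "u \<in> y ` {..<N}"
    then obtain j where j: "j < N" "u = y j" by auto
    have "poly R u = (\<Sum>i<N. if i = j then poly P (y j) else 0)"
      unfolding R_def poly_sum j(2) using j(1) D by (intro sum.cong) (auto simp: Lij)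
    then show "poly P u = poly R u" using j by simp
  qed (use deg degR inj in \<open>auto simp: card_image\<close>)
  then have "poly P z = (\<Sum>i<N. poly P (y i) / D i * poly (L i) z)"
    using poly_sum[of "\<lambda>i. Polynomial.smult (poly P (y i) / D i) (L i)" "{..<N}" z] by (simp add: R_def)
  also have "\<dots> = (\<Sum>i<N. (\<Prod>k<N. z - y k) * (poly P (y i) / (D i * (z - y i))))"
  proof (intro sum.cong refl)
    fix i assume i: "i \<in> {..<N}"
    have "(\<Prod>k<N. z - y k) = (z - y i) * (\<Prod>k\<in>{..<N} - {i}. z - y k)"
      using i by (subst prod.remove[of _ i]) auto
    moreover have "poly (L i) z = (\<Prod>k\<in>{..<N} - {i}. z - y k)"
      unfolding pL using i by (subst prod.remove[of _ i]) (auto intro!: prod.cong)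
    ultimately show "poly P (y i) / D i * poly (L i) z = (\<Prod>k<N. z - y k) * (poly P (y i) / (D i * (z - y i)))"
      using z[of i] i by simp
  qed
  finally show ?thesis by (simp add: D_def sum_distrib_left)
qed

lemma degree_diff_monic_less:
  fixes p q :: "real poly"
  assumes "monic p" "monic q" "degree p = N" "degree q = N" "0 < N"
  shows "degree (p - q) < N"
proof -
  have "degree (p - q) \<le> N" using degree_diff_le[of p N q] assms by simp
  moreover have "coeff (p - q) N = 0" using assms by auto
  ultimately show ?thesis using assms(5)
    by (metis degree_0 leading_coeff_0_iff linorder_neqE_nat not_le)
qed

text \<open>The hypotheses say \<open>l 0 < m 0 < l 1 < m 1 < ...\<close>. A positive rank one
  perturbation always makes the spectra interlace weakly; here the inverse problem is solved: a
  perturbation of \<open>diag(l)\<close> with the given spectrum \<open>m\<close> is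
  constructed.\<close>

locale interlacing =
  fixes N :: nat and l m :: "nat \<Rightarrow> real"
  assumes lm: "i \<le> j \<Longrightarrow> j < N \<Longrightarrow> l i < m j"
    and ml: "i < j \<Longrightarrow> j < N \<Longrightarrow> m i < l j"
begin

lemma l_less: "i < j \<Longrightarrow> j < N \<Longrightarrow> l i < l j"
  using lm[of i i] ml[of i j] by simp

lemma m_less: "i < j \<Longrightarrow> j < N \<Longrightarrow> m i < m j"
  using lm[of j j] ml[of i j] by simp

lemma inj_l: "inj_on l {..<N}"
  using l_less by (intro linorder_inj_onI) (auto simp: order_less_imp_not_eq)

lemma l_eq_iff: "i < N \<Longrightarrow> j < N \<Longrightarrow> l i = l j \<longleftrightarrow> i = j"
  using inj_l by (auto simp: inj_on_def)

lemma l_neq_m: "i < N \<Longrightarrow> j < N \<Longrightarrow> l i \<noteq> m j"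
  using lm[of i j] ml[of j i] by (cases "i \<le> j") auto

text \<open>\<open>p\<close> and \<open>q\<close> are the characteristic polynomials of the
  perturbed and of the diagonal matrix, \<open>p'\<close> and \<open>q'\<close> their derivatives at
  their roots.\<close>

definition p where "p z = (\<Prod>k<N. z - m k)"
definition q where "q z = (\<Prod>k<N. z - l k)"
definition p' where "p' j = (\<Prod>k<N. if k = j then 1 else m j - m k)"
definition q' where "q' i = (\<Prod>k<N. if k = i then 1 else l i - l k)"
text \<open>The characteristic polynomial of \<open>diag(l) + w w^T\<close> divided by
  \<open>q\<close> is \<open>1 - (\<Sum>i. w_i^2 / (z - l_i))\<close>. Comparing residues with
  \<open>p / q\<close> at \<open>l i\<close> dictates these squared components of
  \<open>w\<close>.\<close>

definition w2 where "w2 i = - p (l i) / q' i"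

lemma q_m: "j < N \<Longrightarrow> q (m j) \<noteq> 0"
  by (simp add: q_def) (metis l_neq_m lessThan_iff)

lemma p_l: "i < N \<Longrightarrow> p (l i) \<noteq> 0"
  unfolding p_def using l_neq_m by (auto simp: prod_zero_iff)

lemma q'_nz: "i < N \<Longrightarrow> q' i \<noteq> 0"
  unfolding q'_def using l_eq_iff by (auto simp: prod_zero_iff)

text \<open>Interlacing puts \<open>m k\<close> and \<open>l k\<close> on the same side of
  \<open>l i\<close> for every \<open>k \<noteq> i\<close>, so all the quotients are positive, and
  so is \<open>m i - l i\<close>.\<close>

lemma w2_pos:
  assumes i: "i < N"
  shows "0 < w2 i"
proof -
  have "p (l i) = (l i - m i) * (\<Prod>k\<in>{..<N} - {i}. l i - m k)"
    unfolding p_def using i by (subst prod.remove[of _ i]) auto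
  moreover have "q' i = (\<Prod>k\<in>{..<N} - {i}. l i - l k)"
    unfolding q'_def using i by (subst prod.remove[of _ i]) (auto intro!: prod.cong)
  ultimately have "w2 i = (m i - l i) * (\<Prod>k\<in>{..<N} - {i}. (l i - m k) / (l i - l k))"
    by (simp add: w2_def prod_dividef) (metis minus_diff_eq minus_divide_left mult_minus_left)
  moreover have "0 < (l i - m k) / (l i - l k)" if "k \<in> {..<N} - {i}" for k
  proof (cases "k < i")
    case True
    then show ?thesis using ml[OF True i] l_less[OF True i] by simp
  next
    case False
    then have k: "i < k" "k < N" using that by auto
    then show ?thesis using lm[of i k] l_less[OF k] by (simp add: zero_less_divide_iff)
  qed
  moreover have "0 < m i - l i" using lm[of i i] i by simp
  ultimately show ?thesis by (simp only:) (intro mult_pos_pos prod_pos, auto)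
qed

text \<open>The secular equation, which says that \<open>m j\<close> is an eigenvalue of the
  perturbed matrix. The leading terms of \<open>p\<close> and \<open>q\<close> cancel, so
  \<open>p - q\<close> has partial fractions over \<open>q\<close>; they are evaluated at the root
  \<open>m j\<close> of \<open>p\<close>.\<close>

lemma secular:
  assumes j: "j < N"
  shows "(\<Sum>i<N. w2 i / (l i - m j)) = -1"
proof -
  define P Q where "P = (\<Prod>k<N. [:- m k, 1:])" and "Q = (\<Prod>k<N. [:- l k, 1:])"
  have "monic P" "monic Q" unfolding P_def Q_def by (rule monic_prod, simp)+
  moreover have "degree P = N" "degree Q = N"
    unfolding P_def Q_def by (simp_all add: degree_prod_eq_sum_degree)
  ultimately have "degree (P - Q) < N" using j by (intro degree_diff_monic_less) auto
  have pP: "poly P z = p z" "poly Q z = q z" for z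
    unfolding P_def Q_def p_def q_def by (simp_all add: poly_prod)
  have ql: "q (l i) = 0" if "i < N" for i using that by (auto simp: q_def)
  have pm: "p (m i) = 0" if "i < N" for i using that by (auto simp: p_def)
  have "- q (m j) = q (m j) * (\<Sum>i<N. p (l i) / (q' i * (m j - l i)))"
    using lagrange_partial_fractions[OF inj_l \<open>degree (P - Q) < N\<close>, of "m j"] l_neq_m j ql pm
    by (simp add: pP q_def[symmetric] q'_def[symmetric] eq_commute[of "m j"])
  then have "(\<Sum>i<N. p (l i) / (q' i * (m j - l i))) = -1"
    using q_m[OF j] by (metis mult_cancel_left mult_minus1_right)
  moreover have "p (l i) / (q' i * (m j - l i)) = w2 i / (l i - m j)" for i
    by (simp add: w2_def) (metis minus_diff_eq minus_divide_right mult_minus_right)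
  ultimately show ?thesis by simp
qed

text \<open>The polynomial \<open>p / (z - m j)\<close> of degree \<open>N - 1\<close> has partial
  fractions over \<open>q\<close>, and it vanishes at \<open>m k\<close> unless
  \<open>k = j\<close>. The result is the orthogonality, with squared lengths, of the vectors that
  become the columns of \<open>V\<close>.\<close>

lemma cauchy_orthogonal:
  assumes j: "j < N" and k: "k < N"
  shows "(\<Sum>i<N. w2 i / ((l i - m j) * (l i - m k))) = (if j = k then p' j / q (m j) else 0)"
proof -
  define P where "P = (\<Prod>k<N. if k = j then 1 else [:- m k, 1:])"
  have "degree P \<le> (\<Sum>k<N. degree (if k = j then 1 else [:- m k, 1:]))"
    unfolding P_def using degree_prod_sum_le[of "{..<N}" "\<lambda>k. if k = j then 1 else [:- m k, 1:]"]
    by (simp add: o_def)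
  also have "\<dots> = (\<Sum>k\<in>{..<N} - {j}. 1)"
    using j by (subst sum.remove[of _ j]) auto
  finally have deg: "degree P < N" using j by simp
  have pP: "poly P z = (\<Prod>k<N. if k = j then 1 else z - m k)" for z
    unfolding P_def poly_prod by (intro prod.cong) auto
  have Pm: "poly P (m k) = (if j = k then p' j else 0)"
    using k by (auto simp: pP p'_def)
  have Pl: "poly P (l i) = p (l i) / (l i - m j)" if "i < N" for i
  proof -
    have "p (l i) = (l i - m j) * (\<Prod>k\<in>{..<N} - {j}. l i - m k)"
      unfolding p_def using j by (subst prod.remove[of _ j]) auto
    moreover have "poly P (l i) = (\<Prod>k\<in>{..<N} - {j}. l i - m k)"
      unfolding pP using j by (subst prod.remove[of _ j]) (auto intro!: prod.cong)
    ultimately show ?thesis using l_neq_m[OF that j] by simp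
  qed
  have "poly P (m k) = q (m k) * (\<Sum>i<N. poly P (l i) / (q' i * (m k - l i)))"
    using lagrange_partial_fractions[OF inj_l deg, of "m k"] l_neq_m k
    by (simp add: q_def[symmetric] q'_def[symmetric] eq_commute[of "m k"])
  also have "(\<Sum>i<N. poly P (l i) / (q' i * (m k - l i))) = (\<Sum>i<N. w2 i / ((l i - m j) * (l i - m k)))"
  proof (intro sum.cong refl)
    fix i assume "i \<in> {..<N}"
    then have i: "i < N" by simp
    show "poly P (l i) / (q' i * (m k - l i)) = w2 i / ((l i - m j) * (l i - m k))"
      using l_neq_m[OF i j] l_neq_m[OF i k] q'_nz[OF i]
      by (simp add: Pl[OF i] w2_def divide_simps algebra_simps)

  qed
  finally show ?thesis using Pm q_m[OF k] by (auto simp: field_simps)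
qed

text \<open>The eigenvector of \<open>diag(l) + w w^T\<close> to \<open>m j\<close> is
  \<open>(diag(l) - m_j)^(-1) w\<close>; the second square root is its length, known from
  \<open>cauchy_orthogonal\<close>.\<close>

definition V :: "complex mat" where
  "V = Matrix.mat N N (\<lambda>(i, j). complex_of_real (sqrt (w2 i) / ((l i - m j) * sqrt (p' j / q (m j)))))"

lemma norm_pos:
  assumes j: "j < N"
  shows "0 < p' j / q (m j)"
proof -
  have "p' j / q (m j) = (\<Sum>i<N. w2 i / ((l i - m j) * (l i - m j)))"
    using cauchy_orthogonal[OF j j] by simp
  also have "0 < \<dots>"
  proof (intro sum_pos divide_pos_pos)
    fix i assume "i \<in> {..<N}"
    then show "0 < w2 i" "0 < (l i - m j) * (l i - m j)"
      using w2_pos[of i] l_neq_m[of i j] j by (auto simp: zero_less_mult_iff linorder_neq_iff)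
  qed (use j in auto)
  finally show ?thesis .
qed

lemma unitary_V: "unitary_mat N V"
proof -
  have V: "V \<in> carrier_mat N N" by (simp add: V_def)
  have "mat_adjoint V * V = 1\<^sub>m N"
  proof (rule eq_matI)
    fix j k assume "j < dim_row (1\<^sub>m N :: complex mat)" "k < dim_col (1\<^sub>m N :: complex mat)"
    then have jk: "j < N" "k < N" by auto
    define r where "r j = sqrt (p' j / q (m j))" for j
    define c where "c i j = sqrt (w2 i) / ((l i - m j) * r j)" for i j
    have V': "V = Matrix.mat N N (\<lambda>(i, j). complex_of_real (c i j))"
      by (simp add: V_def c_def r_def)
    have "(mat_adjoint V * V) $$ (j, k) = complex_of_real (\<Sum>i<N. c i j * c i k)"
      using jk unfolding V' by (simp add: scalar_prod_def atLeast0LessThan)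
    also have "(\<Sum>i<N. c i j * c i k) =
       (\<Sum>i<N. w2 i / ((l i - m j) * (l i - m k))) / (r j * r k)"
      unfolding sum_divide_distrib c_def using w2_pos
      by (intro sum.cong refl) (simp add: less_imp_le mult_ac)
    also have "\<dots> = (if j = k then 1 else 0)"
    proof (cases "j = k")
      case True
      have "r k * r k = p' k / q (m k)"
        unfolding r_def using norm_pos[OF jk(2)] by (simp only: real_sqrt_mult_self abs_of_pos)
      then show ?thesis
        unfolding cauchy_orthogonal[OF jk] using True norm_pos[OF jk(2)] by (simp add: zero_less_divide_iff) linarith
    qed (simp add: cauchy_orthogonal[OF jk])
    finally show "(mat_adjoint V * V) $$ (j, k) = 1\<^sub>m N $$ (j, k)" using jk by simp
  qed (auto simp: V_def)
  then have "V * mat_adjoint V = 1\<^sub>m N"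
    using mat_mult_left_right_inverse[of "mat_adjoint V" N V] V by auto
  with V show ?thesis by (simp add: unitary_mat_def)
qed

text \<open>The columns of \<open>V\<close> are eigenvectors: applying \<open>w w^T\<close> to one
  of them produces the sum in \<open>secular\<close>, which is -1, and
  \<open>l_i / (l_i - m_j) - 1 = m_j / (l_i - m_j)\<close>.\<close>

lemma rank_one_update:
  "cdiag N V m = Matrix.mat N N (\<lambda>(i, j). complex_of_real ((if i = j then l i else 0) + sqrt (w2 i) * sqrt (w2 j)))"
    (is "_ = ?M")
proof -
  note V = unitary_matD[OF unitary_V]
  have M: "?M \<in> carrier_mat N N" by simp
  have "?M * V = V * mat_diag N (\<lambda>i. complex_of_real (m i))"
    unfolding mat_diag_mult_right[OF V(1)]
  proof (rule eq_matI, goal_cases)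
    case (1 i j)
    then have ij: "i < N" "j < N" by auto
    let ?r = "sqrt (p' j / q (m j))"
    have "(?M * V) $$ (i, j) = complex_of_real
       (\<Sum>k<N. ((if i = k then l i else 0) + sqrt (w2 i) * sqrt (w2 k)) * (sqrt (w2 k) / ((l k - m j) * ?r)))"
      using ij V(1) by (simp add: scalar_prod_def V_def atLeast0LessThan)
    also have "(\<Sum>k<N. ((if i = k then l i else 0) + sqrt (w2 i) * sqrt (w2 k)) * (sqrt (w2 k) / ((l k - m j) * ?r))) =
       (\<Sum>k<N. if k = i then l i * (sqrt (w2 i) / ((l i - m j) * ?r)) else 0) +
       sqrt (w2 i) * (\<Sum>k<N. w2 k / (l k - m j)) / ?r"
      unfolding sum_distrib_left sum_divide_distrib sum.distrib[symmetric] using w2_pos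
      by (intro sum.cong refl) (auto simp: less_imp_le distrib_left distrib_right add_divide_distrib mult_ac)
    also have "\<dots> = (l i / (l i - m j) - 1) * (sqrt (w2 i) / ?r)"
      unfolding secular[OF ij(2)] using ij by (simp add: left_diff_distrib diff_divide_distrib)
    also have "l i / (l i - m j) - 1 = m j / (l i - m j)"
      using l_neq_m[OF ij] by (simp add: field_simps)
    finally show ?case using ij by (simp add: V_def mult.commute)
  qed (auto simp: V_def)
  then have "cdiag N V m = ?M * V * mat_adjoint V" by (simp add: cdiag_def)
  also have "\<dots> = ?M * (V * mat_adjoint V)"
    using V(1) M by (intro assoc_mult_mat) auto
  also have "\<dots> = ?M" unfolding V(2) using M by (rule right_mult_one_mat)
  finally show ?thesis .
qed

lemma diag_le_update: "loewner_le N (cdiag N (1\<^sub>m N) l) (cdiag N V m)"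
proof (rule loewner_leI)
  fix v :: "complex vec" assume v: "v \<in> carrier_vec N"
  define s where "s = (\<Sum>j<N. complex_of_real (sqrt (w2 j)) * v $ j)"
  have "(cdiag N V m *\<^sub>v v) $ i = complex_of_real (l i) * v $ i + complex_of_real (sqrt (w2 i)) * s"
    if "i < N" for i
  proof -
    have "(cdiag N V m *\<^sub>v v) $ i =
       (\<Sum>j<N. complex_of_real ((if i = j then l i else 0) + sqrt (w2 i) * sqrt (w2 j)) * v $ j)"
      unfolding rank_one_update using that v by (simp add: scalar_prod_def atLeast0LessThan)
    also have "\<dots> = (\<Sum>j<N. if j = i then complex_of_real (l i) * v $ i else 0) +
       (\<Sum>j<N. complex_of_real (sqrt (w2 i)) * (complex_of_real (sqrt (w2 j)) * v $ j))"
      unfolding sum.distrib[symmetric] by (intro sum.cong refl) (auto simp: algebra_simps)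
    finally show ?thesis using that by (simp add: s_def sum_distrib_left)
  qed
  then have "(cdiag N V m *\<^sub>v v) \<bullet>c v =
     (\<Sum>i<N. (complex_of_real (l i) * v $ i + complex_of_real (sqrt (w2 i)) * s) * cnj (v $ i))"
    using v by (simp add: scalar_prod_def atLeast0LessThan)
  also have "\<dots> = (\<Sum>i<N. complex_of_real (l i * (cmod (v $ i))\<^sup>2)) +
     (\<Sum>i<N. s * cnj (complex_of_real (sqrt (w2 i)) * v $ i))"
    unfolding sum.distrib[symmetric]
    by (intro sum.cong refl) (simp add: complex_norm_square algebra_simps del: of_real_power)
  also have "(\<Sum>i<N. s * cnj (complex_of_real (sqrt (w2 i)) * v $ i)) = s * cnj s"
    by (simp add: s_def sum_distrib_left)
  also have "s * cnj s = complex_of_real ((cmod s)\<^sup>2)" by (rule complex_norm_square[symmetric])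
  finally have "qform (cdiag N V m) v = (\<Sum>i<N. l i * (cmod (v $ i))\<^sup>2) + (cmod s)\<^sup>2"
    by (simp add: qform_def)
  then show "qform (cdiag N (1\<^sub>m N) l) v \<le> qform (cdiag N V m) v"
    using v by (simp add: qform_cdiag[OF one_carrier_mat v])
qed (auto intro: hermitian_cdiag cdiag_carrier unitary_matD(1)[OF unitary_V])

text \<open>\<open>p (l i) * q' i\<close> and \<open>q (m j) * p' j\<close> are the derivatives of
  \<open>p q\<close> at its \<open>2 N\<close> roots, so the sum is the divided difference of
  \<open>a^2 f\<close> at the nodes \<open>l\<close> and \<open>m\<close> together. Monotonicity is
  tested on a single vector built from \<open>a\<close>.\<close>

lemma matrix_monotone_interlacing:
  fixes a :: "real poly"
  assumes f: "matrix_monotone f" and pos: "\<And>i. i < N \<Longrightarrow> 0 < l i" and a: "degree a < N"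
  shows "0 \<le> (\<Sum>i<N. f (l i) * (poly a (l i))\<^sup>2 / (p (l i) * q' i)) +
             (\<Sum>j<N. f (m j) * (poly a (m j))\<^sup>2 / (q (m j) * p' j))"
proof -
  note V = unitary_matD[OF unitary_V]
  have posm: "0 < m j" if "j < N" for j using pos[OF that] lm[of j j] that by simp
  have "pos_def N (cdiag N (1\<^sub>m N) l)" "pos_def N (cdiag N V m)"
    using pos posm by (auto intro: pos_def_cdiag unitary_mat_one unitary_V)
  then have le: "loewner_le N (cdiag N (1\<^sub>m N) (\<lambda>i. f (l i))) (cdiag N V (\<lambda>i. f (m i)))"
    using f diag_le_update herm_fun_cdiag[OF unitary_mat_one] herm_fun_cdiag[OF unitary_V]
    unfolding matrix_monotone_def by metis
  \<comment> \<open>In the eigenbasis \<open>V\<close> this vector has coordinates proportional to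
    \<open>a(m_j) / q(m_j)\<close>, by the partial fractions of \<open>a / q\<close>. In the
    standard basis the squares of its coordinates are \<open>- a(l_i)^2 / (p(l_i) q'(l_i))\<close>,
    since \<open>w2 i = - p (l i) / q' i\<close>.\<close>
  define r where "r i = sqrt (w2 i) * poly a (l i) / p (l i)" for i
  define v where "v = Matrix.vec N (\<lambda>i. complex_of_real (r i))"
  have v: "v \<in> carrier_vec N" by (simp add: v_def)
  have "(mat_adjoint V *\<^sub>v v) $ j = complex_of_real (poly a (m j) / (q (m j) * sqrt (p' j / q (m j))))"
    if j: "j < N" for j
  proof -
    let ?r = "sqrt (p' j / q (m j))"
    have "(mat_adjoint V *\<^sub>v v) $ j = complex_of_real (\<Sum>i<N. sqrt (w2 i) / ((l i - m j) * ?r) * r i)"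
      using j V(1) by (simp add: scalar_prod_def V_def v_def atLeast0LessThan)
    also have "(\<Sum>i<N. sqrt (w2 i) / ((l i - m j) * ?r) * r i) =
       (\<Sum>i<N. poly a (l i) / (q' i * (m j - l i))) / ?r"
      unfolding sum_divide_distrib
    proof (intro sum.cong refl)
      fix i assume "i \<in> {..<N}"
      then have i: "i < N" by simp
      have "sqrt (w2 i) / ((l i - m j) * ?r) * r i = w2 i / p (l i) * (poly a (l i) / ((l i - m j) * ?r))"
        using w2_pos[OF i] by (simp add: r_def less_imp_le mult.assoc[symmetric])
      also have "w2 i / p (l i) = - 1 / q' i" using p_l[OF i] by (simp add: w2_def)
      also have "- 1 / q' i * (poly a (l i) / ((l i - m j) * ?r)) = poly a (l i) / (q' i * (m j - l i)) / ?r"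
        using l_neq_m[OF i j] by (simp add: divide_simps) (simp add: algebra_simps)
      finally show "sqrt (w2 i) / ((l i - m j) * ?r) * r i = poly a (l i) / (q' i * (m j - l i)) / ?r" .
    qed
    also have "(\<Sum>i<N. poly a (l i) / (q' i * (m j - l i))) = poly a (m j) / q (m j)"
      using lagrange_partial_fractions[OF inj_l a, of "m j"] l_neq_m j q_m[OF j]
      by (simp add: q_def[symmetric] q'_def[symmetric] eq_commute[of "m j"])
    finally show ?thesis by simp
  qed
  then have "qform (cdiag N V (\<lambda>i. f (m i))) v =
     (\<Sum>j<N. f (m j) * (poly a (m j) / (q (m j) * sqrt (p' j / q (m j))))\<^sup>2)"
    unfolding qform_cdiag[OF V(1) v]
    by (intro sum.cong refl) (simp only: lessThan_iff norm_of_real power2_abs)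
  also have "\<dots> = (\<Sum>j<N. f (m j) * (poly a (m j))\<^sup>2 / (q (m j) * p' j))"
  proof (intro sum.cong refl)
    fix j assume "j \<in> {..<N}"
    then show "f (m j) * (poly a (m j) / (q (m j) * sqrt (p' j / q (m j))))\<^sup>2 =
       f (m j) * (poly a (m j))\<^sup>2 / (q (m j) * p' j)"
      using norm_pos[of j] q_m[of j]
      by (simp add: power_divide power_mult_distrib real_sqrt_pow2 less_imp_le power2_eq_square[of "q (m j)"])
  qed
  finally have 1: "qform (cdiag N V (\<lambda>i. f (m i))) v = (\<Sum>j<N. f (m j) * (poly a (m j))\<^sup>2 / (q (m j) * p' j))" .
  have "qform (cdiag N (1\<^sub>m N) (\<lambda>i. f (l i))) v = (\<Sum>i<N. f (l i) * (r i)\<^sup>2)"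
    unfolding qform_cdiag[OF one_carrier_mat v] using v by (simp add: v_def)
  also have "\<dots> = (\<Sum>i<N. - (f (l i) * (poly a (l i))\<^sup>2 / (p (l i) * q' i)))"
  proof (intro sum.cong refl)
    fix i assume "i \<in> {..<N}"
    then have i: "i < N" by simp
    have "(r i)\<^sup>2 = w2 i * (poly a (l i))\<^sup>2 / (p (l i))\<^sup>2"
      using w2_pos[OF i] by (simp add: r_def power_divide power_mult_distrib)
    also have "\<dots> = - ((poly a (l i))\<^sup>2 / (p (l i) * q' i))"
      using p_l[OF i] q'_nz[OF i] by (simp add: w2_def power2_eq_square[of "p (l i)"])
    finally show "f (l i) * (r i)\<^sup>2 = - (f (l i) * (poly a (l i))\<^sup>2 / (p (l i) * q' i))" by simp
  qed
  finally have 2: "qform (cdiag N (1\<^sub>m N) (\<lambda>i. f (l i))) v = - (\<Sum>i<N. f (l i) * (poly a (l i))\<^sup>2 / (p (l i) * q' i))"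
    by (simp add: sum_negf)
  show ?thesis using loewner_leD[OF le v] unfolding 1 2 by simp
qed

end

section \<open>Divided differences of matrix monotone functions\<close>

text \<open>For \<open>k < n\<close> this is the derivative at \<open>x k\<close> of the polynomial
  with roots \<open>x 0, ..., x (n - 1)\<close>; sums weighted by the reciprocals are divided
  differences.\<close>

definition nodal_deriv :: "nat \<Rightarrow> (nat \<Rightarrow> real) \<Rightarrow> nat \<Rightarrow> real" where
  "nodal_deriv n x k = (\<Prod>j<n. if j = k then 1 else x k - x j)"

lemma sum_even_odd:
  fixes N :: nat
  shows "(\<Sum>k<2 * N. h k) = (\<Sum>i<N. h (2 * i)) + (\<Sum>i<N. h (2 * i + 1) :: real)"
  by (induction N) (simp_all add: add_ac)

lemma prod_even_odd:
  fixes N :: nat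
  shows "(\<Prod>k<2 * N. h k) = (\<Prod>i<N. h (2 * i)) * (\<Prod>i<N. h (2 * i + 1) :: real)"
  by (induction N) (simp_all add: mult_ac)

text \<open>Nodes of even index become eigenvalues of the diagonal matrix, those of odd index
  eigenvalues of the perturbation; increasing order is interlacing.\<close>

lemma matrix_monotone_divided_difference:
  fixes a :: "real poly"
  assumes f: "matrix_monotone f" and a: "degree a < N"
    and mono: "\<And>i j. i < j \<Longrightarrow> j < 2 * N \<Longrightarrow> x i < x j" and pos: "0 < x 0"
  shows "0 \<le> (\<Sum>k<2 * N. f (x k) * (poly a (x k))\<^sup>2 / nodal_deriv (2 * N) x k)"
proof -
  interpret interlacing N "\<lambda>i. x (2 * i)" "\<lambda>i. x (2 * i + 1)"
    using mono by unfold_locales auto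
  have pos': "0 < x (2 * i)" if "i < N" for i
    using pos mono[of 0 "2 * i"] that by (cases "i = 0") auto
  have "nodal_deriv (2 * N) x (2 * i) = p (x (2 * i)) * q' i" if "i < N" for i
    unfolding nodal_deriv_def prod_even_odd p_def q'_def
    by (subst mult.commute, intro arg_cong2[where f = "(*)"] prod.cong refl)
      (auto, presburger)
  moreover have "nodal_deriv (2 * N) x (2 * i + 1) = q (x (2 * i + 1)) * p' i" if "i < N" for i
    unfolding nodal_deriv_def prod_even_odd q_def p'_def
    by (intro arg_cong2[where f = "(*)"] prod.cong refl) (auto, presburger)
  ultimately show ?thesis
    using matrix_monotone_interlacing[OF f pos' a] by (simp add: sum_even_odd)
qed

text \<open>Adding the node \<open>\<epsilon> \<rightarrow> 0\<close> to an odd number of nodes, where \<open>f(\<epsilon>) > 0\<close> has a negative weight.\<close>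

lemma matrix_monotone_odd_nodes_zero:
  fixes a :: "real poly"
  assumes f: "matrix_monotone f" and fpos: "\<And>x. 0 < x \<Longrightarrow> 0 < f x" and a: "degree a \<le> N"
    and mono: "\<And>i j. i < j \<Longrightarrow> j < 2 * N + 1 \<Longrightarrow> y i < y j" and pos: "0 < y 0"
  shows "0 \<le> (\<Sum>k<2 * N + 1. f (y k) * (poly a (y k))\<^sup>2 / (y k * nodal_deriv (2 * N + 1) y k))"
proof -
  let ?M = "2 * N + 1"
  have ypos: "y 0 \<le> y k" if "k < ?M" for k
    using mono[of 0 k] that by (cases "k = 0") auto
  have ev: "0 \<le> (\<Sum>k<?M. f (y k) * (poly a (y k))\<^sup>2 / ((y k - e) * nodal_deriv ?M y k))"
    if e: "0 < e" "e < y 0" for e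
  proof -
    define x where "x = case_nat e y"
    have "x i < x j" if ij: "i < j" "j < 2 * Suc N" for i j
    proof (cases i)
      case 0
      then obtain j' where "j = Suc j'" using ij by (cases j) auto
      then show ?thesis using 0 ij e ypos[of j'] by (simp add: x_def)
    next
      case (Suc i')
      then obtain j' where "j = Suc j'" using ij by (cases j) auto
      then show ?thesis using Suc ij mono[of i' j'] by (simp add: x_def)
    qed
    then have "0 \<le> (\<Sum>k<2 * Suc N. f (x k) * (poly a (x k))\<^sup>2 / nodal_deriv (2 * Suc N) x k)"
      using a e by (intro matrix_monotone_divided_difference[OF f]) (auto simp: x_def)
    moreover have S: "2 * Suc N = Suc ?M" by simp
    have "nodal_deriv (Suc ?M) x (Suc k) = (y k - e) * nodal_deriv ?M y k" for k
      unfolding nodal_deriv_def prod.lessThan_Suc_shift by (simp add: x_def cong: if_cong)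
    moreover have "nodal_deriv (Suc ?M) x 0 = (\<Prod>k<?M. e - y k)"
      unfolding nodal_deriv_def prod.lessThan_Suc_shift by (simp add: x_def)
    \<comment> \<open>An odd number of negative factors: this gives the new node its negative weight
      and lets its term be dropped.\<close>
    moreover have "(\<Prod>k<?M. e - y k) < 0"
    proof -
      have "(\<Prod>k<?M. e - y k) = (\<Prod>k<?M. (- 1) * (y k - e))" by (intro prod.cong) auto
      also have "\<dots> = (-1) ^ ?M * (\<Prod>k<?M. y k - e)" unfolding prod.distrib by simp
      also have "\<dots> = - (\<Prod>k<?M. y k - e)" by simp
      also have "\<dots> < 0"
      proof -
        have "0 < (\<Prod>k<?M. y k - e)"
        proof (rule prod_pos, clarify)
          fix k assume "k < ?M"
          from ypos[OF this] e show "0 < y k - e" by simp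
        qed
        then show ?thesis by (simp only: neg_less_0_iff_less)
      qed
      finally show ?thesis .
    qed
    moreover have "0 \<le> f e * (poly a e)\<^sup>2" using fpos[OF e(1)] by simp
    ultimately have "0 \<le> f e * (poly a e)\<^sup>2 / (\<Prod>k<?M. e - y k) +
        (\<Sum>k<?M. f (y k) * (poly a (y k))\<^sup>2 / ((y k - e) * nodal_deriv ?M y k))"
      and "f e * (poly a e)\<^sup>2 / (\<Prod>k<?M. e - y k) \<le> 0"
      unfolding S sum.lessThan_Suc_shift by (simp_all add: x_def divide_nonneg_neg del: prod.lessThan_Suc sum.lessThan_Suc)
    then show ?thesis by linarith
  qed
  have "((\<lambda>e. \<Sum>k<?M. f (y k) * (poly a (y k))\<^sup>2 / ((y k - e) * nodal_deriv ?M y k)) \<longlongrightarrow>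
     (\<Sum>k<?M. f (y k) * (poly a (y k))\<^sup>2 / ((y k - 0) * nodal_deriv ?M y k))) (at_right 0)"
  proof (intro tendsto_intros)
    fix k assume "k \<in> {..<?M}"
    then have k: "k < ?M" by simp
    have "y k \<noteq> y j" if "j < ?M" "j \<noteq> k" for j
      using mono[of j k] mono[of k j] that k by (cases j k rule: linorder_cases) auto
    then have "nodal_deriv ?M y k \<noteq> 0" unfolding nodal_deriv_def prod_zero_iff[OF finite_lessThan] by auto
    moreover have "y k \<noteq> 0" using ypos[OF k] pos by simp
    ultimately show "(y k - 0) * nodal_deriv ?M y k \<noteq> 0" by simp
  qed
  moreover have "\<forall>\<^sub>F e in at_right 0. 0 \<le> (\<Sum>k<?M. f (y k) * (poly a (y k))\<^sup>2 / ((y k - e) * nodal_deriv ?M y k))"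
    by (rule eventually_mono[OF eventually_at_right_real[OF pos]], rule ev) auto
  ultimately have "0 \<le> (\<Sum>k<?M. f (y k) * (poly a (y k))\<^sup>2 / ((y k - 0) * nodal_deriv ?M y k))"
    by (rule tendsto_lowerbound) simp
  then show ?thesis by (simp only: diff_0_right)
qed

text \<open>Adding a node at which the polynomial vanishes and which tends to infinity.\<close>

lemma matrix_monotone_odd_nodes_infinity:
  fixes b :: "real poly"
  assumes f: "matrix_monotone f" and b: "degree b < N"
    and mono: "\<And>i j. i < j \<Longrightarrow> j < 2 * N + 1 \<Longrightarrow> y i < y j" and pos: "0 < y 0"
  shows "(\<Sum>k<2 * N + 1. f (y k) * (poly b (y k))\<^sup>2 / nodal_deriv (2 * N + 1) y k) \<le> 0"
proof -
  let ?M = "2 * N + 1"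
  let ?c = "\<lambda>k. f (y k) * (poly b (y k))\<^sup>2 / nodal_deriv ?M y k"
  have ypos: "y k \<le> y (2 * N)" if "k < ?M" for k
    using mono[of k "2 * N"] that by (cases "k = 2 * N") auto
  have ev: "(\<Sum>k<?M. ?c k * (1 - y k / z)) \<le> 0" if z: "y (2 * N) < z" for z
  proof -
    define x where "x k = (if k < ?M then y k else z)" for k
    \<comment> \<open>The factor \<open>X - z\<close> removes the term of the new node. In the other
      terms its square meets one factor \<open>y k - z\<close> of the derivative, which leaves
      \<open>y k - z = - z (1 - y k / z)\<close>; the negative factor \<open>- z\<close> reverses
      the inequality.\<close>
    define a where "a = [:- z, 1:] * b"
    have S: "2 * Suc N = Suc ?M" by simp
    have z0: "0 < z" using z pos ypos[of 0] by simp
    have "degree a < Suc N"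
      using b degree_mult_le[of "[:- z, 1:]" b] by (simp add: a_def)
    moreover have "x i < x j" if "i < j" "j < 2 * Suc N" for i j
    proof (cases "j < ?M")
      case True
      then show ?thesis using that mono[of i j] by (simp add: x_def)
    next
      case False
      then show ?thesis using that z ypos[of i] by (simp add: x_def)
    qed
    ultimately have "0 \<le> (\<Sum>k<2 * Suc N. f (x k) * (poly a (x k))\<^sup>2 / nodal_deriv (2 * Suc N) x k)"
      using pos by (intro matrix_monotone_divided_difference[OF f]) (auto simp: x_def)
    also have "\<dots> = (\<Sum>k<?M. f (y k) * (poly a (y k))\<^sup>2 / (nodal_deriv ?M y k * (y k - z)))"
    proof -
      have "nodal_deriv (Suc ?M) x k = nodal_deriv ?M y k * (y k - z)" if "k < ?M" for k
        unfolding nodal_deriv_def prod.lessThan_Suc[of _ ?M] using that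
        by (intro arg_cong2[where f = "(*)"] prod.cong) (auto simp: x_def)
      moreover have "poly a (x ?M) = 0" by (simp add: a_def x_def)
      ultimately show ?thesis
        unfolding S sum.lessThan_Suc[of _ ?M] by (simp add: x_def del: sum.lessThan_Suc)
    qed
    also have "\<dots> = (\<Sum>k<?M. - z * (?c k * (1 - y k / z)))"
    proof (intro sum.cong refl)
      fix k assume "k \<in> {..<?M}"
      then have "y k - z \<noteq> 0" using ypos[of k] z by simp
      moreover have pa: "poly a (y k) = (y k - z) * poly b (y k)" by (simp add: a_def algebra_simps)
      ultimately have "(poly a (y k))\<^sup>2 / (nodal_deriv ?M y k * (y k - z)) = (poly b (y k))\<^sup>2 / nodal_deriv ?M y k * (y k - z)"
        unfolding pa by (simp add: power2_eq_square)
      moreover have "- z * (1 - y k / z) = y k - z" using z0 by (simp add: field_simps)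
      moreover have "f (y k) * (c / d * (u * w)) = u * (f (y k) * c / d * w)" for c d u w :: real
        by simp
      ultimately show "f (y k) * (poly a (y k))\<^sup>2 / (nodal_deriv ?M y k * (y k - z)) = - z * (?c k * (1 - y k / z))"
        by (metis (no_types) times_divide_eq_right)
    qed
    also have "\<dots> = - z * (\<Sum>k<?M. ?c k * (1 - y k / z))" by (simp only: sum_distrib_left)
    finally show ?thesis using z0 by (simp add: mult_le_0_iff zero_le_mult_iff)
  qed
  have "((\<lambda>z. \<Sum>k<?M. ?c k * (1 - y k / z)) \<longlongrightarrow> (\<Sum>k<?M. ?c k * (1 - 0))) at_top"
    by (intro tendsto_intros tendsto_divide_0[OF tendsto_const] filterlim_at_top_imp_at_infinity filterlim_ident)
  moreover have "\<forall>\<^sub>F z in at_top. (\<Sum>k<?M. ?c k * (1 - y k / z)) \<le> 0"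
    by (rule eventually_mono[OF eventually_gt_at_top[of "y (2 * N)"]], rule ev)
  ultimately have "(\<Sum>k<?M. ?c k * (1 - 0)) \<le> 0"
    by (rule tendsto_upperbound) simp
  then show ?thesis by (simp only: diff_0_right mult_1_right)
qed

text \<open>For \<open>x < 1\<close> the second divided difference of \<open>f\<close> at
  \<open>x\<close>, 1, \<open>1 / x\<close> is nonpositive. By symmetry
  \<open>f (1 / x) = f x / x\<close>, so it involves \<open>f x\<close> alone and reduces to
  \<open>2 f x \<le> 1 + x\<close>. Values above 1 are reduced to their reciprocals.\<close>

lemma symmetric_mean_le_arith:
  assumes f: "symmetric_mean f" and x: "0 < x"
  shows "f x \<le> (1 + x) / 2"
proof -
  have mf: "matrix_monotone f" and f1: "f 1 = 1"
    using f by (auto simp: symmetric_mean_def mean_function_def)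
  have *: "f x \<le> (1 + x) / 2" if x: "0 < x" "x < 1" for x
  proof -
    define y where "y k = (if k = 0 then x else if k = 1 then 1 else 1 / x)" for k :: nat
    have "1 < 1 / x" "x < 1 / x" using x less_trans[of x 1 "1 / x"] by auto
    then have "y i < y j" if "i < j" "j < 2 * 1 + 1" for i j
      using that x by (auto simp: y_def less_Suc_eq numeral_eq_Suc)
    then have "(\<Sum>k<2 * 1 + 1. f (y k) * (poly 1 (y k))\<^sup>2 / nodal_deriv (2 * 1 + 1) y k) \<le> 0"
      using x by (intro matrix_monotone_odd_nodes_infinity[OF mf]) (auto simp: y_def)
    moreover have "{..<2 * 1 + 1} = {0, 1, 2::nat}" by auto
    ultimately have "f x / ((x - 1) * (x - 1 / x)) + 1 / ((1 - x) * (1 - 1 / x)) +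
        f (1 / x) / ((1 / x - x) * (1 / x - 1)) \<le> 0"
      using f1 by (simp add: y_def nodal_deriv_def add_ac)
    moreover have "f (1 / x) = f x / x"
      using symmetric_mean_scalar[OF f x(1)] x by (simp add: field_simps)
    moreover have "f x / ((x - 1) * (x - 1 / x)) = f x * x / ((1 - x)\<^sup>2 * (1 + x))"
    proof -
      have "(x - 1) * (x - 1 / x) = (1 - x)\<^sup>2 * (1 + x) / x"
        using x by (simp add: field_simps power2_eq_square)
      then show ?thesis by simp
    qed
    moreover have "f x / x / ((1 / x - x) * (1 / x - 1)) = f x * x / ((1 - x)\<^sup>2 * (1 + x))"
    proof -
      have "(1 / x - x) * (1 / x - 1) = (1 - x)\<^sup>2 * (1 + x) / x\<^sup>2"
        using x by (simp add: field_simps power2_eq_square)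
      then show ?thesis using x by (simp add: power2_eq_square)
    qed
    moreover have "1 / ((1 - x) * (1 - 1 / x)) = - (x * (1 + x)) / ((1 - x)\<^sup>2 * (1 + x))"
    proof -
      have "(1 - x) * (1 - 1 / x) = - ((1 - x)\<^sup>2 / x)"
        using x by (simp add: field_simps power2_eq_square)
      then show ?thesis using x by simp
    qed
    ultimately have "f x * x / ((1 - x)\<^sup>2 * (1 + x)) + - (x * (1 + x)) / ((1 - x)\<^sup>2 * (1 + x)) +
        f x * x / ((1 - x)\<^sup>2 * (1 + x)) \<le> 0"
      by (simp only:)
    then have "(2 * (f x * x) - x * (1 + x)) / ((1 - x)\<^sup>2 * (1 + x)) \<le> 0"
      unfolding add_divide_distrib[symmetric] by (simp add: mult.commute)
    then have "2 * (f x * x) - x * (1 + x) \<le> 0"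
      using x by (simp add: divide_le_0_iff mult_le_0_iff)
    then have "x * (2 * f x) \<le> x * (1 + x)" by (simp add: mult_ac)
    then show ?thesis using x by simp
  qed
  show ?thesis
  proof (rule linorder_cases[of x 1])
    assume "1 < x"
    then have "f (1 / x) \<le> (1 + 1 / x) / 2" by (intro *) auto
    then have "x * f (1 / x) \<le> x * ((1 + 1 / x) / 2)" using x by (intro mult_left_mono) auto
    also have "\<dots> = (1 + x) / 2" using x by (simp add: field_simps)
    finally show ?thesis using symmetric_mean_scalar[OF f x] by simp
  qed (use * x f1 in auto)
qed

section \<open>Approximation by harmonic kernels\<close>

lemma poly_map_of_real_add:
  "poly (map_poly complex_of_real (p + q)) z =
    poly (map_poly complex_of_real p) z + poly (map_poly complex_of_real q) z"
proof -
  have "map_poly complex_of_real (p + q) = map_poly complex_of_real p + map_poly complex_of_real q"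
    by (rule poly_eqI) (simp add: coeff_map_poly)
  then show ?thesis by simp
qed

lemma poly_map_of_real_pCons:
  "poly (map_poly complex_of_real (pCons c p)) z = of_real c + z * poly (map_poly complex_of_real p) z"
proof -
  have "map_poly complex_of_real (pCons c p) = pCons (of_real c) (map_poly complex_of_real p)"
    by (rule poly_eqI) (simp add: coeff_map_poly coeff_pCons split: nat.split)
  then show ?thesis by simp
qed

lemma poly_map_of_real_mult:
  "poly (map_poly complex_of_real (p * q)) z =
    poly (map_poly complex_of_real p) z * poly (map_poly complex_of_real q) z"
proof -
  have "map_poly complex_of_real (p * q) = map_poly complex_of_real p * map_poly complex_of_real q"
    by (rule poly_eqI) (simp add: coeff_map_poly coeff_mult)
  then show ?thesis by simp
qed

text \<open>Sums of \<open>a^2\<close> and \<open>X b^2\<close>. The bound \<open>d\<close> limits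
  the degree of every summand, not only of the sum: the functional to which the cone is applied is
  shown to be positive on summands of degree at most \<open>2 N\<close>.\<close>

inductive pos_cone :: "nat \<Rightarrow> real poly \<Rightarrow> bool" where
  sq: "2 * degree a \<le> d \<Longrightarrow> pos_cone d (a * a)"
| xsq: "2 * degree b + 1 \<le> d \<Longrightarrow> pos_cone d ([:0, 1:] * (b * b))"
| add: "pos_cone d p \<Longrightarrow> pos_cone d q \<Longrightarrow> pos_cone d (p + q)"

lemma pos_cone_mult_sq:
  assumes "pos_cone d p" "2 * degree a \<le> e"
  shows "pos_cone (d + e) (a * a * p)"
  using assms
proof (induction rule: pos_cone.induct)
  case (sq b d)
  have "2 * degree (a * b) \<le> d + e" using sq degree_mult_le[of a b] by simp
  from pos_cone.sq[OF this] show ?case by (simp add: mult_ac)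
next
  case (xsq b d)
  have "2 * degree (a * b) + 1 \<le> d + e" using xsq degree_mult_le[of a b] by simp
  moreover have "[:0, 1:] * ((a * b) * (a * b)) = a * a * ([:0, 1:] * (b * b))" by (simp only: mult_ac)
  ultimately show ?case using pos_cone.xsq[of "a * b" "d + e"] by (simp only:)
next
  case (add d p q)
  then show ?case using pos_cone.add by (simp add: distrib_left)
qed

text \<open>\<open>X a^2\<close> times \<open>X b^2\<close> is the square of \<open>X a b\<close>;
  this is what closes the cone under products.\<close>

lemma pos_cone_mult_xsq:
  assumes "pos_cone d p" "2 * degree a + 1 \<le> e"
  shows "pos_cone (d + e) ([:0, 1:] * (a * a) * p)"
  using assms
proof (induction rule: pos_cone.induct)
  case (sq b d)
  have "2 * degree (a * b) + 1 \<le> d + e" using sq degree_mult_le[of a b] by simp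
  moreover have "[:0, 1:] * ((a * b) * (a * b)) = [:0, 1:] * (a * a) * (b * b)" by (simp only: mult_ac)
  ultimately show ?case using pos_cone.xsq[of "a * b" "d + e"] by (simp only:)
next
  case (xsq b d)
  have "degree ([:0, 1:] * (a * b)) \<le> 1 + (degree a + degree b)"
    using degree_mult_le[of "[:0, 1:]" "a * b"] degree_mult_le[of a b] by simp
  then have "2 * degree ([:0, 1:] * (a * b)) \<le> d + e" using xsq by simp
  moreover have "([:0, 1:] * (a * b)) * ([:0, 1:] * (a * b)) = [:0, 1:] * (a * a) * ([:0, 1:] * (b * b))"
    by (simp only: mult_ac)
  ultimately show ?case using pos_cone.sq[of "[:0, 1:] * (a * b)" "d + e"] by (simp only:)
next
  case (add d p q)
  show ?case
    unfolding distrib_left by (rule pos_cone.add[OF add.IH(1)[OF add.prems] add.IH(2)[OF add.prems]])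
qed

lemma pos_cone_mult:
  assumes "pos_cone d p" "pos_cone e q"
  shows "pos_cone (d + e) (p * q)"
  using assms
proof (induction rule: pos_cone.induct)
  case (sq a d)
  then show ?case using pos_cone_mult_sq[of e q a d] by (simp add: add.commute)
next
  case (xsq b d)
  then show ?case using pos_cone_mult_xsq[of e q b d] by (simp add: add.commute)
next
  case (add d p1 p2)
  then show ?case using pos_cone.add by (simp add: distrib_right)
qed

lemma poly_nonneg_limit:
  fixes s :: "real poly"
  assumes "\<And>x. r < x \<Longrightarrow> 0 \<le> poly s x"
  shows "0 \<le> poly s r"
proof (rule tendsto_lowerbound)
  show "(poly s \<longlongrightarrow> poly s r) (at_right r)"
    using isCont_def poly_isCont filterlim_at_split by blast
  show "\<forall>\<^sub>F x in at_right r. 0 \<le> poly s x"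
    using assms by (auto simp: eventually_at_right_field intro: exI[of _ "r + 1"])
qed simp

lemma pos_cone_linear:
  assumes "0 \<le> c"
  shows "pos_cone 1 [:c, 1:]"
proof -
  have "pos_cone 1 ([:sqrt c:] * [:sqrt c:] + [:0, 1:] * (1 * 1))"
    by (intro add sq xsq) auto
  then show ?thesis using assms by simp
qed

lemma pos_cone_quadratic: "pos_cone 2 ([:- r, 1:] * [:- r, 1:] + [:i:] * [:i:])"
  by (intro add sq) auto

text \<open>A factor from the cone is split off at a complex root: \<open>X + c\<close> at a root
  \<open>- c \<le> 0\<close>, \<open>(X - r)^2\<close> at a positive root, which has to be at least
  double, and a quadratic without real roots at a non-real one. The cofactor is again nonnegative
  and of lower degree.\<close>

theorem nonneg_poly_pos_cone:
  fixes p :: "real poly"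
  assumes "\<And>x. 0 \<le> x \<Longrightarrow> 0 \<le> poly p x"
  shows "pos_cone (degree p) p"
  using assms
proof (induction "degree p" arbitrary: p rule: less_induct)
  case less
  show ?case
  proof (cases "degree p = 0")
    case True
    then obtain c where p: "p = [:c:]" using degree_eq_zeroE by blast
    then have "p = [:sqrt c:] * [:sqrt c:]" using less(2)[of 0] by simp
    then show ?thesis using sq[of "[:sqrt c:]" "degree p"] by simp
  next
    case False
    have step: ?thesis if p: "p = a * s" and a: "pos_cone (degree a) a" "0 < degree a"
      and pos: "\<And>x. 0 \<le> x \<Longrightarrow> 0 \<le> poly s x" for a s
    proof -
      have "p \<noteq> 0" using False by auto
      then have d: "degree p = degree a + degree s" using p by (auto simp: degree_mult_eq)
      from less(1)[OF _ pos] a(2) d have "pos_cone (degree s) s" by simp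
      from pos_cone_mult[OF a(1) this] show ?thesis by (simp add: p[symmetric] d)
    qed
    have "\<not> constant (poly (map_poly complex_of_real p))"
      using False by (simp add: constant_degree degree_map_poly)
    then obtain z where z: "poly (map_poly complex_of_real p) z = 0"
      using fundamental_theorem_of_algebra by blast
    show ?thesis
    proof (cases "Im z = 0")
      case True
      then have "z = complex_of_real (Re z)" by (simp add: complex_eq_iff)
      then have "poly p (Re z) = 0"
        using z by (metis of_real_hom.poly_map_poly of_real_eq_0_iff)
      then obtain q where q: "p = [:- Re z, 1:] * q" by (metis dvdE poly_eq_0_iff_dvd)
      have pq: "poly p x = (x - Re z) * poly q x" for x by (simp add: q algebra_simps)
      show ?thesis
      proof (cases "Re z \<le> 0")
        case True
        have "0 \<le> poly q x" if "0 < x" for x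
          using less(2)[of x] pq[of x] that True by (simp add: zero_le_mult_iff)
        then have "0 \<le> poly q x" if "0 \<le> x" for x
          using poly_nonneg_limit[of 0 q] that by (cases "x = 0") auto
        then show ?thesis using True pos_cone_linear[of "- Re z"] by (intro step[OF q]) auto
      next
        case False
        have q1: "0 \<le> poly q x" if "Re z < x" for x
          using less(2)[of x] pq[of x] that False by (simp add: zero_le_mult_iff)
        have q2: "poly q x \<le> 0" if "0 \<le> x" "x < Re z" for x
          using less(2)[of x] pq[of x] that by (simp add: zero_le_mult_iff)
        \<comment> \<open>\<open>q\<close> is nonpositive to the left of the root and nonnegative to
          the right, so by continuity it vanishes there and the root is at least double.\<close>
        have "poly q (Re z) \<le> 0"
        proof (rule tendsto_upperbound)
          show "(poly q \<longlongrightarrow> poly q (Re z)) (at_left (Re z))"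
            using isCont_def poly_isCont filterlim_at_split by blast
          show "\<forall>\<^sub>F x in at_left (Re z). poly q x \<le> 0"
            using q2 False by (auto simp: eventually_at_left_field intro!: exI[of _ 0])
        qed simp
        then have "poly q (Re z) = 0" using poly_nonneg_limit[of "Re z" q] q1 by force
        then obtain s where s: "q = [:- Re z, 1:] * s" by (metis dvdE poly_eq_0_iff_dvd)
        have p: "p = ([:- Re z, 1:] * [:- Re z, 1:]) * s" using q s by (simp only: mult.assoc)
        have "0 \<le> poly s x" if "0 \<le> x" "x \<noteq> Re z" for x
        proof -
          have "poly p x = (x - Re z)\<^sup>2 * poly s x" by (simp add: p power2_eq_square algebra_simps)
          then show ?thesis using less(2)[of x] that by (simp add: zero_le_mult_iff)
        qed
        then have "0 \<le> poly s x" if "0 \<le> x" for x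
          using poly_nonneg_limit[of "Re z" s] that False by (cases "x = Re z") auto
        moreover have deg: "degree ([:- Re z, 1:] * [:- Re z, 1:]) = 2" by (subst degree_mult_eq) auto
        moreover have "pos_cone 2 ([:- Re z, 1:] * [:- Re z, 1:])" by (rule sq) simp
        ultimately show ?thesis by (intro step[OF p]) (simp_all only: deg zero_less_numeral)
      qed
    next
      case False
      define a where "a = [:- Re z, 1:] * [:- Re z, 1:] + [:Im z:] * [:Im z:]"
      have a': "a = [:(Re z)\<^sup>2 + (Im z)\<^sup>2, - 2 * Re z, 1:]" by (simp add: a_def power2_eq_square)
      have deg: "degree a = 2" by (simp add: a')
      have az: "poly (map_poly complex_of_real a) z = 0"
        by (simp add: a' poly_map_of_real_pCons complex_eq_iff power2_eq_square algebra_simps)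
      \<comment> \<open>The remainder has degree at most 1 and real coefficients, and it vanishes at
        the non-real \<open>z\<close>; hence it is zero.\<close>
      define r where "r = p mod a"
      have "degree r < 2 \<or> r = 0" using degree_mod_less[of a p] deg unfolding r_def by force
      then have "degree r \<le> 1" by auto
      then have r: "r = [:coeff r 0, coeff r 1:]"
        by (intro poly_eqI) (auto simp: coeff_pCons coeff_eq_0 split: nat.split)
      have "p = a * (p div a) + r" by (simp add: r_def)
      then have "poly (map_poly complex_of_real p) z =
          poly (map_poly complex_of_real a) z * poly (map_poly complex_of_real (p div a)) z +
          poly (map_poly complex_of_real r) z"
        by (metis poly_map_of_real_add poly_map_of_real_mult)
      then have "poly (map_poly complex_of_real r) z = 0" using z az by simp
      moreover have "poly (map_poly complex_of_real [:c0, c1:]) z = of_real c0 + z * of_real c1" for c0 c1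
        by (simp add: poly_map_of_real_pCons)
      ultimately have "of_real (coeff r 0) + z * complex_of_real (coeff r 1) = 0"
        using r by metis
      then have "coeff r 1 = 0 \<and> coeff r 0 = 0"
        using False by (auto simp: complex_eq_iff)
      then have "r = 0" using r by simp
      then have p: "p = a * (p div a)" using \<open>p = a * (p div a) + r\<close> by simp
      have "0 \<le> poly (p div a) x" if "0 \<le> x" for x
      proof -
        have "poly a x = (x - Re z)\<^sup>2 + (Im z)\<^sup>2" by (simp add: a_def power2_eq_square algebra_simps)
        then have "0 < poly a x" using False by (simp add: add_nonneg_pos)
        then show ?thesis using less(2)[OF that] arg_cong[OF p, of "\<lambda>q. poly q x"]
          by (simp add: zero_le_mult_iff)
      qed
      moreover have "pos_cone (degree a) a" unfolding deg unfolding a_def by (rule pos_cone_quadratic)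
      ultimately show ?thesis by (intro step[OF p]) (simp_all only: deg zero_less_numeral)
    qed
  qed
qed

text \<open>Represents the weighted harmonic mean \<open>A (sA + (1-s)B)^(-1) B\<close>; on non-zero
  arguments \<open>s = 0\<close> gives the constant 1 and \<open>s = 1\<close> the identity. The
  type is general so that one symbol serves real nodes and complex arguments.\<close>

definition hker :: "real \<Rightarrow> 'a \<Rightarrow> 'a :: real_normed_field" where
  "hker s x = x / (of_real s + of_real (1 - s) * x)"

definition conv_wt :: "real set \<Rightarrow> (real \<Rightarrow> real) \<Rightarrow> bool" where
  "conv_wt S w \<longleftrightarrow> finite S \<and> S \<subseteq> {0..1} \<and> (\<forall>s\<in>S. 0 \<le> w s) \<and> sum w S = 1"

definition hsum :: "real set \<Rightarrow> (real \<Rightarrow> real) \<Rightarrow> 'a \<Rightarrow> 'a :: real_normed_field" where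
  "hsum S w x = (\<Sum>s\<in>S. of_real (w s) * hker s x)"

lemma hker_bounds:
  fixes x :: real
  assumes "0 \<le> s" "s \<le> 1" "0 < x"
  shows "0 \<le> hker s x" "hker s x \<le> 1 + x"
proof -
  have d: "0 < s + (1 - s) * x"
    using assms by (cases "s = 1") (auto intro!: add_nonneg_pos)
  then show "0 \<le> hker s x" using assms by (simp add: hker_def)
  have "(1 + x) * (s + (1 - s) * x) = x + s + (1 - s) * x\<^sup>2"
    by (simp add: algebra_simps power2_eq_square)
  moreover have "0 \<le> s + (1 - s) * x\<^sup>2" using assms by simp
  ultimately show "hker s x \<le> 1 + x" using d by (simp add: hker_def divide_le_eq)
qed

lemma hker_one [simp]: "hker s (1 :: real) = 1"
  by (simp add: hker_def)

lemma hsum_bounds: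
  fixes x :: real
  assumes "conv_wt S w" "0 < x"
  shows "0 \<le> hsum S w x" "hsum S w x \<le> 1 + x"
proof -
  have s: "0 \<le> s" "s \<le> 1" "0 \<le> w s" if "s \<in> S" for s
    using assms(1) that by (auto simp: conv_wt_def)
  show "0 \<le> hsum S w x"
    unfolding hsum_def using hker_bounds(1) s assms(2) by (intro sum_nonneg) simp
  have "hsum S w x \<le> (\<Sum>s\<in>S. w s * (1 + x))"
    unfolding hsum_def using hker_bounds(2) s assms(2) by (intro sum_mono) (simp add: mult_left_mono)
  also have "\<dots> = 1 + x" using assms(1) by (simp add: conv_wt_def flip: sum_distrib_right)
  finally show "hsum S w x \<le> 1 + x" .
qed

lemma conv_wt_step:
  assumes "conv_wt S w" "0 \<le> t" "t \<le> 1" "0 \<le> c" "c \<le> 1"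
  obtains S' w' where "conv_wt S' w'" "\<And>x :: real. hsum S' w' x = (1 - c) * hsum S w x + c * hker t x"
proof
  define w' where "w' s = (1 - c) * (if s \<in> S then w s else 0) + (if s = t then c else 0)" for s
  have fin: "finite S" using assms(1) by (simp add: conv_wt_def)
  have *: "(\<Sum>s\<in>insert t S. w' s * h s) = (1 - c) * (\<Sum>s\<in>S. w s * h s) + c * h t" for h :: "real \<Rightarrow> real"
  proof -
    have "(\<Sum>s\<in>insert t S. w' s * h s) =
       (\<Sum>s\<in>insert t S. if s \<in> S then (1 - c) * (w s * h s) else 0) +
       (\<Sum>s\<in>insert t S. if s = t then c * h t else 0)"
      unfolding sum.distrib[symmetric] by (intro sum.cong refl) (auto simp: w'_def algebra_simps)
    also have "(\<Sum>s\<in>insert t S. if s \<in> S then (1 - c) * (w s * h s) else 0) = (\<Sum>s\<in>S. (1 - c) * (w s * h s))"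
      using fin by (intro sum.mono_neutral_cong_right) auto
    finally show ?thesis using fin by (simp add: sum_distrib_left)
  qed
  show "hsum (insert t S) w' x = (1 - c) * hsum S w x + c * hker t x" for x :: real
    using * by (simp add: hsum_def)
  show "conv_wt (insert t S) w'"
    using *[of "\<lambda>_. 1"] assms by (auto simp: conv_wt_def w'_def)
qed

text \<open>
  The functional \<open>P \<mapsto> \<Sum>\<^sub>k P(-y\<^sub>k) f(y\<^sub>k) / (y\<^sub>k \<omega>'(y\<^sub>k))\<close> is positive on squares and on \<open>X\<close> times squares,
  hence on all polynomials that are nonnegative on \<open>[0,\<infinity>)\<close>.
\<close>

lemma matrix_monotone_dual:
  fixes N :: nat and y :: "nat \<Rightarrow> real"
  assumes f: "matrix_monotone f" and fpos: "\<And>x. 0 < x \<Longrightarrow> 0 < f x"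
    and mono: "\<And>i j. i < j \<Longrightarrow> j < 2 * N + 1 \<Longrightarrow> y i < y j" and pos: "0 < y 0"
    and c: "\<And>s. 0 \<le> s \<Longrightarrow> s \<le> 1 \<Longrightarrow> 0 \<le> (\<Sum>k<2 * N + 1. c k * hker s (y k))"
  shows "0 \<le> (\<Sum>k<2 * N + 1. c k * f (y k))"
proof -
  define M where "M = 2 * N + 1"
  have ypos: "0 < y k" if "k < M" for k
    using mono[of 0 k] that pos by (cases "k = 0") (auto simp: M_def)
  have neq: "y k \<noteq> y j" if "k < M" "j < M" "j \<noteq> k" for j k
    using mono[of j k] mono[of k j] that by (cases j k rule: linorder_cases) (auto simp: M_def)
  have nz: "nodal_deriv M y k \<noteq> 0" if "k < M" for k
    using neq[OF that] unfolding nodal_deriv_def prod_zero_iff[OF finite_lessThan] by auto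
  define L where "L k = (\<Prod>j<M. if j = k then 1 else [:y j, 1:])" for k
  \<comment> \<open>Put \<open>u = s / (1 - s)\<close>, so that
    \<open>hker s y = y (1 + u) / (y + u)\<close>. Clearing denominators in
    \<open>\<Sum>k. c k * hker s (y k)\<close> leaves \<open>P u\<close>; as \<open>s\<close> runs
    through \<open>[0, 1)\<close>, \<open>u\<close> runs through
    \<open>[0, \<infinity>)\<close>.\<close>
  define P where "P = (\<Sum>k<M. Polynomial.smult (c k * y k) (L k))"
  have pL: "poly (L k) u = (\<Prod>j<M. if j = k then 1 else y j + u)" for k u
    unfolding L_def poly_prod by (intro prod.cong) auto
  have degL: "degree (L k) \<le> 2 * N" if "k < M" for k
  proof -
    have "degree (L k) \<le> (\<Sum>j<M. degree (if j = k then 1 else [:y j, 1:]))"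
      unfolding L_def using degree_prod_sum_le[of "{..<M}" "\<lambda>j. if j = k then 1 else [:y j, 1:]"]
      by (simp add: o_def)
    also have "\<dots> = (\<Sum>j\<in>{..<M} - {k}. 1)"
      using that by (subst sum.remove[of _ k]) auto
    finally show ?thesis using that by (simp add: M_def)
  qed
  have degP: "degree P \<le> 2 * N"
    unfolding P_def using degL by (intro degree_sum_le) (auto intro: order_trans[OF degree_smult_le])
  have "0 \<le> poly P u" if u: "0 \<le> u" for u
  proof -
    have "poly P u = (\<Sum>k<M. c k * y k * poly (L k) u)"
      by (simp add: P_def poly_sum)
    also have "\<dots> = (\<Sum>k<M. (\<Prod>j<M. y j + u) / (1 + u) * (c k * hker (u / (1 + u)) (y k)))"
    proof (intro sum.cong refl)
      fix k assume "k \<in> {..<M}"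
      then have k: "k < M" by simp
      have "(\<Prod>j<M. y j + u) = (y k + u) * (\<Prod>j\<in>{..<M} - {k}. y j + u)"
        using k by (subst prod.remove[of _ k]) auto
      moreover have "poly (L k) u = (\<Prod>j\<in>{..<M} - {k}. y j + u)"
        unfolding pL using k by (subst prod.remove[of _ k]) (auto intro!: prod.cong)
      ultimately have "(\<Prod>j<M. y j + u) = (y k + u) * poly (L k) u" by simp
      moreover have "hker (u / (1 + u)) (y k) = y k * (1 + u) / (y k + u)"
      proof -
        have "u / (1 + u) + (1 - u / (1 + u)) * y k = (y k + u) / (1 + u)"
        proof -
          have "1 - u / (1 + u) = 1 / (1 + u)" using u by (simp add: field_simps)
          then show ?thesis by (simp add: add_divide_distrib)
        qed
        then show ?thesis by (simp add: hker_def)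
      qed
      ultimately show "c k * y k * poly (L k) u = (\<Prod>j<M. y j + u) / (1 + u) * (c k * hker (u / (1 + u)) (y k))"
        using u ypos[OF k] by simp
    qed
    also have "\<dots> = (\<Prod>j<M. y j + u) / (1 + u) * (\<Sum>k<M. c k * hker (u / (1 + u)) (y k))"
      by (simp only: sum_distrib_left)
    also have "0 \<le> \<dots>"
    proof (intro mult_nonneg_nonneg divide_nonneg_nonneg prod_nonneg)
      show "0 \<le> (\<Sum>k<M. c k * hker (u / (1 + u)) (y k))"
        unfolding M_def using u by (intro c) (auto simp: divide_le_eq_1)
      show "0 \<le> y j + u" if "j \<in> {..<M}" for j using ypos[of j] u that by simp
    qed (use u in auto)
    finally show ?thesis .
  qed
  then have cone: "pos_cone (degree P) P" by (rule nonneg_poly_pos_cone)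
  define \<Lambda> where "\<Lambda> Q = (\<Sum>k<M. poly Q (- y k) * (f (y k) / (y k * nodal_deriv M y k)))" for Q
  have "0 \<le> \<Lambda> Q" if "pos_cone d Q" "d \<le> 2 * N" for d Q
    using that
  proof (induction rule: pos_cone.induct)
    case (sq a d)
    define b where "b = a \<circ>\<^sub>p [:0, - 1:]"
    have b: "poly b x = poly a (- x)" for x by (simp add: b_def poly_pcompose)
    have "degree b \<le> N" using sq degree_pcompose_le[of a "[:0, - 1:]"] by (simp add: b_def)
    then have "0 \<le> (\<Sum>k<2 * N + 1. f (y k) * (poly b (y k))\<^sup>2 / (y k * nodal_deriv (2 * N + 1) y k))"
      using f fpos mono pos by (intro matrix_monotone_odd_nodes_zero)
    also have "\<dots> = \<Lambda> (a * a)"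
      unfolding \<Lambda>_def M_def by (intro sum.cong refl) (simp add: b power2_eq_square mult_ac)
    finally show ?case .
  next
    case (xsq a d)
    define b where "b = a \<circ>\<^sub>p [:0, - 1:]"
    have b: "poly b x = poly a (- x)" for x by (simp add: b_def poly_pcompose)
    have "degree b < N" using xsq degree_pcompose_le[of a "[:0, - 1:]"] by (simp add: b_def)
    then have "(\<Sum>k<2 * N + 1. f (y k) * (poly b (y k))\<^sup>2 / nodal_deriv (2 * N + 1) y k) \<le> 0"
      using f mono pos by (intro matrix_monotone_odd_nodes_infinity)
    \<comment> \<open>At \<open>- y k\<close> the factor \<open>X\<close> is \<open>- y k\<close>:
      it cancels \<open>y k\<close> in the weight and supplies the sign that turns the nonpositive
      sum into a nonnegative value.\<close>
    also have "(\<Sum>k<2 * N + 1. f (y k) * (poly b (y k))\<^sup>2 / nodal_deriv (2 * N + 1) y k) =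
        - \<Lambda> ([:0, 1:] * (a * a))"
      unfolding \<Lambda>_def M_def[symmetric] sum_negf[symmetric]
    proof (intro sum.cong refl)
      fix k assume "k \<in> {..<M}"
      then have "y k \<noteq> 0" using ypos[of k] by simp
      then show "f (y k) * (poly b (y k))\<^sup>2 / nodal_deriv M y k =
          - (poly ([:0, 1:] * (a * a)) (- y k) * (f (y k) / (y k * nodal_deriv M y k)))"
        by (simp add: b power2_eq_square mult_ac)
    qed
    finally show ?case by simp
  next
    case (add d p q)
    then show ?case by (simp add: \<Lambda>_def distrib_right add_divide_distrib sum.distrib)
  qed
  from this[OF cone degP] have "0 \<le> \<Lambda> P" .
  also have "\<Lambda> P = (\<Sum>k<M. c k * f (y k))"
    unfolding \<Lambda>_def
  proof (intro sum.cong refl)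
    fix k assume "k \<in> {..<M}"
    then have k: "k < M" by simp
    have Lk: "poly (L i) (- y k) = (if i = k then nodal_deriv M y k else 0)" if "i < M" for i
    proof (cases "i = k")
      case True
      \<comment> \<open>The value is the product of \<open>y j - y k\<close> over the
        \<open>2 N\<close> indices \<open>j \<noteq> k\<close>; as their number is even, reversing
        all the differences gives \<open>nodal_deriv\<close> without a sign.\<close>
      have "poly (L k) (- y k) = (\<Prod>j<M. (if j = k then 1 else - 1) * (if j = k then 1 else y k - y j))"
        unfolding pL by (intro prod.cong) auto
      also have "\<dots> = (\<Prod>j<M. if j = k then 1 else - 1) * nodal_deriv M y k"
        by (simp only: prod.distrib nodal_deriv_def)
      also have "(\<Prod>j<M. if j = k then 1 else - 1 :: real) = (\<Prod>j\<in>{..<M} - {k}. - 1)"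
        using k by (subst prod.remove[of _ k]) (auto intro!: prod.cong)
      also have "\<dots> = 1" using k by (simp add: M_def)
      finally show ?thesis using True by simp
    next
      case False
      then show ?thesis using k unfolding pL by (auto intro!: bexI[of _ k])
    qed
    have "poly P (- y k) = (\<Sum>i<M. if i = k then c k * y k * nodal_deriv M y k else 0)"
      unfolding P_def poly_sum by (intro sum.cong refl) (auto simp: Lk)
    also have "\<dots> = c k * y k * nodal_deriv M y k" using k by simp
    finally show "poly P (- y k) * (f (y k) / (y k * nodal_deriv M y k)) = c k * f (y k)"
      using nz[OF k] ypos[OF k] by simp
  qed
  finally show ?thesis by (simp add: M_def)
qed

text \<open>
  If every convex combination stayed away from \<open>f\<close> on the nodes, then a near-minimiser of the
  squared distance would separate \<open>f\<close> from all kernels \<open>hker s\<close>; no compactness is needed.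
\<close>

lemma matrix_monotone_approx:
  fixes N :: nat and y :: "nat \<Rightarrow> real"
  assumes f: "matrix_monotone f" and fpos: "\<And>x. 0 < x \<Longrightarrow> 0 < f x" and f1: "f 1 = 1"
    and mono: "\<And>i j. i < j \<Longrightarrow> j < 2 * N + 1 \<Longrightarrow> y i < y j" and pos: "0 < y 0"
    and one: "k1 < 2 * N + 1" "y k1 = 1" and e: "0 < e"
  obtains S w where "conv_wt S w" "\<And>k. k < 2 * N + 1 \<Longrightarrow> \<bar>hsum S w (y k) - f (y k)\<bar> < e"
proof -
  define M where "M = 2 * N + 1"
  have ypos: "0 < y k" if "k < M" for k
    using mono[of 0 k] that pos by (cases "k = 0") (auto simp: M_def)
  define E where "E S w = (\<Sum>k<M. (hsum S w (y k) - f (y k))\<^sup>2)" for S w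
  have Enn: "0 \<le> E S w" for S w unfolding E_def by (intro sum_nonneg) simp
  have "\<exists>S w. conv_wt S w \<and> E S w < e\<^sup>2"
  proof (rule ccontr)
    assume "\<not> ?thesis"
    then have far: "e\<^sup>2 \<le> E S w" if "conv_wt S w" for S w using that by (meson not_less)
    define X where "X = {E S w | S w. conv_wt S w}"
    have wt1: "conv_wt {0} (\<lambda>_. 1)" by (simp add: conv_wt_def)
    then have Xne: "X \<noteq> {}" by (auto simp: X_def)
    have bdd: "bdd_below X" using Enn by (auto simp: X_def intro!: bdd_belowI[of _ 0])
    define D where "D = Inf X"
    have D: "e\<^sup>2 \<le> D" unfolding D_def using Xne far by (intro cInf_greatest) (auto simp: X_def)
    then have D0: "0 < D" using e by (meson less_le_trans zero_less_power)
    have Dle: "D \<le> E S w" if "conv_wt S w" for S w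
      unfolding D_def using that by (intro cInf_lower[OF _ bdd]) (auto simp: X_def)
    define C where "C = (\<Sum>k<M. (1 + y k)\<^sup>2)"
    have C: "0 \<le> C" unfolding C_def by (intro sum_nonneg) simp
    \<comment> \<open>The length of the step from the near-minimiser towards a kernel. Divided by
      \<open>r\<close>, the defect \<open>r^2\<close> of near-minimality and the second-order term
      \<open>r^2 C\<close> amount to at most \<open>r (1 + C) \<le> D\<close>.\<close>
    define r where "r = min 1 (D / (1 + C))"
    have r: "0 < r" "r \<le> 1" using D0 C by (simp_all add: r_def)
    have "r \<le> D / (1 + C)" by (simp add: r_def)
    then have rC: "r * (1 + C) \<le> D" using C by (simp add: pos_le_divide_eq)
    obtain S w where S: "conv_wt S w" and ES: "E S w < D + r\<^sup>2"
    proof -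
      have "Inf X < D + r\<^sup>2" using r by (simp add: D_def)
      then obtain x where "x \<in> X" "x < D + r\<^sup>2" using cInf_lessD[OF Xne] by blast
      then show thesis using that by (auto simp: X_def)
    qed
    define p where "p k = hsum S w (y k)" for k
    define c where "c k = p k - f (y k)" for k
    \<comment> \<open>No step towards \<open>hker t\<close> brings the squared distance below
      \<open>D\<close>, so the inner product of \<open>c\<close> with \<open>h - p\<close> is at
      least \<open>- D / 2\<close>; that of \<open>c\<close> with \<open>p - f\<close> is the
      squared distance, at least \<open>D\<close>. Added, they separate \<open>f\<close> from the
      kernels by \<open>D / 2\<close>.\<close>
    have sep: "(\<Sum>k<M. c k * f (y k)) + D / 2 \<le> (\<Sum>k<M. c k * hker t (y k))" if t: "0 \<le> t" "t \<le> 1" for t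
    proof -
      define h where "h k = hker t (y k)" for k
      obtain S' w' where S': "conv_wt S' w'" and h': "\<And>x :: real. hsum S' w' x = (1 - r) * hsum S w x + r * hker t x"
        using conv_wt_step[OF S t, of r] r by auto
      have "E S' w' = (\<Sum>k<M. (c k)\<^sup>2 + 2 * r * (c k * (h k - p k)) + r\<^sup>2 * (h k - p k)\<^sup>2)"
        unfolding E_def h' by (intro sum.cong refl) (simp add: c_def p_def h_def power2_eq_square algebra_simps)
      also have "\<dots> = E S w + 2 * r * (\<Sum>k<M. c k * (h k - p k)) + r\<^sup>2 * (\<Sum>k<M. (h k - p k)\<^sup>2)"
        by (simp add: sum.distrib sum_distrib_left E_def c_def p_def)
      finally have E': "E S' w' = E S w + 2 * r * (\<Sum>k<M. c k * (h k - p k)) + r\<^sup>2 * (\<Sum>k<M. (h k - p k)\<^sup>2)" .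
      have "(\<Sum>k<M. (h k - p k)\<^sup>2) \<le> C"
        unfolding C_def
      proof (rule sum_mono)
        fix k assume "k \<in> {..<M}"
        then have "0 < y k" using ypos by simp
        then have "\<bar>h k - p k\<bar> \<le> 1 + y k"
          using hker_bounds[OF t, of "y k"] hsum_bounds[OF S, of "y k"] by (simp add: h_def p_def)
        then show "(h k - p k)\<^sup>2 \<le> (1 + y k)\<^sup>2" by (metis abs_ge_zero power2_abs power_mono)
      qed
      then have "r\<^sup>2 * (\<Sum>k<M. (h k - p k)\<^sup>2) \<le> r\<^sup>2 * C" by (intro mult_left_mono) auto
      then have "- r\<^sup>2 * (1 + C) \<le> 2 * r * (\<Sum>k<M. c k * (h k - p k))"
        using Dle[OF S'] E' ES by (simp add: algebra_simps)
      then have "r * (- r * (1 + C)) \<le> r * (2 * (\<Sum>k<M. c k * (h k - p k)))"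
        by (simp add: power2_eq_square algebra_simps)
      then have "- r * (1 + C) \<le> 2 * (\<Sum>k<M. c k * (h k - p k))" using r(1) by (simp only: mult_le_cancel_left_pos)
      then have 1: "- D / 2 \<le> (\<Sum>k<M. c k * (h k - p k))" using rC by simp
      have "(\<Sum>k<M. c k * p k) = (\<Sum>k<M. c k * f (y k)) + E S w"
        unfolding E_def sum.distrib[symmetric]
        by (intro sum.cong refl) (simp add: c_def p_def power2_eq_square algebra_simps)
      then show ?thesis using 1 Dle[OF S] by (simp add: h_def right_diff_distrib sum_subtractf)
    qed
    define g where "g = (\<Sum>k<M. c k * f (y k)) + D / 2"
    \<comment> \<open>\<open>f\<close> and all kernels are 1 at the node \<open>k1\<close>, so
      subtracting \<open>g\<close> there shifts every value by the same constant. The affine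
      separation becomes a linear one, which \<open>matrix_monotone_dual\<close> excludes.\<close>
    define c' where "c' k = c k - (if k = k1 then g else 0)" for k
    have c'sum: "(\<Sum>k<M. c' k * h k) = (\<Sum>k<M. c k * h k) - g * h k1" for h
    proof -
      have "(\<Sum>k<M. c' k * h k) = (\<Sum>k<M. c k * h k - (if k = k1 then g * h k1 else 0))"
        by (intro sum.cong refl) (simp add: c'_def left_diff_distrib)
      then show ?thesis using one(1) by (simp add: sum_subtractf M_def)
    qed
    have "0 \<le> (\<Sum>k<2 * N + 1. c' k * hker s (y k))" if "0 \<le> s" "s \<le> 1" for s
      using c'sum[of "\<lambda>k. hker s (y k)"] sep[OF that] one(2) by (simp add: M_def g_def)
    from matrix_monotone_dual[OF f fpos mono pos this] have "0 \<le> (\<Sum>k<M. c' k * f (y k))"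
      by (simp add: M_def)
    then show False using c'sum[of "\<lambda>k. f (y k)"] one(2) f1 D0 by (simp add: g_def)
  qed
  then obtain S w where S: "conv_wt S w" "E S w < e\<^sup>2" by blast
  have "\<bar>hsum S w (y k) - f (y k)\<bar> < e" if "k < 2 * N + 1" for k
  proof -
    have "(hsum S w (y k) - f (y k))\<^sup>2 \<le> E S w"
      unfolding E_def using that
      by (intro member_le_sum[of k "{..<M}" "\<lambda>k. (hsum S w (y k) - f (y k))\<^sup>2"]) (auto simp: M_def)
    then have "\<bar>hsum S w (y k) - f (y k)\<bar>\<^sup>2 < e\<^sup>2" using S(2) by simp
    from power2_less_imp_less[OF this] e show ?thesis by simp
  qed
  with S(1) show thesis using that by blast
qed

section \<open>Analytic extension\<close>

lemma matrix_monotone_mono: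
  assumes f: "matrix_monotone f" and x: "0 < x" "x \<le> y"
  shows "f x \<le> f y"
proof (cases "x = y")
  case False
  define u where "u k = (if k = 0 then x else y)" for k :: nat
  have "0 \<le> (\<Sum>k<2 * 1. f (u k) * (poly 1 (u k))\<^sup>2 / nodal_deriv (2 * 1) u k)"
    using x False by (intro matrix_monotone_divided_difference[OF f]) (auto simp: u_def)
  moreover have "{..<2} = {0, 1 :: nat}" by auto
  ultimately have "0 \<le> f x / (x - y) + f y / (y - x)"
    by (simp add: u_def nodal_deriv_def)
  also have "\<dots> = (f y - f x) / (y - x)"
    using minus_divide_right[of "f x" "y - x"] by (simp add: diff_divide_distrib)
  finally show ?thesis using x False by (simp add: zero_le_divide_iff)
qed simp

text \<open>For \<open>s \<noteq> 1\<close> the only zero of the denominator is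
  \<open>- s / (1 - s)\<close>, on the removed half-line.\<close>

lemma hker_denom_nonzero:
  fixes z :: complex
  assumes "0 \<le> s" "s \<le> 1" "z \<notin> \<real>\<^sub>\<le>\<^sub>0"
  shows "of_real s + of_real (1 - s) * z \<noteq> 0"
proof
  assume 0: "of_real s + of_real (1 - s) * z = 0"
  then have s: "s \<noteq> 1" by auto
  then have "z = of_real (- s / (1 - s))"
    using 0 by (simp add: field_simps eq_neg_iff_add_eq_0 flip: of_real_diff)
  moreover have "- s / (1 - s) \<le> 0" using assms s by (simp add: divide_nonpos_nonneg)
  ultimately show False using assms(3) nonpos_Reals_of_real_iff by blast
qed

lemma hker_holomorphic:
  assumes "0 \<le> s" "s \<le> 1"
  shows "hker s holomorphic_on (- \<real>\<^sub>\<le>\<^sub>0)"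
  unfolding hker_def using hker_denom_nonzero[OF assms] by (auto intro!: holomorphic_intros)

lemma hsum_holomorphic:
  assumes "conv_wt S w"
  shows "hsum S w holomorphic_on (- \<real>\<^sub>\<le>\<^sub>0)"
proof -
  have "(\<lambda>z. \<Sum>s\<in>S. of_real (w s) * hker s z) holomorphic_on (- \<real>\<^sub>\<le>\<^sub>0)"
    using assms by (intro holomorphic_on_sum holomorphic_on_mult holomorphic_on_const hker_holomorphic)
      (auto simp: conv_wt_def)
  then show ?thesis by (simp add: hsum_def[abs_def])
qed

lemma hsum_of_real: "hsum S w (complex_of_real x) = complex_of_real (hsum S w x)"
  by (simp add: hsum_def hker_def)

text \<open>The kernels are jointly continuous on the compact set \<open>{0..1} \<times> K\<close>,
  and a convex combination inherits their bound. It does not depend on the weights, as Montel's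
  theorem demands.\<close>

lemma hsum_bounded_on_compact:
  assumes K: "compact K" "K \<subseteq> - \<real>\<^sub>\<le>\<^sub>0"
  shows "\<exists>B. \<forall>S w. conv_wt S w \<longrightarrow> (\<forall>z\<in>K. cmod (hsum S w z) \<le> B)"
proof -
  have "continuous_on ({0..1} \<times> K) (\<lambda>(s, z). hker s z)"
    unfolding hker_def case_prod_beta using hker_denom_nonzero K(2)
    by (intro continuous_intros) (auto simp: subset_iff)
  then have "compact ((\<lambda>(s, z). hker s z) ` ({0..1} \<times> K))"
    using K(1) by (intro compact_continuous_image compact_Times) auto
  then obtain B where B: "\<And>s z. 0 \<le> s \<Longrightarrow> s \<le> 1 \<Longrightarrow> z \<in> K \<Longrightarrow> cmod (hker s z) \<le> B"
    by (fastforce dest: compact_imp_bounded simp: bounded_iff)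
  have "cmod (hsum S w z) \<le> B" if S: "conv_wt S w" and z: "z \<in> K" for S w z
  proof -
    have s: "0 \<le> s" "s \<le> 1" "0 \<le> w s" if "s \<in> S" for s
      using S that by (auto simp: conv_wt_def)
    have "cmod (hsum S w z) \<le> (\<Sum>s\<in>S. w s * B)"
      unfolding hsum_def using B[OF _ _ z] s
      by (intro sum_norm_le) (simp add: norm_mult mult_left_mono)
    also have "\<dots> = B" using S by (simp add: conv_wt_def flip: sum_distrib_right)
    finally show ?thesis .
  qed
  then show ?thesis by blast
qed

section \<open>Approximants on dyadic nodes\<close>

lemma dyadic_dense:
  fixes a b :: real
  assumes "0 \<le> a" "a < b"
  obtains p q :: nat where "0 < p" "a < p / 2 ^ q" "p / 2 ^ q < b"
proof -
  obtain q where q: "1 / (b - a) < 2 ^ q" using real_arch_pow[of 2 "1 / (b - a)"] by auto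
  define p where "p = nat (\<lfloor>a * 2 ^ q\<rfloor> + 1)"
  have "0 \<le> a * 2 ^ q" using assms by simp
  then have p: "real p = of_int \<lfloor>a * 2 ^ q\<rfloor> + 1" by (simp add: p_def)
  have "a * 2 ^ q < p" "p \<le> a * 2 ^ q + 1" unfolding p by linarith+
  moreover have "1 < (b - a) * 2 ^ q" using q assms by (simp add: field_simps)
  ultimately have "a * 2 ^ q < p" "p < b * 2 ^ q" by (auto simp: algebra_simps)
  then have "a < p / 2 ^ q" "p / 2 ^ q < b" by (simp_all add: field_simps)
  moreover have "0 < p" using \<open>0 \<le> a * 2 ^ q\<close> \<open>a * 2 ^ q < p\<close> by (metis gr0I leD of_nat_0)
  ultimately show thesis using that by blast
qed

text \<open>Stage \<open>m\<close> uses the nodes \<open>k / 2 ^ m\<close> for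
  \<open>1 \<le> k \<le> 2 * 4 ^ m + 1\<close> and the error \<open>1 / (m + 1)\<close>. The grids
  become finer and at the same time longer, so every positive dyadic number is a node from some
  stage on.\<close>

lemma dyadic_approximants:
  assumes f: "mean_function f"
  obtains S w where "\<And>m. conv_wt (S m) (w m)"
    "\<And>p q. 0 < p \<Longrightarrow> (\<lambda>m. hsum (S m) (w m) (real p / 2 ^ q)) \<longlonglongrightarrow> f (real p / 2 ^ q)"
proof -
  have mf: "matrix_monotone f" "\<And>x. 0 < x \<Longrightarrow> 0 < f x" "f 1 = 1"
    using f by (auto simp: mean_function_def)
  have "\<exists>S w. conv_wt S w \<and> (\<forall>k < 2 * 4 ^ m + 1. \<bar>hsum S w (real (k + 1) / 2 ^ m) - f (real (k + 1) / 2 ^ m)\<bar> < 1 / real (Suc m))" for m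
  proof -
    have "(2 :: nat) ^ m \<le> 4 ^ m" by (intro power_mono) auto
    then have "2 ^ m - 1 < 2 * 4 ^ m + (1 :: nat)" by linarith
    \<comment> \<open>Indices start at 0, so the node 1, which the approximation demands, has index
      \<open>2 ^ m - 1\<close>.\<close>
    moreover have "real (2 ^ m - 1 + 1) / 2 ^ m = 1" by (simp add: of_nat_diff)
    ultimately obtain S w where "conv_wt S w"
      "\<And>k. k < 2 * 4 ^ m + 1 \<Longrightarrow> \<bar>hsum S w (real (k + 1) / 2 ^ m) - f (real (k + 1) / 2 ^ m)\<bar> < 1 / real (Suc m)"
      using matrix_monotone_approx[OF mf, of "4 ^ m" "\<lambda>k. real (k + 1) / 2 ^ m" "2 ^ m - 1" "1 / real (Suc m)"]
      by (auto simp: divide_strict_right_mono)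
    then show ?thesis by blast
  qed
  then obtain S w where S: "\<And>m. conv_wt (S m) (w m)"
    and app: "\<And>m k. k < 2 * 4 ^ m + 1 \<Longrightarrow> \<bar>hsum (S m) (w m) (real (k + 1) / 2 ^ m) - f (real (k + 1) / 2 ^ m)\<bar> < 1 / real (Suc m)"
    by metis
  have "(\<lambda>m. hsum (S m) (w m) (real p / 2 ^ q)) \<longlonglongrightarrow> f (real p / 2 ^ q)" if p: "0 < p" for p q
  proof -
    have "\<bar>hsum (S m) (w m) (real p / 2 ^ q) - f (real p / 2 ^ q)\<bar> < 1 / real (Suc m)" if m: "p + q \<le> m" for m
    proof -
      define k where "k = p * 2 ^ (m - q) - 1"
      have pos: "0 < p * 2 ^ (m - q)" using p by simp
      have "p < 2 ^ p" by (rule less_exp)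
      also have "(2 :: nat) ^ p \<le> 2 ^ m" using m by (intro power_increasing) auto
      finally have "p * 2 ^ (m - q) \<le> 2 ^ m * 2 ^ m"
        by (intro mult_mono power_increasing) auto
      also have "(2 :: nat) ^ m * 2 ^ m = 4 ^ m" by (simp flip: power_mult_distrib)
      finally have "k < 2 * 4 ^ m + 1" unfolding k_def by linarith
      moreover have "real (k + 1) / 2 ^ m = real p / 2 ^ q"
      proof -
        have "k + 1 = p * 2 ^ (m - q)" using pos by (simp add: k_def)
        moreover have "(2 :: real) ^ m = 2 ^ (m - q) * 2 ^ q" using m by (simp flip: power_add)
        ultimately show ?thesis by simp
      qed
      ultimately show ?thesis using app[of k m] by simp
    qed
    then have "\<forall>\<^sub>F m in sequentially. norm (hsum (S m) (w m) (real p / 2 ^ q) - f (real p / 2 ^ q)) \<le> 1 / real (Suc m)"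
      unfolding eventually_sequentially real_norm_def by (meson less_imp_le)
    moreover have "(\<lambda>m. 1 / real (Suc m)) \<longlonglongrightarrow> 0"
      using LIMSEQ_inverse_real_of_nat by (simp add: inverse_eq_divide)
    ultimately have "(\<lambda>m. hsum (S m) (w m) (real p / 2 ^ q) - f (real p / 2 ^ q)) \<longlonglongrightarrow> 0"
      by (rule Lim_null_comparison)
    then show ?thesis using Lim_null by blast
  qed
  with S show thesis using that by blast
qed

lemma open_slit_plane: "open (- \<real>\<^sub>\<le>\<^sub>0 :: complex set)"
  by (simp add: open_Compl)

lemma starlike_slit_plane: "starlike (- \<real>\<^sub>\<le>\<^sub>0 :: complex set)"
proof -
  have "\<real>\<^sub>\<le>\<^sub>0 = complex_of_real ` {..0}" by (auto simp: nonpos_Reals_def)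
  then show ?thesis using starlike_slotted_complex_plane_left[of 0] by simp
qed

text \<open>Montel's theorem gives a locally uniform limit \<open>F\<close> of a subsequence, equal
  to \<open>f\<close> at dyadic points. Monotonicity of \<open>f\<close> and continuity of
  \<open>F\<close> extend the equality to all positive arguments.\<close>

theorem loewner_extension:
  assumes f: "mean_function f"
  obtains F S w where "F holomorphic_on (- \<real>\<^sub>\<le>\<^sub>0)"
    "\<And>x. 0 < x \<Longrightarrow> F (complex_of_real x) = complex_of_real (f x)"
    "\<And>m. conv_wt (S m) (w m)"
    "\<And>K. compact K \<Longrightarrow> K \<subseteq> - \<real>\<^sub>\<le>\<^sub>0 \<Longrightarrow> uniform_limit K (\<lambda>m. hsum (S m) (w m)) F sequentially"
proof -
  obtain S w where S: "\<And>m. conv_wt (S m) (w m)"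
    and lim: "\<And>p q. 0 < p \<Longrightarrow> (\<lambda>m. hsum (S m) (w m) (real p / 2 ^ q)) \<longlonglongrightarrow> f (real p / 2 ^ q)"
    using dyadic_approximants[OF f] by blast
  define H :: "(complex \<Rightarrow> complex) set" where "H = {hsum S w | S w. conv_wt S w}"
  obtain F r where F: "F holomorphic_on (- \<real>\<^sub>\<le>\<^sub>0)" and r: "strict_mono (r :: nat \<Rightarrow> nat)"
    and pw: "\<And>x. x \<in> - \<real>\<^sub>\<le>\<^sub>0 \<Longrightarrow> (\<lambda>m. hsum (S (r m)) (w (r m)) x) \<longlonglongrightarrow> F x"
    and ul: "\<And>K. compact K \<Longrightarrow> K \<subseteq> - \<real>\<^sub>\<le>\<^sub>0 \<Longrightarrow>
      uniform_limit K ((\<lambda>m. hsum (S m) (w m)) \<circ> r) F sequentially"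
  proof (rule Montel[OF open_slit_plane, of H "\<lambda>m. hsum (S m) (w m)"])
    show "h holomorphic_on - \<real>\<^sub>\<le>\<^sub>0" if "h \<in> H" for h
      using that hsum_holomorphic by (auto simp: H_def)
    show "\<exists>B. \<forall>h\<in>H. \<forall>z\<in>K. cmod (h z) \<le> B" if "compact K" "K \<subseteq> - \<real>\<^sub>\<le>\<^sub>0" for K
      using hsum_bounded_on_compact[OF that] by (force simp: H_def)
    show "range (\<lambda>m. hsum (S m) (w m)) \<subseteq> H" using S by (auto simp: H_def)
  qed blast
  have slit: "complex_of_real x \<in> - \<real>\<^sub>\<le>\<^sub>0" if "0 < x" for x
    using that by (simp add: complex_nonpos_Reals_iff)
  have lim_re: "(\<lambda>m. hsum (S (r m)) (w (r m)) x) \<longlonglongrightarrow> Re (F (complex_of_real x))" if "0 < x" for x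
    using tendsto_Re[OF pw[OF slit[OF that]]] by (simp add: hsum_of_real)
  have im: "Im (F (complex_of_real x)) = 0" if "0 < x" for x
    using tendsto_Im[OF pw[OF slit[OF that]]] by (simp add: hsum_of_real LIMSEQ_const_iff)
  have dyadic: "Re (F (complex_of_real (real p / 2 ^ q))) = f (real p / 2 ^ q)" if "0 < p" for p q
    using LIMSEQ_unique[OF lim_re LIMSEQ_subseq_LIMSEQ[OF lim[OF that] r, unfolded o_def]] that by simp
  have mono: "f x \<le> f y" if "0 < x" "x \<le> y" for x y
    using matrix_monotone_mono[OF _ that] f by (simp add: mean_function_def)
  have "Re (F (complex_of_real x)) = f x" if x: "0 < x" for x
  proof (rule ccontr)
    assume ne: "Re (F (complex_of_real x)) \<noteq> f x"
    define G where "G t = Re (F (complex_of_real t))" for t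
    have "isCont F (complex_of_real x)"
      using F slit[OF x] open_slit_plane holomorphic_on_imp_continuous_on continuous_on_eq_continuous_at by blast
    then have "isCont G x"
      unfolding G_def by (intro isCont_Re isCont_o2[of x complex_of_real F]) auto
    then obtain d where d: "0 < d" "\<And>t. \<bar>t - x\<bar> < d \<Longrightarrow> \<bar>G t - G x\<bar> < \<bar>G x - f x\<bar>"
      unfolding continuous_at_eps_delta using ne by (auto simp: dist_real_def G_def) (metis right_minus_eq zero_less_abs_iff)
    \<comment> \<open>If \<open>f x < F x\<close>, then at a dyadic point slightly to the left
      \<open>f\<close> exceeds \<open>f x\<close>, against monotonicity; in the other case a point
      on the right gives the contradiction.\<close>
    show False
    proof (cases "f x < G x")
      case True
      obtain p q :: nat where p: "0 < p" "max 0 (x - d) < p / 2 ^ q" "p / 2 ^ q < x"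
        using dyadic_dense[of "max 0 (x - d)" x] x d(1) by auto
      then have "\<bar>p / 2 ^ q - x\<bar> < d" by auto
      from d(2)[OF this] True have "f x < G (p / 2 ^ q)" by linarith
      also have "G (p / 2 ^ q) = f (p / 2 ^ q)" unfolding G_def using dyadic[OF p(1)] by simp
      also have "\<dots> \<le> f x" using p by (intro mono) auto
      finally show False by simp
    next
      case False
      obtain p q :: nat where p: "0 < p" "x < p / 2 ^ q" "p / 2 ^ q < x + d"
        using dyadic_dense[of x "x + d"] x d(1) by auto
      then have "\<bar>p / 2 ^ q - x\<bar> < d" by auto
      from d(2)[OF this] False ne have "G (p / 2 ^ q) < f x" by (simp add: G_def)
      also have "f x \<le> f (p / 2 ^ q)" using p x by (intro mono) auto
      also have "\<dots> = G (p / 2 ^ q)" unfolding G_def using dyadic[OF p(1)] by simp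
      finally show False by simp
    qed
  qed
  then have "F (complex_of_real x) = complex_of_real (f x)" if "0 < x" for x
    using im[OF that] that by (simp add: complex_eq_iff)
  with that[OF F, of "S \<circ> r" "w \<circ> r"] S ul show thesis by (simp add: o_def)
qed

text \<open>\<open>loewner_extension\<close> shows that the choice in \<open>analytic_ext\<close>
  can be satisfied; the identity theorem, applied along the positive axis, shows that the chosen
  function is the limit \<open>F\<close>, so the approximation carries over to it.\<close>

lemma analytic_ext_approx:
  assumes f: "mean_function f"
  obtains S w where "analytic_ext f holomorphic_on (- \<real>\<^sub>\<le>\<^sub>0)"
    "\<And>x. 0 < x \<Longrightarrow> analytic_ext f (complex_of_real x) = complex_of_real (f x)"
    "\<And>m. conv_wt (S m) (w m)"
    "\<And>K. compact K \<Longrightarrow> K \<subseteq> - \<real>\<^sub>\<le>\<^sub>0 \<Longrightarrow>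
      uniform_limit K (\<lambda>m. hsum (S m) (w m)) (analytic_ext f) sequentially"
proof -
  obtain F S w where F: "F holomorphic_on (- \<real>\<^sub>\<le>\<^sub>0)"
    "\<And>x. 0 < x \<Longrightarrow> F (complex_of_real x) = complex_of_real (f x)"
    and S: "\<And>m. conv_wt (S m) (w m)"
    and ul: "\<And>K. compact K \<Longrightarrow> K \<subseteq> - \<real>\<^sub>\<le>\<^sub>0 \<Longrightarrow> uniform_limit K (\<lambda>m. hsum (S m) (w m)) F sequentially"
    using loewner_extension[OF f] by blast
  let ?P = "\<lambda>F. F holomorphic_on (- \<real>\<^sub>\<le>\<^sub>0) \<and> (\<forall>x>0. F (complex_of_real x) = complex_of_real (f x))"
  have "?P F" using F by blast
  then have "?P (analytic_ext f)" unfolding analytic_ext_def by (rule someI[of ?P])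
  then have G: "analytic_ext f holomorphic_on (- \<real>\<^sub>\<le>\<^sub>0)"
    "\<And>x. 0 < x \<Longrightarrow> analytic_ext f (complex_of_real x) = complex_of_real (f x)" by blast+
  have eq: "analytic_ext f z = F z" if z: "z \<in> - \<real>\<^sub>\<le>\<^sub>0" for z
  proof -
    have conn: "connected (- \<real>\<^sub>\<le>\<^sub>0 :: complex set)"
      by (rule starlike_imp_connected[OF starlike_slit_plane])
    define U where "U = complex_of_real ` {0<..}"
    have "1 islimpt U"
    proof -
      have "(\<lambda>n. complex_of_real (1 + 1 / real (Suc n))) \<longlonglongrightarrow> complex_of_real (1 + 0)"
        using LIMSEQ_inverse_real_of_nat
        by (intro tendsto_intros) (simp add: inverse_eq_divide)
      then show ?thesis unfolding islimpt_sequential U_def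
        by (intro exI[of _ "\<lambda>n. complex_of_real (1 + 1 / real (Suc n))"]) (auto simp: complex_eq_iff add_pos_pos)
    qed
    then have "analytic_ext f z - F z = 0"
      using G F z by (intro analytic_continuation[of "\<lambda>z. analytic_ext f z - F z" "- \<real>\<^sub>\<le>\<^sub>0" U 1 z])
        (auto simp: U_def open_slit_plane conn complex_nonpos_Reals_iff intro!: holomorphic_intros)
    then show ?thesis by simp
  qed
  have "uniform_limit K (\<lambda>m. hsum (S m) (w m)) (analytic_ext f) sequentially"
    if "compact K" "K \<subseteq> - \<real>\<^sub>\<le>\<^sub>0" for K
  proof -
    have "F z = analytic_ext f z" if "z \<in> K" for z using eq that \<open>K \<subseteq> - \<real>\<^sub>\<le>\<^sub>0\<close> by auto
    then show ?thesis
      using uniform_limit_cong'[of K "\<lambda>m. hsum (S m) (w m)" "\<lambda>m. hsum (S m) (w m)" F "analytic_ext f" sequentially]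
        ul[OF that] by blast
  qed
  from that[OF G S this] show thesis .
qed

section \<open>Curves surrounding a finite set\<close>

text \<open>The disks with centre \<open>R\<close> and radius \<open>R - 1 / R\<close> exhaust the
  right half-plane: expanding \<open>(cmod (w - R))^2\<close> shows that \<open>w\<close> lies
  inside as soon as \<open>(cmod w)^2 + 2 < 2 R Re w\<close>. The sum in the definition of
  \<open>R\<close> achieves this for all \<open>w \<in> W\<close> at once.\<close>

lemma circle_around_finite_set:
  fixes W :: "complex set"
  assumes W: "finite W" "\<And>w. w \<in> W \<Longrightarrow> 0 < Re w"
  obtains R r :: real where "0 < r" "r < R" "W \<subseteq> ball (of_real R) r"
proof -
  define R where "R = 2 + (\<Sum>w\<in>W. ((cmod w)\<^sup>2 + 2) / (2 * Re w))"
  have nn: "0 \<le> ((cmod w)\<^sup>2 + 2) / (2 * Re w)" if "w \<in> W" for w using W(2)[OF that] by simp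
  have R: "2 \<le> R" unfolding R_def using nn by (simp add: sum_nonneg)
  then have "1 / R \<le> 1" by simp
  then have pos: "0 < R - 1 / R" using R by linarith
  have "W \<subseteq> ball (of_real R) (R - 1 / R)"
  proof
    fix w assume w: "w \<in> W"
    have "((cmod w)\<^sup>2 + 2) / (2 * Re w) < R"
      unfolding R_def using member_le_sum[of w W "\<lambda>w. ((cmod w)\<^sup>2 + 2) / (2 * Re w)"] w nn W(1) by simp
    then have *: "(cmod w)\<^sup>2 + 2 < 2 * R * Re w"
      using W(2)[OF w] by (simp add: field_simps)
    have "(cmod (w - of_real R))\<^sup>2 = (cmod w)\<^sup>2 - 2 * R * Re w + R\<^sup>2"
      unfolding cmod_power2 by (simp add: power2_eq_square algebra_simps)
    also have "\<dots> < R\<^sup>2 - 2 + (1 / R)\<^sup>2" using * by (smt (verit) zero_le_power2)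
    also have "\<dots> = (R - 1 / R)\<^sup>2" using R by (simp add: power2_eq_square field_simps)
    finally have "cmod (w - of_real R) < R - 1 / R"
      by (rule power2_less_imp_less) (use pos in simp)
    then show "w \<in> ball (of_real R) (R - 1 / R)" by (simp add: dist_norm norm_minus_commute)
  qed
  moreover have "R - 1 / R < R" using R by simp
  ultimately show thesis using that pos by blast
qed

lemma circle_right_half_plane:
  assumes "0 < r" "r < R" "w \<in> path_image (circlepath (of_real R) r)"
  shows "0 < Re w"
proof -
  have "cmod (w - of_real R) = r"
    using assms by (simp add: dist_norm norm_minus_commute)
  then have "\<bar>Re w - R\<bar> \<le> r" using abs_Re_le_cmod[of "w - of_real R"] by simp
  then show ?thesis using assms(2) by linarith
qed

lemma square_in_slit_plane:
  assumes "0 < Re w"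
  shows "w\<^sup>2 \<in> - \<real>\<^sub>\<le>\<^sub>0"
proof -
  have "\<not> (Re (w\<^sup>2) \<le> 0 \<and> Im (w\<^sup>2) = 0)"
  proof
    assume *: "Re (w\<^sup>2) \<le> 0 \<and> Im (w\<^sup>2) = 0"
    then have "Im w = 0" using assms by (simp add: power2_eq_square)
    with * have "Re w * Re w \<le> 0" by (simp add: power2_eq_square)
    then show False using assms by (simp add: mult_le_0_iff)
  qed
  then show ?thesis by (simp add: complex_nonpos_Reals_iff)
qed

text \<open>Points just above and just below the negative axis cannot be enclosed by a circle that
  avoids it. Squaring maps the right half-plane injectively onto the slit plane, so the image of a
  circle in that half-plane can surround them; the factor \<open>2 * w\<close> comes from the
  substitution.\<close>

lemma square_curve:
  assumes r: "0 < r" "r < R"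
  defines "\<gamma> \<equiv> (\<lambda>w. w\<^sup>2) \<circ> circlepath (of_real R) r"
  shows "valid_path \<gamma>" "simple_path \<gamma>" "pathfinish \<gamma> = pathstart \<gamma>" "path_image \<gamma> \<subseteq> - \<real>\<^sub>\<le>\<^sub>0"
    and "contour_integral \<gamma> f = contour_integral (circlepath (of_real R) r) (\<lambda>w. 2 * w * f (w\<^sup>2))"
proof -
  let ?c = "circlepath (of_real R) r"
  show "valid_path \<gamma>" unfolding \<gamma>_def
    by (rule valid_path_compose_holomorphic[of _ _ UNIV]) (auto intro!: holomorphic_intros)
  have "inj_on (\<lambda>w. w\<^sup>2) (path_image ?c)"
  proof (rule inj_onI)
    fix x y assume xy: "x \<in> path_image ?c" "y \<in> path_image ?c" "x\<^sup>2 = y\<^sup>2"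
    then have "x = y \<or> x = - y" by (simp add: power2_eq_iff)
    then show "x = y" using circle_right_half_plane[OF r xy(1)] circle_right_half_plane[OF r xy(2)] by auto
  qed
  then show "simple_path \<gamma>" unfolding \<gamma>_def
    using r by (intro simple_path_continuous_image) (auto intro!: continuous_intros simp: simple_path_circlepath)
  show "pathfinish \<gamma> = pathstart \<gamma>" by (simp add: \<gamma>_def pathfinish_compose pathstart_compose)
  show "path_image \<gamma> \<subseteq> - \<real>\<^sub>\<le>\<^sub>0"
    unfolding \<gamma>_def path_image_compose using square_in_slit_plane circle_right_half_plane[OF r] by blast
  have "contour_integral \<gamma> f = contour_integral ?c (\<lambda>w. deriv (\<lambda>w. w\<^sup>2) w * f (w\<^sup>2))"
    unfolding \<gamma>_def by (rule contour_integral_comp_analyticW[of _ UNIV]) (auto intro!: analytic_intros)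
  moreover have "deriv (\<lambda>w. w\<^sup>2) w = 2 * w" for w :: complex
    by (rule DERIV_imp_deriv) (auto intro!: derivative_eq_intros)
  ultimately show "contour_integral \<gamma> f = contour_integral ?c (\<lambda>w. 2 * w * f (w\<^sup>2))" by simp
qed

lemma Re_csqrt_pos:
  assumes "k \<notin> \<real>\<^sub>\<le>\<^sub>0"
  shows "0 < Re (csqrt k)"
proof (rule ccontr)
  assume "\<not> 0 < Re (csqrt k)"
  then have "Re (csqrt k) = 0" using csqrt_principal[of k] by linarith
  moreover have "s\<^sup>2 = complex_of_real (- (Im s)\<^sup>2)" if "Re s = 0" for s
    using that by (simp add: complex_eq_iff power2_eq_square)
  ultimately have "(csqrt k)\<^sup>2 = complex_of_real (- (Im (csqrt k))\<^sup>2)" by blast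
  then have "k = complex_of_real (- (Im (csqrt k))\<^sup>2)" by (simp only: power2_csqrt)
  moreover have "- (Im (csqrt k))\<^sup>2 \<le> 0" by simp
  ultimately show False using assms nonpos_Reals_of_real_iff by metis
qed

text \<open>Since \<open>2 w / (w^2 - k) = 1 / (w - s) + 1 / (w + s)\<close>, the first summand
  contributes one turn about \<open>s\<close>, the second none because \<open>- s\<close> lies in
  the left half-plane, outside the disk.\<close>

lemma winding_number_square_curve:
  assumes r: "0 < r" "r < R" and s: "s\<^sup>2 = k" "0 < Re s" "s \<in> ball (of_real R) r"
  defines "\<gamma> \<equiv> (\<lambda>w. w\<^sup>2) \<circ> circlepath (of_real R) r"
  shows "k \<notin> path_image \<gamma>" "winding_number \<gamma> k = 1"
proof -
  let ?c = "circlepath (of_real R) r"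
  have off: "s \<notin> path_image ?c" "- s \<notin> path_image ?c"
    using s(3) r circle_right_half_plane[OF r, of "- s"] s(2) by auto
  have eq: "w\<^sup>2 - k = (w - s) * (w - (- s))" for w
    using s(1) by (simp add: algebra_simps power2_eq_square)
  show notin: "k \<notin> path_image \<gamma>"
  proof
    assume "k \<in> path_image \<gamma>"
    then obtain w where w: "w \<in> path_image ?c" "k = w\<^sup>2" unfolding \<gamma>_def path_image_compose by auto
    then have "(w - s) * (w - (- s)) = 0" using eq[of w] by simp
    then have "w = s \<or> w = - s" unfolding mult_eq_0_iff right_minus_eq .
    then show False using off w(1) by auto
  qed
  have "winding_number \<gamma> k = 1 / (2 * of_real pi * \<i>) * contour_integral \<gamma> (\<lambda>z. 1 / (z - k))"
    using winding_number_valid_path[OF square_curve(1)[OF r] notin[unfolded \<gamma>_def]] by (simp add: \<gamma>_def)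
  also have "contour_integral \<gamma> (\<lambda>z. 1 / (z - k)) = contour_integral ?c (\<lambda>w. 2 * w * (1 / (w\<^sup>2 - k)))"
    unfolding \<gamma>_def by (rule square_curve(5)[OF r])
  also have "\<dots> = contour_integral ?c (\<lambda>w. 1 / (w - s) + 1 / (w - (- s)))"
  proof (rule contour_integral_cong)
    fix w assume "w \<in> path_image ?c"
    then have "w - s \<noteq> 0" "w - (- s) \<noteq> 0" unfolding right_minus_eq using off by auto
    then show "2 * w * (1 / (w\<^sup>2 - k)) = 1 / (w - s) + 1 / (w - (- s))"
      unfolding eq by (simp add: field_simps)
  qed simp
  also have "\<dots> = contour_integral ?c (\<lambda>w. 1 / (w - s)) + contour_integral ?c (\<lambda>w. 1 / (w - (- s)))"
    using off by (intro contour_integral_add contour_integrable_inversediff) auto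
  also have "contour_integral ?c (\<lambda>w. 1 / (w - s)) = 2 * of_real pi * \<i>"
  proof -
    have "winding_number ?c (s) = 1"
      using s(3) by (intro winding_number_circlepath) (simp add: dist_norm norm_minus_commute)
    then show ?thesis using winding_number_valid_path[OF valid_path_circlepath off(1)] by (simp add: field_simps)
  qed
  also have "contour_integral ?c (\<lambda>w. 1 / (w - (- s))) = 0"
  proof -
    have "- s \<notin> cball (of_real R) r"
    proof
      assume "- s \<in> cball (of_real R) r"
      then have "cmod (of_real R + s) \<le> r" by (simp add: dist_norm)
      then have "\<bar>R + Re s\<bar> \<le> r" using abs_Re_le_cmod[of "of_real R + s"] by simp
      then show False using s(2) r by simp
    qed
    then have "(\<lambda>w. 1 / (w - (- s))) holomorphic_on cball (of_real R) r"
      by (intro holomorphic_intros) (metis right_minus_eq)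
    then show ?thesis using r
      by (intro contour_integral_unique Cauchy_theorem_convex_simple[of _ "cball (of_real R) r"]) auto
  qed
  finally show "winding_number \<gamma> k = 1" by simp
qed

text \<open>Integrals over an arbitrary surrounding curve reduce to integrals over a circle in the right
  half-plane, where limits can be interchanged with integration.\<close>

lemma surrounding_integral_circle:
  assumes K: "finite K" "K \<subseteq> - \<real>\<^sub>\<le>\<^sub>0"
  obtains R r :: real where "0 < r" "r < R"
    "valid_path ((\<lambda>w. w\<^sup>2) \<circ> circlepath (of_real R) r)" "simple_path ((\<lambda>w. w\<^sup>2) \<circ> circlepath (of_real R) r)"
    "\<And>k. k \<in> K \<Longrightarrow> k \<notin> path_image ((\<lambda>w. w\<^sup>2) \<circ> circlepath (of_real R) r)"
    "\<And>k. k \<in> K \<Longrightarrow> winding_number ((\<lambda>w. w\<^sup>2) \<circ> circlepath (of_real R) r) k = 1"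
    "\<And>\<gamma> f. valid_path \<gamma> \<Longrightarrow> pathfinish \<gamma> = pathstart \<gamma> \<Longrightarrow> path_image \<gamma> \<subseteq> - \<real>\<^sub>\<le>\<^sub>0 - K \<Longrightarrow>
      (\<And>k. k \<in> K \<Longrightarrow> winding_number \<gamma> k = 1) \<Longrightarrow> f holomorphic_on (- \<real>\<^sub>\<le>\<^sub>0 - K) \<Longrightarrow>
      contour_integral \<gamma> f = contour_integral (circlepath (of_real R) r) (\<lambda>w. 2 * w * f (w\<^sup>2))"
proof -
  have re: "0 < Re (csqrt k)" if "k \<in> K" for k
    using that K(2) by (intro Re_csqrt_pos) auto
  have "finite (csqrt ` K)" using K(1) by simp
  moreover have "0 < Re w" if "w \<in> csqrt ` K" for w using re that by (elim imageE) (simp only:)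
  ultimately obtain R r :: real where r: "0 < r" "r < R" and sub: "csqrt ` K \<subseteq> ball (of_real R) r"
    by (rule circle_around_finite_set)
  let ?g = "(\<lambda>w. w\<^sup>2) \<circ> circlepath (of_real R) r"
  have wn: "k \<notin> path_image ?g" "winding_number ?g k = 1" if "k \<in> K" for k
    using winding_number_square_curve[OF r power2_csqrt re[OF that]] sub that by blast+
  have sc: "simply_connected (- \<real>\<^sub>\<le>\<^sub>0 :: complex set)"
    by (rule starlike_imp_simply_connected[OF starlike_slit_plane])
  have conn: "connected (- \<real>\<^sub>\<le>\<^sub>0 :: complex set)" by (rule starlike_imp_connected[OF starlike_slit_plane])
  \<comment> \<open>The winding numbers are 1 on \<open>K\<close> and 0 off the simply connected
    slit plane, so the residue theorem gives a value that is common to all such curves.\<close>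
  have res: "contour_integral \<gamma> f = 2 * of_real pi * \<i> * (\<Sum>p\<in>K. residue f p)"
    if g: "valid_path \<gamma>" "pathfinish \<gamma> = pathstart \<gamma>" "path_image \<gamma> \<subseteq> - \<real>\<^sub>\<le>\<^sub>0 - K"
      and w: "\<And>k. k \<in> K \<Longrightarrow> winding_number \<gamma> k = 1" and f: "f holomorphic_on (- \<real>\<^sub>\<le>\<^sub>0 - K)" for \<gamma> f
  proof -
    have "\<forall>z. z \<notin> - \<real>\<^sub>\<le>\<^sub>0 \<longrightarrow> winding_number \<gamma> z = 0"
      using simply_connected_imp_winding_number_zero[OF sc valid_path_imp_path[OF g(1)]] g by blast
    from Residue_theorem[OF open_slit_plane conn K(1) f g(1,2,3) this]
    show ?thesis using w by simp
  qed
  have sq: "contour_integral \<gamma> f = contour_integral (circlepath (of_real R) r) (\<lambda>w. 2 * w * f (w\<^sup>2))"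
    if g: "valid_path \<gamma>" "pathfinish \<gamma> = pathstart \<gamma>" "path_image \<gamma> \<subseteq> - \<real>\<^sub>\<le>\<^sub>0 - K"
      and w: "\<And>k. k \<in> K \<Longrightarrow> winding_number \<gamma> k = 1" and f: "f holomorphic_on (- \<real>\<^sub>\<le>\<^sub>0 - K)" for \<gamma> f
  proof -
    have sub': "path_image ?g \<subseteq> - \<real>\<^sub>\<le>\<^sub>0 - K" using square_curve(4)[OF r] wn(1) by blast
    from square_curve(5)[OF r, of f] res[OF square_curve(1)[OF r] square_curve(3)[OF r] sub' wn(2) f] res[OF g w f]
    show ?thesis by simp
  qed
  from that[OF r square_curve(1,2)[OF r] wn sq] show thesis .
qed

section \<open>Holomorphic functional calculus\<close>

text \<open>Two distinct points allow a partial fraction step, which leaves the difference of two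
  integrals that are equal by induction. If all points coincide and there are at least two of them,
  the integrand has a primitive. Only a single factor contributes.\<close>

lemma has_contour_integral_inverse_prod:
  assumes g: "valid_path \<gamma>" "pathfinish \<gamma> = pathstart \<gamma>"
    and M: "\<And>a. a \<in># M \<Longrightarrow> a \<notin> path_image \<gamma>" "\<And>a. a \<in># M \<Longrightarrow> winding_number \<gamma> a = 1" "size M = Suc k"
  shows "((\<lambda>z. 1 / (\<Prod>a\<in>#M. z - a)) has_contour_integral (if k = 0 then 2 * of_real pi * \<i> else 0)) \<gamma>"
  using M
proof (induction k arbitrary: M)
  case 0
  then obtain a where "M = {#a#}" using size_eq_Suc_imp_eq_union[of M 0] by auto
  then show ?case using has_contour_integral_winding_number[OF g(1), of a] 0 by simp
next
  case (Suc k)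
  show ?case
  proof (cases "\<exists>a b N. M = add_mset a (add_mset b N) \<and> a \<noteq> b")
    case True
    then obtain a b N where N: "M = add_mset a (add_mset b N)" "a \<noteq> b" by blast
    define c where "c = (if k = 0 then 2 * complex_of_real pi * \<i> else 0)"
    have "((\<lambda>z. 1 / (\<Prod>a\<in>#add_mset a N. z - a)) has_contour_integral c) \<gamma>"
      "((\<lambda>z. 1 / (\<Prod>a\<in>#add_mset b N. z - a)) has_contour_integral c) \<gamma>"
      unfolding c_def using Suc.prems N(1) by (intro Suc.IH; auto)+
    then have "((\<lambda>z. 1 / (a - b) * (1 / (\<Prod>a\<in>#add_mset a N. z - a) - 1 / (\<Prod>a\<in>#add_mset b N. z - a)))
        has_contour_integral (1 / (a - b) * (c - c))) \<gamma>"
      by (intro has_contour_integral_lmul has_contour_integral_diff)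
    moreover have "1 / (a - b) * (1 / (\<Prod>a\<in>#add_mset a N. z - a) - 1 / (\<Prod>a\<in>#add_mset b N. z - a)) =
        1 / (\<Prod>a\<in>#M. z - a)" if z: "z \<in> path_image \<gamma>" for z
    proof -
      have "z - a \<noteq> 0" "z - b \<noteq> 0" "a - b \<noteq> 0" using Suc.prems(1) N z by auto
      moreover have "1 / (d - e) * (1 / (e' * p) - 1 / (d' * p)) = 1 / (e' * (d' * p))"
        if "e' \<noteq> 0" "d' \<noteq> 0" "d - e \<noteq> 0" "d' - e' = d - e" for d e d' e' p :: complex
      proof (cases "p = 0")
        case False
        have "1 / (e' * p) - 1 / (d' * p) = (d' - e') / (e' * (d' * p))"
          using that(1,2) False by (simp add: divide_simps)
        then show ?thesis unfolding that(4) using that(3) by simp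
      qed simp
      ultimately show ?thesis by (simp add: N(1))
    qed
    ultimately show ?thesis by (simp add: has_contour_integral_eq)
  next
    case False
    obtain a M' where M': "M = add_mset a M'" "size M' = Suc k"
      using Suc.prems(3) size_eq_Suc_imp_eq_union[of M "Suc k"] by auto
    have "b = a" if "b \<in># M'" for b
      using False M'(1) multi_member_split[OF that] by metis
    then have "M' = replicate_mset (Suc k) a"
      using M'(2) by (metis set_mset_subset_singletonD singleton_iff subsetI)
    then have M: "M = replicate_mset (Suc (Suc k)) a" using M'(1) by simp
    have a: "a \<notin> path_image \<gamma>" using Suc.prems(1) M by simp
    have "((\<lambda>z. 1 / (z - a) ^ Suc (Suc k)) has_contour_integral 0) \<gamma>"
    proof (rule Cauchy_theorem_primitive[of "- {a}"])
      fix z assume "z \<in> - {a}"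
      then have z: "z - a \<noteq> 0" by simp
      have "((\<lambda>z. inverse (z - a)) has_field_derivative - (inverse (z - a))\<^sup>2) (at z within - {a})"
        using z by (auto intro!: derivative_eq_intros simp: power2_eq_square)
      from DERIV_cmult[OF DERIV_power_Suc[OF this, of k], of "- 1 / of_nat (Suc k)"]
      have "((\<lambda>z. - 1 / of_nat (Suc k) * inverse (z - a) ^ Suc k) has_field_derivative
          - 1 / of_nat (Suc k) * ((1 + of_nat k) * (- (inverse (z - a))\<^sup>2 * inverse (z - a) ^ k))) (at z within - {a})" .
      also have "- 1 / of_nat (Suc k) * ((1 + of_nat k) * (- (inverse (z - a))\<^sup>2 * inverse (z - a) ^ k)) =
          of_nat (Suc k) / of_nat (Suc k) * ((inverse (z - a))\<^sup>2 * inverse (z - a) ^ k)"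
        by (simp del: of_nat_Suc add: of_nat_Suc[symmetric])
      also have "\<dots> = 1 / (z - a) ^ Suc (Suc k)"
        by (simp add: power2_eq_square inverse_eq_divide power_one_over del: of_nat_Suc)
      finally show "((\<lambda>z. - 1 / of_nat (Suc k) * inverse (z - a) ^ Suc k) has_field_derivative
          1 / (z - a) ^ Suc (Suc k)) (at z within - {a})" .
    qed (use g a in auto)
    then show ?thesis by (simp add: M)
  qed
qed

section \<open>Newton products of a matrix and the expansion of its resolvent\<close>

primrec shift_prod :: "complex mat \<Rightarrow> (nat \<Rightarrow> complex) \<Rightarrow> nat \<Rightarrow> complex mat" where
  "shift_prod X t 0 = 1\<^sub>m (dim_row X)"
| "shift_prod X t (Suc k) = shift_prod X t k * (X - t k \<cdot>\<^sub>m 1\<^sub>m (dim_row X))"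

lemma shift_prod_carrier [simp]:
  assumes "X \<in> carrier_mat n n"
  shows "shift_prod X t k \<in> carrier_mat n n"
proof (induction k)
  case (Suc k)
  have "X - t k \<cdot>\<^sub>m 1\<^sub>m (dim_row X) \<in> carrier_mat n n" using assms by (intro minus_carrier_mat) auto
  with Suc show ?case by (simp add: mult_carrier_mat[of _ n n])
qed (use assms in auto)

text \<open>In the entry \<open>(i, j)\<close> of the next product, the indices \<open>l < k\<close>
  are covered by induction; for \<open>l \<ge> k\<close> the entry of the new factor lies below the
  diagonal or is the diagonal entry at \<open>l = j = k\<close>, which the shift cancels. At
  \<open>k = n\<close> this is Cayley-Hamilton for triangular matrices.\<close>

lemma shift_prod_upper_triangular:
  assumes T: "T \<in> carrier_mat n n" "upper_triangular T" and "k \<le> n" "j < k" "i < n"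
  shows "shift_prod T (\<lambda>i. T $$ (i, i)) k $$ (i, j) = 0"
  using assms(3-)
proof (induction k arbitrary: i j)
  case (Suc k)
  let ?M = "shift_prod T (\<lambda>i. T $$ (i, i)) k"
  have M: "?M \<in> carrier_mat n n" using T(1) by simp
  have "shift_prod T (\<lambda>i. T $$ (i, i)) (Suc k) $$ (i, j) =
    (\<Sum>l<n. ?M $$ (i, l) * (T $$ (l, j) - (if l = j then T $$ (k, k) else 0)))"
    using Suc.prems carrier_matD[OF M] carrier_matD[OF T(1)]
    by (auto simp: scalar_prod_def atLeast0LessThan intro!: sum.cong)
  also have "\<dots> = 0"
  proof (intro sum.neutral ballI)
    fix l assume l: "l \<in> {..<n}"
    show "?M $$ (i, l) * (T $$ (l, j) - (if l = j then T $$ (k, k) else 0)) = 0"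
    proof (cases "l < k")
      case True
      then show ?thesis using Suc.IH[of l i] Suc.prems by simp
    next
      case False
      then have "j \<le> l" using Suc.prems by simp
      then consider "j = l" "l = k" | "j < l" using False Suc.prems by linarith
      then have "T $$ (l, j) - (if l = j then T $$ (k, k) else 0) = 0"
        using l carrier_matD(1)[OF T(1)] upper_triangularD[OF T(2), of j l] by cases auto
      then show ?thesis by simp
    qed
  qed
  finally show ?case .
qed simp

lemma schur_triangularisation:
  fixes X :: "complex mat"
  assumes X: "X \<in> carrier_mat n n"
  shows "\<exists>T P Q. T \<in> carrier_mat n n \<and> P \<in> carrier_mat n n \<and> Q \<in> carrier_mat n n \<and>
    upper_triangular T \<and> P * Q = 1\<^sub>m n \<and> Q * P = 1\<^sub>m n \<and> X = P * T * Q \<and>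
    (\<forall>i<n. eigenvalue X (T $$ (i, i)))"
proof -
  obtain as where as: "char_poly X = (\<Prod>a\<leftarrow>as. [:- a, 1:])" using char_poly_factorized[OF X] by blast
  obtain T where T: "T \<in> carrier_mat n n" "upper_triangular T" "similar_mat X T"
    using schur_decomposition_exists[OF X as] by blast
  obtain P Q where PQ: "similar_mat_wit X T P Q" using T(3) unfolding similar_mat_def by blast
  note w = similar_mat_witD2[OF X PQ]
  have "eigenvalue X (T $$ (i, i))" if "i < n" for i
  proof -
    have "T $$ (i, i) \<in> set (diag_mat T)" using that T(1) by (auto simp: diag_mat_def)
    then have "poly (char_poly T) (T $$ (i, i)) = 0"
      unfolding char_poly_upper_triangular[OF T(1,2)] by (force simp: poly_prod_list prod_list_zero_iff)
    then show ?thesis unfolding eigenvalue_root_char_poly[OF X] char_poly_similar[OF T(3)] .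
  qed
  with T w show ?thesis by blast
qed

text \<open>Cayley-Hamilton in factored form, the roots being listed along the diagonal of a Schur
  form. The factored form is wanted because its partial products are the coefficients of the
  resolvent.\<close>

lemma cayley_hamilton_product:
  fixes X :: "complex mat"
  assumes X: "X \<in> carrier_mat n n"
  obtains t where "\<And>i. i < n \<Longrightarrow> eigenvalue X (t i)" "shift_prod X t n = 0\<^sub>m n n"
proof -
  obtain T P Q where w: "T \<in> carrier_mat n n" "P \<in> carrier_mat n n" "Q \<in> carrier_mat n n"
    "upper_triangular T" "P * Q = 1\<^sub>m n" "Q * P = 1\<^sub>m n" "X = P * T * Q" "\<And>i. i < n \<Longrightarrow> eigenvalue X (T $$ (i, i))"
    using schur_triangularisation[OF X] by blast
  define t where "t i = T $$ (i, i)" for i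
  note assocs = assoc_mult_mat[of _ n n _ n _ n] mult_carrier_mat[of _ n n]
    left_mult_one_mat[of _ n n] right_mult_one_mat[of _ n n] minus_carrier_mat
  have conj: "shift_prod X t k = P * shift_prod T t k * Q" for k
  proof (induction k)
    case 0
    then show ?case using w X by (simp add: assocs)
  next
    case (Suc k)
    have M: "shift_prod T t k \<in> carrier_mat n n" using w(1) by simp
    have tc: "t k \<cdot>\<^sub>m 1\<^sub>m n \<in> carrier_mat n n" by simp
    have D: "T - t k \<cdot>\<^sub>m 1\<^sub>m n \<in> carrier_mat n n" by (rule minus_carrier_mat[OF tc])
    have "P * (T - t k \<cdot>\<^sub>m 1\<^sub>m n) * Q = P * T * Q - P * (t k \<cdot>\<^sub>m 1\<^sub>m n) * Q"
      unfolding mult_minus_distrib_mat[OF w(2,1) tc]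
      by (rule minus_mult_distrib_mat[OF mult_carrier_mat[OF w(2,1)] mult_carrier_mat[OF w(2) tc] w(3)])
    also have "P * (t k \<cdot>\<^sub>m 1\<^sub>m n) * Q = t k \<cdot>\<^sub>m 1\<^sub>m n"
      unfolding mult_smult_distrib[OF w(2) one_carrier_mat] right_mult_one_mat[OF w(2)]
        mult_smult_assoc_mat[OF w(2,3)] w(5) ..
    finally have "X - t k \<cdot>\<^sub>m 1\<^sub>m n = P * (T - t k \<cdot>\<^sub>m 1\<^sub>m n) * Q" using w(7) by simp
    then have "shift_prod X t (Suc k) = (P * shift_prod T t k * Q) * (P * (T - t k \<cdot>\<^sub>m 1\<^sub>m n) * Q)"
      using X Suc.IH by simp
    also have "\<dots> = P * shift_prod T t k * (Q * P) * (T - t k \<cdot>\<^sub>m 1\<^sub>m n) * Q"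
      using w(2,3) M D by (simp add: assocs)
    also have "\<dots> = P * (shift_prod T t k * (T - t k \<cdot>\<^sub>m 1\<^sub>m n)) * Q"
      unfolding w(6) using w(2,3) M D by (simp add: assocs)
    finally show ?case using w(1) by simp
  qed
  have "shift_prod T t n = 0\<^sub>m n n"
    unfolding t_def using shift_prod_upper_triangular[OF w(1,4) order_refl] w(1)
      carrier_matD[OF shift_prod_carrier[OF w(1), of "\<lambda>i. T $$ (i, i)" n]] by (intro eq_matI) auto
  then have "shift_prod X t n = 0\<^sub>m n n"
    unfolding conj using w(2,3) by (simp add: right_mult_zero_mat[of _ n n] left_mult_zero_mat[of _ n n])
  with that[of t] w(8) show thesis unfolding t_def by blast
qed

lemma minus_mat_swap:
  fixes A B C :: "'a :: ab_group_add mat"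
  assumes "B \<in> carrier_mat n m" "C \<in> carrier_mat n m" "A = B - C"
  shows "C = B - A"
  unfolding assms(3) using assms(1,2) by (intro eq_matI) auto

lemma shift_inverse:
  assumes X: "X \<in> carrier_mat n n" and z: "\<not> eigenvalue X z"
  shows "inv_mat (z \<cdot>\<^sub>m 1\<^sub>m n - X) \<in> carrier_mat n n"
    and "X * inv_mat (z \<cdot>\<^sub>m 1\<^sub>m n - X) = z \<cdot>\<^sub>m inv_mat (z \<cdot>\<^sub>m 1\<^sub>m n - X) - 1\<^sub>m n"
proof -
  have zc: "z \<cdot>\<^sub>m 1\<^sub>m n \<in> carrier_mat n n" by simp
  have D: "z \<cdot>\<^sub>m 1\<^sub>m n - X \<in> carrier_mat n n" by (rule minus_carrier_mat[OF X])
  have "v = 0\<^sub>v n" if v: "v \<in> carrier_vec n" "(z \<cdot>\<^sub>m 1\<^sub>m n - X) *\<^sub>v v = 0\<^sub>v n" for v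
  proof (rule ccontr)
    assume "v \<noteq> 0\<^sub>v n"
    moreover have "X *\<^sub>v v = z \<cdot>\<^sub>v v"
    proof (rule eq_vecI)
      fix i assume "i < dim_vec (z \<cdot>\<^sub>v v)"
      then have i: "i < n" using v(1) by simp
      have "((z \<cdot>\<^sub>m 1\<^sub>m n - X) *\<^sub>v v) $ i = z * v $ i - (X *\<^sub>v v) $ i"
        unfolding minus_mult_distrib_mat_vec[OF zc X v(1)]
        using i v(1) X by (simp add: scalar_prod_def mult.assoc if_distrib[of "\<lambda>x. x * _"] sum_distrib_left[symmetric] sum.delta cong: if_cong)
      then show "(X *\<^sub>v v) $ i = (z \<cdot>\<^sub>v v) $ i" using v i by simp
    qed (use X v in auto)
    ultimately show False using z v(1) X unfolding eigenvalue_def eigenvector_def by auto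
  qed
  note inv = inv_mat_injective[OF D this]
  show R: "inv_mat (z \<cdot>\<^sub>m 1\<^sub>m n - X) \<in> carrier_mat n n" using inv(1) by blast
  have "1\<^sub>m n = z \<cdot>\<^sub>m inv_mat (z \<cdot>\<^sub>m 1\<^sub>m n - X) - X * inv_mat (z \<cdot>\<^sub>m 1\<^sub>m n - X)"
    using inv(2) unfolding minus_mult_distrib_mat[OF zc X R] mult_smult_assoc_mat[OF one_carrier_mat R]
      left_mult_one_mat[OF R] by simp
  then show "X * inv_mat (z \<cdot>\<^sub>m 1\<^sub>m n - X) = z \<cdot>\<^sub>m inv_mat (z \<cdot>\<^sub>m 1\<^sub>m n - X) - 1\<^sub>m n"
    by (rule minus_mat_swap[OF smult_carrier_mat[OF R] mult_carrier_mat[OF X R]])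
qed

text \<open>For the resolvent \<open>R\<close> one has \<open>(X - t_k) R = (z - t_k) R - 1\<close>.
  Solving for \<open>R\<close> repeatedly is Newton's expansion of \<open>1 / (z - x)\<close>; its
  remainder after \<open>n\<close> steps contains \<open>shift_prod X t n\<close> and vanishes. The
  entries of \<open>R\<close> are thereby explicit rational functions of \<open>z\<close>.\<close>

lemma resolvent_expansion:
  assumes X: "X \<in> carrier_mat n n" and t: "shift_prod X t n = 0\<^sub>m n n"
    and z: "\<not> eigenvalue X z" "\<And>i. i < n \<Longrightarrow> z \<noteq> t i" and ab: "a < n" "b < n"
  shows "inv_mat (z \<cdot>\<^sub>m 1\<^sub>m n - X) $$ (a, b) = (\<Sum>j<n. shift_prod X t j $$ (a, b) / (\<Prod>i<Suc j. z - t i))"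
proof -
  define R where "R = inv_mat (z \<cdot>\<^sub>m 1\<^sub>m n - X)"
  have R: "R \<in> carrier_mat n n" and XR: "X * R = z \<cdot>\<^sub>m R - 1\<^sub>m n"
    using shift_inverse[OF X z(1)] by (simp_all add: R_def)
  have step: "(shift_prod X t (Suc k) * R) $$ (a, b) = (z - t k) * (shift_prod X t k * R) $$ (a, b) - shift_prod X t k $$ (a, b)" for k
  proof -
    let ?M = "shift_prod X t k"
    have M: "?M \<in> carrier_mat n n" using X by simp
    have tc: "t k \<cdot>\<^sub>m 1\<^sub>m n \<in> carrier_mat n n" by simp
    have "shift_prod X t (Suc k) * R = ?M * ((X - t k \<cdot>\<^sub>m 1\<^sub>m n) * R)"
      using X assoc_mult_mat[OF M minus_carrier_mat[OF tc] R, of X] by simp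
    also have "(X - t k \<cdot>\<^sub>m 1\<^sub>m n) * R = (z - t k) \<cdot>\<^sub>m R - 1\<^sub>m n"
      unfolding minus_mult_distrib_mat[OF X tc R] XR mult_smult_assoc_mat[OF one_carrier_mat R] left_mult_one_mat[OF R]
      using R by (intro eq_matI) (auto simp: algebra_simps)
    also have "?M * ((z - t k) \<cdot>\<^sub>m R - 1\<^sub>m n) = (z - t k) \<cdot>\<^sub>m (?M * R) - ?M"
      unfolding mult_minus_distrib_mat[OF M smult_carrier_mat[OF R] one_carrier_mat]
        mult_smult_distrib[OF M R] right_mult_one_mat[OF M] ..
    finally show ?thesis using ab M R by simp
  qed
  have "k \<le> n \<Longrightarrow> R $$ (a, b) = (\<Sum>j<k. shift_prod X t j $$ (a, b) / (\<Prod>i<Suc j. z - t i)) +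
      (shift_prod X t k * R) $$ (a, b) / (\<Prod>i<k. z - t i)" for k
  proof (induction k)
    case 0
    then show ?case using X R by simp
  next
    case (Suc k)
    have nz: "z - t k \<noteq> 0" using z(2)[of k] Suc.prems by simp
    have "(shift_prod X t k * R) $$ (a, b) =
        (shift_prod X t (Suc k) * R) $$ (a, b) / (z - t k) + shift_prod X t k $$ (a, b) / (z - t k)"
      unfolding step using nz by (simp add: diff_divide_distrib)
    then show ?case using Suc by (simp add: add_divide_distrib mult.commute del: shift_prod.simps)
  qed
  from this[OF order_refl] show ?thesis using t R ab by (simp add: R_def left_mult_zero_mat[of _ n n])
qed

lemma finite_eigenvalues:
  fixes X :: "complex mat"
  assumes "X \<in> carrier_mat n n"
  shows "finite {k. eigenvalue X k}"
  using card_finite_spectrum(1)[OF assms] by (simp add: spectrum_def)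

text \<open>Collects what is used later of the curve chosen in \<open>hol_fun\<close>: its winding
  numbers, and rational functions \<open>r a b\<close> that equal the entries of the resolvent off
  the spectrum and have known integrals.\<close>

lemma hol_fun_as_integral:
  fixes X :: "complex mat"
  assumes X: "X \<in> carrier_mat n n" and spec: "\<And>k. eigenvalue X k \<Longrightarrow> k \<in> - \<real>\<^sub>\<le>\<^sub>0"
  defines "K \<equiv> {k. eigenvalue X k}"
  obtains \<gamma> r where "valid_path \<gamma>" "pathfinish \<gamma> = pathstart \<gamma>" "path_image \<gamma> \<subseteq> - \<real>\<^sub>\<le>\<^sub>0 - K"
    "\<And>k. k \<in> K \<Longrightarrow> winding_number \<gamma> k = 1"
    "\<And>a b. r a b holomorphic_on (- K)"
    "\<And>a b z. a < n \<Longrightarrow> b < n \<Longrightarrow> z \<notin> K \<Longrightarrow> r a b z = inv_mat (z \<cdot>\<^sub>m 1\<^sub>m n - X) $$ (a, b)"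
    "\<And>a b. a < n \<Longrightarrow> b < n \<Longrightarrow> (r a b has_contour_integral (if a = b then 2 * of_real pi * \<i> else 0)) \<gamma>"
    "\<And>F a b. a < n \<Longrightarrow> b < n \<Longrightarrow>
      hol_fun F X $$ (a, b) = 1 / (2 * of_real pi * \<i>) * contour_integral \<gamma> (\<lambda>z. F z * r a b z)"
proof -
  have K: "finite K" "K \<subseteq> - \<real>\<^sub>\<le>\<^sub>0" using finite_eigenvalues[OF X] spec by (auto simp: K_def)
  obtain \<gamma>0 where "surrounds_eigenvalues \<gamma>0 X"
  proof -
    obtain R r :: real where Rr: "0 < r" "r < R"
      "valid_path ((\<lambda>w. w\<^sup>2) \<circ> circlepath (of_real R) r)" "simple_path ((\<lambda>w. w\<^sup>2) \<circ> circlepath (of_real R) r)"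
      "\<And>k. k \<in> K \<Longrightarrow> k \<notin> path_image ((\<lambda>w. w\<^sup>2) \<circ> circlepath (of_real R) r)"
      "\<And>k. k \<in> K \<Longrightarrow> winding_number ((\<lambda>w. w\<^sup>2) \<circ> circlepath (of_real R) r) k = 1"
      "\<And>\<gamma> f. valid_path \<gamma> \<Longrightarrow> pathfinish \<gamma> = pathstart \<gamma> \<Longrightarrow> path_image \<gamma> \<subseteq> - \<real>\<^sub>\<le>\<^sub>0 - K \<Longrightarrow>
        (\<And>k. k \<in> K \<Longrightarrow> winding_number \<gamma> k = 1) \<Longrightarrow> f holomorphic_on (- \<real>\<^sub>\<le>\<^sub>0 - K) \<Longrightarrow>
        contour_integral \<gamma> f = contour_integral (circlepath (of_real R) r) (\<lambda>w. 2 * w * f (w\<^sup>2))"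
      by (rule surrounding_integral_circle[OF K]) (rule that; blast)
    have "surrounds_eigenvalues ((\<lambda>w. w\<^sup>2) \<circ> circlepath (of_real R) r) X"
      unfolding surrounds_eigenvalues_def using Rr(3-6) square_curve(3,4)[OF Rr(1,2)] by (simp add: K_def)
    then show thesis using that by blast
  qed
  define \<gamma> where "\<gamma> = (SOME \<gamma>. surrounds_eigenvalues \<gamma> X)"
  have "surrounds_eigenvalues \<gamma> X"
    unfolding \<gamma>_def using \<open>surrounds_eigenvalues \<gamma>0 X\<close> by (rule someI[of "\<lambda>\<gamma>. surrounds_eigenvalues \<gamma> X"])
  then have g: "valid_path \<gamma>" "pathfinish \<gamma> = pathstart \<gamma>" "path_image \<gamma> \<subseteq> - \<real>\<^sub>\<le>\<^sub>0 - K"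
    and wn: "\<And>k. k \<in> K \<Longrightarrow> winding_number \<gamma> k = 1"
    unfolding surrounds_eigenvalues_def by (auto simp: K_def)
  obtain t where t: "\<And>i. i < n \<Longrightarrow> eigenvalue X (t i)" "shift_prod X t n = 0\<^sub>m n n"
    using cayley_hamilton_product[OF X] by blast
  define r where "r a b z = (\<Sum>j<n. shift_prod X t j $$ (a, b) / (\<Prod>i<Suc j. z - t i))" for a b z
  have tK: "t i \<in> K" if "i < n" for i using t(1)[OF that] by (simp add: K_def)
  have hol: "r a b holomorphic_on (- K)" for a b
  proof -
    have "(\<lambda>z. \<Sum>j<n. shift_prod X t j $$ (a, b) / (\<Prod>i<Suc j. z - t i)) holomorphic_on (- K)"
    proof (intro holomorphic_intros)
      fix j z assume "j \<in> {..<n}" "z \<in> - K"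
      then have "z \<noteq> t i" if "i < Suc j" for i using tK[of i] that by auto
      then show "(\<Prod>i<Suc j. z - t i) \<noteq> 0" unfolding prod_zero_iff[OF finite_lessThan] by auto
    qed
    then show ?thesis by (simp add: r_def[abs_def])
  qed
  have req: "r a b z = inv_mat (z \<cdot>\<^sub>m 1\<^sub>m n - X) $$ (a, b)" if "a < n" "b < n" "z \<notin> K" for a b z
    unfolding r_def
  proof (rule resolvent_expansion[symmetric, OF X t(2) _ _ that(1,2)])
    show "\<not> eigenvalue X z" using that(3) by (simp add: K_def)
    show "z \<noteq> t i" if "i < n" for i using tK[OF that] \<open>z \<notin> K\<close> by blast
  qed
  have int: "(r a b has_contour_integral (if a = b then 2 * of_real pi * \<i> else 0)) \<gamma>" if ab: "a < n" "b < n" for a b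
  proof -
    have "((\<lambda>z. \<Sum>j<n. shift_prod X t j $$ (a, b) * (1 / (\<Prod>i<Suc j. z - t i)))
      has_contour_integral (\<Sum>j<n. shift_prod X t j $$ (a, b) * (if j = 0 then 2 * of_real pi * \<i> else 0))) \<gamma>"
    proof (intro has_contour_integral_sum has_contour_integral_lmul)
      fix j assume j: "j \<in> {..<n}"
      define M where "M = image_mset t (mset_set {..<Suc j})"
      have M: "size M = Suc j" "\<And>a. a \<in># M \<Longrightarrow> a \<in> K"
        using tK j unfolding M_def by (auto simp del: lessThan_Suc)
      have "(\<Prod>a\<in>#M. z - a) = (\<Prod>i<Suc j. z - t i)" for z
        unfolding M_def by (simp add: prod_unfold_prod_mset image_mset.compositionality o_def del: prod.lessThan_Suc lessThan_Suc)
      moreover have "((\<lambda>z. 1 / (\<Prod>a\<in>#M. z - a)) has_contour_integral (if j = 0 then 2 * of_real pi * \<i> else 0)) \<gamma>"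
        using M wn g(3) by (intro has_contour_integral_inverse_prod g(1,2)) auto
      ultimately show "((\<lambda>z. 1 / (\<Prod>i<Suc j. z - t i)) has_contour_integral (if j = 0 then 2 * of_real pi * \<i> else 0)) \<gamma>"
        by (simp only:)
    qed simp
    \<comment> \<open>Only \<open>j = 0\<close> has a single factor in the denominator and a
      non-zero integral; its coefficient is an entry of the identity matrix.\<close>
    moreover have "(\<Sum>j<n. shift_prod X t j $$ (a, b) * (if j = 0 then 2 * of_real pi * \<i> else 0)) =
        (\<Sum>j<n. if j = 0 then (if a = b then 2 * of_real pi * \<i> else 0) else 0)"
      using X ab by (intro sum.cong refl) auto
    ultimately show ?thesis using ab by (simp add: r_def[abs_def] del: prod.lessThan_Suc)
  qed
  have "hol_fun F X $$ (a, b) = 1 / (2 * of_real pi * \<i>) * contour_integral \<gamma> (\<lambda>z. F z * r a b z)"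
    if ab: "a < n" "b < n" for F a b
  proof -
    have "contour_integral \<gamma> (\<lambda>z. F z * inv_mat (z \<cdot>\<^sub>m 1\<^sub>m n - X) $$ (a, b)) = contour_integral \<gamma> (\<lambda>z. F z * r a b z)"
      using req[OF ab] g(3) by (intro contour_integral_cong) auto
    then show ?thesis using ab X by (simp add: hol_fun_def Let_def \<gamma>_def)
  qed
  from that[OF g wn hol req int this] show thesis .
qed

section \<open>Functional calculus on harmonic kernels and its limits\<close>

definition mker :: "real \<Rightarrow> complex mat \<Rightarrow> complex mat" where
  "mker s X = inv_mat (of_real s \<cdot>\<^sub>m 1\<^sub>m (dim_row X) + of_real (1 - s) \<cdot>\<^sub>m X) * X"

lemma inv_mat_segment:
  fixes X :: "complex mat"
  assumes X: "X \<in> carrier_mat n n" and spec: "\<And>k. eigenvalue X k \<Longrightarrow> k \<in> - \<real>\<^sub>\<le>\<^sub>0" and s: "0 \<le> s" "s \<le> 1"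
  defines "D \<equiv> of_real s \<cdot>\<^sub>m 1\<^sub>m n + of_real (1 - s) \<cdot>\<^sub>m X"
  shows "D \<in> carrier_mat n n" "inv_mat D \<in> carrier_mat n n" "D * inv_mat D = 1\<^sub>m n" "inv_mat D * D = 1\<^sub>m n"
proof -
  show D: "D \<in> carrier_mat n n" unfolding D_def using X by simp
  have "v = 0\<^sub>v n" if v: "v \<in> carrier_vec n" "D *\<^sub>v v = 0\<^sub>v n" for v
  proof (rule ccontr)
    assume nz: "v \<noteq> 0\<^sub>v n"
    have eq: "of_real s * v $ i + of_real (1 - s) * (X *\<^sub>v v) $ i = 0" if i: "i < n" for i
    proof -
      have "(D *\<^sub>v v) $ i = (\<Sum>j<n. D $$ (i, j) * v $ j)"
        using i v(1) carrier_matD[OF D] by (simp add: scalar_prod_def atLeast0LessThan)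
      also have "\<dots> = (\<Sum>j<n. (if j = i then of_real s * v $ i else 0) + of_real (1 - s) * (X $$ (i, j) * v $ j))"
        using i X by (intro sum.cong refl) (auto simp: D_def distrib_right mult.assoc)
      also have "\<dots> = of_real s * v $ i + of_real (1 - s) * (X *\<^sub>v v) $ i"
        using i v(1) X by (simp add: sum.distrib scalar_prod_def atLeast0LessThan sum_distrib_left)
      finally show ?thesis using v(2) i by simp
    qed
    show False
    proof (cases "s = 1")
      case True
      then have "v = 0\<^sub>v n" using eq v(1) by (intro eq_vecI) auto
      then show False using nz by simp
    next
      case False
      have "X *\<^sub>v v = of_real (- s / (1 - s)) \<cdot>\<^sub>v v"
      proof (rule eq_vecI)
        fix i assume "i < dim_vec (of_real (- s / (1 - s)) \<cdot>\<^sub>v v)"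
        then have i: "i < n" using v(1) by simp
        have "complex_of_real (1 - s) \<noteq> 0" using False by simp
        then have "(X *\<^sub>v v) $ i = - (of_real s / of_real (1 - s) * v $ i)"
          using eq[OF i] by (simp add: field_simps eq_neg_iff_add_eq_0 del: of_real_diff)
        then show "(X *\<^sub>v v) $ i = (of_real (- s / (1 - s)) \<cdot>\<^sub>v v) $ i"
          using i v(1) by simp
      qed (use X v in auto)
      then have "eigenvalue X (of_real (- s / (1 - s)))"
        using X v(1) nz unfolding eigenvalue_def eigenvector_def by auto
      moreover have "- s / (1 - s) \<le> 0" using s False by (simp add: divide_nonpos_nonneg)
      ultimately show False using spec nonpos_Reals_of_real_iff by blast
    qed
  qed
  note inv = inv_mat_injective[OF D this]
  show "inv_mat D \<in> carrier_mat n n" "D * inv_mat D = 1\<^sub>m n" "inv_mat D * D = 1\<^sub>m n" using inv by blast+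
qed

text \<open>The matrix form of
  \<open>(h(z) - h(x)) / (z - x) = s / ((s + (1-s) x) (s + (1-s) z))\<close> for
  \<open>h = hker s\<close>: replacing \<open>h(z)\<close> by \<open>h(X)\<close> in front of the
  resolvent costs a term that is holomorphic on the whole slit plane.\<close>

lemma hker_resolvent:
  fixes X :: "complex mat"
  assumes X: "X \<in> carrier_mat n n" and spec: "\<And>k. eigenvalue X k \<Longrightarrow> k \<in> - \<real>\<^sub>\<le>\<^sub>0" and s: "0 \<le> s" "s \<le> 1"
    and z: "\<not> eigenvalue X z" "z \<notin> \<real>\<^sub>\<le>\<^sub>0" and ab: "a < n" "b < n"
  defines "D \<equiv> of_real s \<cdot>\<^sub>m 1\<^sub>m n + of_real (1 - s) \<cdot>\<^sub>m X"
  defines "R \<equiv> inv_mat (z \<cdot>\<^sub>m 1\<^sub>m n - X)"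
  shows "hker s z * R $$ (a, b) =
    (\<Sum>l<n. mker s X $$ (a, l) * R $$ (l, b)) + inv_mat D $$ (a, b) * (of_real s / (of_real s + of_real (1 - s) * z))"
proof -
  note D = inv_mat_segment[OF X spec s, folded D_def]
  have R: "R \<in> carrier_mat n n" "X * R = z \<cdot>\<^sub>m R - 1\<^sub>m n"
    unfolding R_def using shift_inverse[OF X z(1)] by simp_all
  define e where "e = of_real s + of_real (1 - s) * z"
  have e: "e \<noteq> 0" unfolding e_def by (rule hker_denom_nonzero[OF s z(2)])
  have ms: "mker s X = inv_mat D * X" using X by (simp add: mker_def D_def)
  have IR: "inv_mat D * R \<in> carrier_mat n n" using D(2) R(1) by (rule mult_carrier_mat)
  have "D * R = e \<cdot>\<^sub>m R - of_real (1 - s) \<cdot>\<^sub>m 1\<^sub>m n"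
  proof -
    have "D * R = of_real s \<cdot>\<^sub>m R + of_real (1 - s) \<cdot>\<^sub>m (z \<cdot>\<^sub>m R - 1\<^sub>m n)"
      unfolding D_def add_mult_distrib_mat[OF smult_carrier_mat[OF one_carrier_mat] smult_carrier_mat[OF X] R(1)]
        mult_smult_assoc_mat[OF one_carrier_mat R(1)] mult_smult_assoc_mat[OF X R(1)] left_mult_one_mat[OF R(1)] R(2) ..
    then show ?thesis using R(1) by (intro eq_matI) (auto simp: e_def algebra_simps)
  qed
  then have "inv_mat D * (D * R) = e \<cdot>\<^sub>m (inv_mat D * R) - of_real (1 - s) \<cdot>\<^sub>m inv_mat D"
    by (simp only: mult_minus_distrib_mat[OF D(2) smult_carrier_mat[OF R(1)] smult_carrier_mat[OF one_carrier_mat]]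
        mult_smult_distrib[OF D(2) R(1)] mult_smult_distrib[OF D(2) one_carrier_mat] right_mult_one_mat[OF D(2)])
  moreover have "inv_mat D * (D * R) = R"
    using assoc_mult_mat[OF D(2,1) R(1)] D(4) R(1) by simp
  ultimately have "R $$ (a, b) = (e \<cdot>\<^sub>m (inv_mat D * R) - of_real (1 - s) \<cdot>\<^sub>m inv_mat D) $$ (a, b)" by simp
  then have r: "R $$ (a, b) = e * (inv_mat D * R) $$ (a, b) - of_real (1 - s) * inv_mat D $$ (a, b)"
    using ab carrier_matD[OF IR] carrier_matD[OF D(2)] by simp
  have "mker s X * R = inv_mat D * X * R" by (simp only: ms)
  also have "\<dots> = inv_mat D * (X * R)" by (rule assoc_mult_mat[OF D(2) X R(1)])
  also have "X * R = z \<cdot>\<^sub>m R - 1\<^sub>m n" by (rule R(2))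
  also have "inv_mat D * (z \<cdot>\<^sub>m R - 1\<^sub>m n) = z \<cdot>\<^sub>m (inv_mat D * R) - inv_mat D"
    by (simp only: mult_minus_distrib_mat[OF D(2) smult_carrier_mat[OF R(1)] one_carrier_mat]
        mult_smult_distrib[OF D(2) R(1)] right_mult_one_mat[OF D(2)])
  finally have m: "(mker s X * R) $$ (a, b) = z * (inv_mat D * R) $$ (a, b) - inv_mat D $$ (a, b)"
    using ab carrier_matD[OF IR] carrier_matD[OF D(2)] by simp
  have mc: "mker s X \<in> carrier_mat n n" unfolding ms using D(2) X by (rule mult_carrier_mat)
  have "(\<Sum>l<n. mker s X $$ (a, l) * R $$ (l, b)) = (mker s X * R) $$ (a, b)"
    using ab carrier_matD[OF mc] carrier_matD[OF R(1)] by (simp add: scalar_prod_def atLeast0LessThan)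
  moreover have "z / e * (e * u - c * d) = (z * u - d) + d * (s' / e)" if "s' + c * z = e" for u c d s'
  proof -
    have "s' / e = 1 - c * z / e" using e unfolding that[symmetric] by (simp add: field_simps)
    moreover have "z / e * (e * u) = z * u" using e by simp
    ultimately show ?thesis by (simp add: right_diff_distrib mult_ac)
  qed
  ultimately show ?thesis unfolding hker_def e_def[symmetric] r m
    by (simp only: e_def[symmetric])
qed

text \<open>In \<open>hker_resolvent\<close> the holomorphic term integrates to zero by Cauchy's
  theorem, and the integral of the resolvent is \<open>2 pi i\<close> times the identity, so each
  kernel is sent to \<open>mker s X\<close>.\<close>

lemma hol_fun_hsum:
  fixes X :: "complex mat"
  assumes X: "X \<in> carrier_mat n n" and spec: "\<And>k. eigenvalue X k \<Longrightarrow> k \<in> - \<real>\<^sub>\<le>\<^sub>0"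
    and S: "conv_wt S w" and ab: "a < n" "b < n"
  shows "hol_fun (hsum S w) X $$ (a, b) = (\<Sum>s\<in>S. of_real (w s) * mker s X $$ (a, b))"
proof -
  define K where "K = {k. eigenvalue X k}"
  obtain \<gamma> r where g: "valid_path \<gamma>" "pathfinish \<gamma> = pathstart \<gamma>" "path_image \<gamma> \<subseteq> - \<real>\<^sub>\<le>\<^sub>0 - K"
    and wn: "\<And>k. k \<in> K \<Longrightarrow> winding_number \<gamma> k = 1"
    and hol: "\<And>a b. r a b holomorphic_on (- K)"
    and r: "\<And>a b z. a < n \<Longrightarrow> b < n \<Longrightarrow> z \<notin> K \<Longrightarrow> r a b z = inv_mat (z \<cdot>\<^sub>m 1\<^sub>m n - X) $$ (a, b)"
    and int: "\<And>a b. a < n \<Longrightarrow> b < n \<Longrightarrow> (r a b has_contour_integral (if a = b then 2 * of_real pi * \<i> else 0)) \<gamma>"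
    and hf: "\<And>F a b. a < n \<Longrightarrow> b < n \<Longrightarrow>
      hol_fun F X $$ (a, b) = 1 / (2 * of_real pi * \<i>) * contour_integral \<gamma> (\<lambda>z. F z * r a b z)"
    by (rule hol_fun_as_integral[OF X spec, folded K_def]) (assumption, rule that, assumption+)
  have "((\<lambda>z. hker s z * r a b z) has_contour_integral (2 * of_real pi * \<i> * mker s X $$ (a, b))) \<gamma>"
    if s: "0 \<le> s" "s \<le> 1" for s
  proof -
    define d where "d = inv_mat (of_real s \<cdot>\<^sub>m 1\<^sub>m n + of_real (1 - s) \<cdot>\<^sub>m X) $$ (a, b)"
    have "((\<lambda>z. (\<Sum>l<n. mker s X $$ (a, l) * r l b z) + d * (of_real s / (of_real s + of_real (1 - s) * z)))
      has_contour_integral ((\<Sum>l<n. mker s X $$ (a, l) * (if l = b then 2 * of_real pi * \<i> else 0)) + d * 0)) \<gamma>"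
    proof (intro has_contour_integral_add has_contour_integral_sum has_contour_integral_lmul int)
      have "(\<lambda>z. of_real s / (of_real s + of_real (1 - s) * z)) holomorphic_on (- \<real>\<^sub>\<le>\<^sub>0)"
        using hker_denom_nonzero[OF s] by (auto intro!: holomorphic_intros)
      then show "((\<lambda>z. of_real s / (of_real s + of_real (1 - s) * z)) has_contour_integral 0) \<gamma>"
        using Cauchy_theorem_starlike_simple[OF open_slit_plane starlike_slit_plane _ g(1) _ g(2)] g(3) by blast
    qed (use ab in auto)
    moreover have "(\<Sum>l<n. mker s X $$ (a, l) * (if l = b then 2 * of_real pi * \<i> else 0)) + d * 0 =
        2 * of_real pi * \<i> * mker s X $$ (a, b)"
      using ab by (simp add: if_distrib[of "\<lambda>x. _ * x"] cong: if_cong)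
    moreover have "(\<Sum>l<n. mker s X $$ (a, l) * r l b z) + d * (of_real s / (of_real s + of_real (1 - s) * z)) =
        hker s z * r a b z" if "z \<in> path_image \<gamma>" for z
    proof -
      have z: "\<not> eigenvalue X z" "z \<notin> \<real>\<^sub>\<le>\<^sub>0" "z \<notin> K" using that g(3) by (auto simp: K_def)
      have "(\<Sum>l<n. mker s X $$ (a, l) * r l b z) = (\<Sum>l<n. mker s X $$ (a, l) * inv_mat (z \<cdot>\<^sub>m 1\<^sub>m n - X) $$ (l, b))"
        using r[OF _ ab(2) z(3)] by (intro sum.cong) auto
      then show ?thesis
        using hker_resolvent[OF X spec s z(1,2) ab] r[OF ab z(3)] by (simp only: d_def)
    qed
    ultimately show ?thesis by (metis (no_types, lifting) has_contour_integral_eq)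
  qed
  then have "((\<lambda>z. \<Sum>s\<in>S. of_real (w s) * (hker s z * r a b z)) has_contour_integral
      (\<Sum>s\<in>S. of_real (w s) * (2 * of_real pi * \<i> * mker s X $$ (a, b)))) \<gamma>"
    using S by (intro has_contour_integral_sum has_contour_integral_lmul) (auto simp: conv_wt_def)
  then have "contour_integral \<gamma> (\<lambda>z. hsum S w z * r a b z) =
      (\<Sum>s\<in>S. of_real (w s) * (2 * of_real pi * \<i> * mker s X $$ (a, b)))"
    by (intro contour_integral_unique) (simp add: hsum_def sum_distrib_right mult.assoc)
  then show ?thesis unfolding hf[OF ab] by (simp add: sum_distrib_left mult_ac)
qed

text \<open>The derivative of the chosen curve may be unbounded, so uniform convergence on it does
  not directly give convergence of the integrals. All of them are first moved to one circle in the
  right half-plane, pulled back along the squaring map.\<close>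

lemma hol_fun_tendsto:
  fixes X :: "complex mat"
  assumes X: "X \<in> carrier_mat n n" and spec: "\<And>k. eigenvalue X k \<Longrightarrow> k \<in> - \<real>\<^sub>\<le>\<^sub>0" and ab: "a < n" "b < n"
    and H: "\<And>m. H m holomorphic_on (- \<real>\<^sub>\<le>\<^sub>0)" and F: "F holomorphic_on (- \<real>\<^sub>\<le>\<^sub>0)"
    and ul: "\<And>K. compact K \<Longrightarrow> K \<subseteq> - \<real>\<^sub>\<le>\<^sub>0 \<Longrightarrow> uniform_limit K H F sequentially"
  shows "(\<lambda>m. hol_fun (H m) X $$ (a, b)) \<longlonglongrightarrow> hol_fun F X $$ (a, b)"
proof -
  define K where "K = {k. eigenvalue X k}"
  have K: "finite K" "K \<subseteq> - \<real>\<^sub>\<le>\<^sub>0" using finite_eigenvalues[OF X] spec by (auto simp: K_def)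
  obtain \<gamma> r where g: "valid_path \<gamma>" "pathfinish \<gamma> = pathstart \<gamma>" "path_image \<gamma> \<subseteq> - \<real>\<^sub>\<le>\<^sub>0 - K"
    and wn: "\<And>k. k \<in> K \<Longrightarrow> winding_number \<gamma> k = 1"
    and hol: "\<And>a b. r a b holomorphic_on (- K)"
    and r: "\<And>a b z. a < n \<Longrightarrow> b < n \<Longrightarrow> z \<notin> K \<Longrightarrow> r a b z = inv_mat (z \<cdot>\<^sub>m 1\<^sub>m n - X) $$ (a, b)"
    and int: "\<And>a b. a < n \<Longrightarrow> b < n \<Longrightarrow> (r a b has_contour_integral (if a = b then 2 * of_real pi * \<i> else 0)) \<gamma>"
    and hf: "\<And>F a b. a < n \<Longrightarrow> b < n \<Longrightarrow>
      hol_fun F X $$ (a, b) = 1 / (2 * of_real pi * \<i>) * contour_integral \<gamma> (\<lambda>z. F z * r a b z)"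
    by (rule hol_fun_as_integral[OF X spec, folded K_def]) (assumption, rule that, assumption+)
  obtain R d :: real where Rd: "0 < d" "d < R"
    and "valid_path ((\<lambda>w. w\<^sup>2) \<circ> circlepath (of_real R) d)" "simple_path ((\<lambda>w. w\<^sup>2) \<circ> circlepath (of_real R) d)"
    and off: "\<And>k. k \<in> K \<Longrightarrow> k \<notin> path_image ((\<lambda>w. w\<^sup>2) \<circ> circlepath (of_real R) d)"
    and "\<And>k. k \<in> K \<Longrightarrow> winding_number ((\<lambda>w. w\<^sup>2) \<circ> circlepath (of_real R) d) k = 1"
    and circ: "\<And>\<gamma> f. valid_path \<gamma> \<Longrightarrow> pathfinish \<gamma> = pathstart \<gamma> \<Longrightarrow> path_image \<gamma> \<subseteq> - \<real>\<^sub>\<le>\<^sub>0 - K \<Longrightarrow>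
      (\<And>k. k \<in> K \<Longrightarrow> winding_number \<gamma> k = 1) \<Longrightarrow> f holomorphic_on (- \<real>\<^sub>\<le>\<^sub>0 - K) \<Longrightarrow>
      contour_integral \<gamma> f = contour_integral (circlepath (of_real R) d) (\<lambda>w. 2 * w * f (w\<^sup>2))"
    by (rule surrounding_integral_circle[OF K]) (rule that; blast)
  define C where "C = sphere (complex_of_real R) d"
  have CC: "path_image (circlepath (of_real R) d) = C" using Rd by (simp add: C_def)
  have sqC: "w\<^sup>2 \<in> - \<real>\<^sub>\<le>\<^sub>0 - K" if "w \<in> C" for w
  proof -
    have "w\<^sup>2 \<in> - \<real>\<^sub>\<le>\<^sub>0"
      using that circle_right_half_plane[OF Rd, of w] square_in_slit_plane by (simp only: CC)
    moreover have "w\<^sup>2 \<in> path_image ((\<lambda>w. w\<^sup>2) \<circ> circlepath (of_real R) d)"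
      unfolding path_image_compose CC using that by blast
    ultimately show ?thesis using off by blast
  qed
  have conv: "contour_integral \<gamma> (\<lambda>z. G z * r a b z) =
      contour_integral (circlepath (of_real R) d) (\<lambda>w. 2 * w * (G (w\<^sup>2) * r a b (w\<^sup>2)))"
    if "G holomorphic_on (- \<real>\<^sub>\<le>\<^sub>0)" for G
  proof -
    have "G holomorphic_on (- \<real>\<^sub>\<le>\<^sub>0 - K)" "r a b holomorphic_on (- \<real>\<^sub>\<le>\<^sub>0 - K)"
      by (rule holomorphic_on_subset[OF that], blast) (rule holomorphic_on_subset[OF hol], blast)
    then show ?thesis by (intro circ[OF g wn] holomorphic_on_mult)
  qed
  have cont: "continuous_on C (\<lambda>w. G (w\<^sup>2))" if "G holomorphic_on (- \<real>\<^sub>\<le>\<^sub>0 - K)" for G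
    using sqC by (intro continuous_on_compose2[OF holomorphic_on_imp_continuous_on[OF that]] continuous_intros) auto
  have cr: "continuous_on C (\<lambda>w. r a b (w\<^sup>2))" and cF: "continuous_on C (\<lambda>w. F (w\<^sup>2))"
    and cH: "\<And>m. continuous_on C (\<lambda>w. H m (w\<^sup>2))"
    by (intro cont holomorphic_on_subset[OF hol] holomorphic_on_subset[OF F] holomorphic_on_subset[OF H]; blast)+
  have cpt: "compact C" by (simp add: C_def)
  have "uniform_limit ((\<lambda>w. w\<^sup>2) ` C) H F sequentially"
    using sqC cpt by (intro ul compact_continuous_image continuous_intros) auto
  then have "uniform_limit C (\<lambda>m w. H m (w\<^sup>2)) (\<lambda>w. F (w\<^sup>2)) sequentially"
    by (rule uniform_limit_compose') auto
  then have "uniform_limit C (\<lambda>m w. (2 * w * r a b (w\<^sup>2)) * H m (w\<^sup>2)) (\<lambda>w. (2 * w * r a b (w\<^sup>2)) * F (w\<^sup>2)) sequentially"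
    by (intro uniform_lim_mult uniform_limit_const compact_imp_bounded compact_continuous_image cpt continuous_intros cr cF)
  then have "uniform_limit (sphere (of_real R) d) (\<lambda>m w. 2 * w * (H m (w\<^sup>2) * r a b (w\<^sup>2)))
      (\<lambda>w. 2 * w * (F (w\<^sup>2) * r a b (w\<^sup>2))) sequentially"
    by (simp add: mult_ac C_def)
  moreover have "(\<lambda>w. 2 * w * (H m (w\<^sup>2) * r a b (w\<^sup>2))) contour_integrable_on circlepath (of_real R) d" for m
    by (intro contour_integrable_continuous_circlepath continuous_intros cH cr) (simp_all only: CC cH cr continuous_on_id)
  ultimately have "(\<lambda>m. contour_integral (circlepath (of_real R) d) (\<lambda>w. 2 * w * (H m (w\<^sup>2) * r a b (w\<^sup>2)))) \<longlonglongrightarrow>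
      contour_integral (circlepath (of_real R) d) (\<lambda>w. 2 * w * (F (w\<^sup>2) * r a b (w\<^sup>2)))"
    using Rd(1) by (intro contour_integral_uniform_limit_circlepath) auto
  then show ?thesis
    unfolding hf[OF ab] conv[OF H] conv[OF F] by (intro tendsto_mult tendsto_const)
qed

section \<open>Means of accretive matrices\<close>

lemma midpoint_convex_nonpos:
  fixes h :: "real \<Rightarrow> real"
  assumes cont: "continuous_on {a..b} h" and ends: "h a \<le> 0" "h b \<le> 0"
    and mid: "\<And>u v. u \<in> {a..b} \<Longrightarrow> v \<in> {a..b} \<Longrightarrow> h ((u + v) / 2) \<le> (h u + h v) / 2"
    and t: "t \<in> {a..b}"
  shows "h t \<le> 0"
proof (rule ccontr)
  assume "\<not> h t \<le> 0"
  obtain m where m: "m \<in> {a..b}" "\<And>u. u \<in> {a..b} \<Longrightarrow> h u \<le> h m"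
    using continuous_attains_sup[OF compact_Icc _ cont] t by blast
  have pos: "0 < h m" using m(2)[OF t] \<open>\<not> h t \<le> 0\<close> by simp
  define Z where "Z = {u \<in> {a..b}. h u = h m}"
  have "closed Z" unfolding Z_def by (rule continuous_closed_preimage_constant[OF cont]) simp
  then have "compact ({a..b} \<inter> Z)" by (rule compact_Int_closed[OF compact_Icc])
  moreover have "{a..b} \<inter> Z = Z" by (auto simp: Z_def)
  ultimately have "compact Z" by simp
  moreover have "Z \<noteq> {}" using m(1) by (auto simp: Z_def)
  \<comment> \<open>The leftmost maximiser. It is interior, because the maximum is positive and
    \<open>h\<close> is nonpositive at both ends; then \<open>h\<close> is strictly smaller at
    \<open>u - r\<close> and not larger at \<open>u + r\<close>, against midpoint convexity.\<close>
  ultimately obtain u where u: "u \<in> Z" "\<And>z. z \<in> Z \<Longrightarrow> u \<le> z" using compact_attains_inf[of Z] by auto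
  define r where "r = min (u - a) (b - u)"
  have "u \<noteq> a" "u \<noteq> b" using u(1) pos ends by (auto simp: Z_def)
  then have r: "0 < r" "u - r \<in> {a..b}" "u + r \<in> {a..b}" using u(1) by (auto simp: Z_def r_def)
  have "u - r \<notin> Z" using u(2)[of "u - r"] r(1) by auto
  then have "h (u - r) < h m" using m(2)[OF r(2)] r(2) by (simp add: Z_def)
  moreover have "h u \<le> (h (u - r) + h (u + r)) / 2" using mid[OF r(2,3)] by simp
  ultimately show False using m(2)[OF r(3)] u(1) by (simp add: Z_def)
qed

text \<open>\<open>G\<close> is midpoint convex because \<open>f y \<le> (1 + y) / 2\<close>. The
  chord from \<open>t\<close> to the farther endpoint passes over \<open>1 / 2\<close>, so it bounds
  \<open>f x = G (1 / 2)\<close> from above; multiplied by \<open>2 R\<close>, twice the distance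
  from \<open>t\<close> to that endpoint, this is the claim.\<close>

lemma interpolational_path_le:
  assumes f: "symmetric_mean f" and path: "interpolational_path f g" and x: "0 < x"
    and t: "0 \<le> t" "t \<le> 1" and R: "R = max t (1 - t)"
  shows "1 - t + t * x \<le> g t x + 2 * R * ((1 + x) / 2 - f x)"
proof -
  define G where "G u = g u x" for u
  note p = interpolational_path_scalar[OF path x, folded G_def]
  have mid: "G ((u + v) / 2) \<le> (G u + G v) / 2" if uv: "u \<in> {0..1}" "v \<in> {0..1}" for u v
  proof -
    have "G u * f (G v / G u) \<le> G u * ((1 + G v / G u) / 2)"
      using p(4)[OF uv(1)] p(4)[OF uv(2)] by (intro mult_left_mono symmetric_mean_le_arith[OF f]) auto
    also have "\<dots> = (G u + G v) / 2" using p(4)[OF uv(1)] by (simp add: field_simps)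
    finally show ?thesis using p(5)[OF uv] by simp
  qed
  have chord: "G (1 / 2) \<le> c + d / 2"
    if ab: "0 \<le> a" "a \<le> 1 / 2" "1 / 2 \<le> b" "b \<le> 1" "G a \<le> c + d * a" "G b \<le> c + d * b" for c d a b
  proof -
    define h where "h u = G u - (c + d * u)" for u
    have "h (1 / 2) \<le> 0"
    proof (rule midpoint_convex_nonpos[of a b h "1 / 2"])
      show "continuous_on {a..b} h" unfolding h_def
        by (intro continuous_intros continuous_on_subset[OF p(6)]) (use ab in auto)
      show "h ((u + v) / 2) \<le> (h u + h v) / 2" if "u \<in> {a..b}" "v \<in> {a..b}" for u v
        using mid[of u v] that ab(1-4) by (simp add: h_def field_simps)
    qed (use ab in \<open>auto simp: h_def\<close>)
    then show ?thesis by (simp add: h_def)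
  qed
  show ?thesis
  proof (cases "t \<le> 1 / 2")
    case True
    \<comment> \<open>The slope of the chord from \<open>(t, G t)\<close> to \<open>(1, x)\<close>;
      in the other case the chord joins \<open>(0, 1)\<close> to \<open>(t, G t)\<close>.\<close>
    define d where "d = (x - G t) / (1 - t)"
    have d: "d * (1 - t) = x - G t" using True by (simp add: d_def)
    have "G 1 \<le> G t - d * t + d * 1" using d p(2) by (simp add: right_diff_distrib)
    then have "G (1 / 2) \<le> G t - d * t + d / 2"
      by (intro chord[of t 1]) (use True t in simp_all)
    then have "2 * (1 - t) * f x \<le> 2 * (1 - t) * (G t + d * (1 / 2 - t))"
      using True p(3) by (intro mult_left_mono) (auto simp: algebra_simps)
    also have "\<dots> = 2 * (1 - t) * G t + (1 - 2 * t) * (d * (1 - t))" by (simp add: algebra_simps)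
    also have "\<dots> = G t + (1 - 2 * t) * x" unfolding d by (simp add: algebra_simps)
    finally have "2 * (1 - t) * f x \<le> G t + (1 - 2 * t) * x" .
    moreover have R': "R = 1 - t" using True R by simp
    ultimately show ?thesis unfolding R' by (simp add: G_def field_simps)
  next
    case False
    define d where "d = (G t - 1) / t"
    have d: "d * t = G t - 1" using False by (simp add: d_def)
    have "G t \<le> 1 + d * t" unfolding d by simp
    then have "G (1 / 2) \<le> 1 + d / 2"
      by (intro chord[of 0 t]) (use False t p(1) in simp_all)
    then have "2 * t * f x \<le> 2 * t * (1 + d / 2)"
      using False p(3) by (intro mult_left_mono) auto
    also have "\<dots> = 2 * t + d * t" by (simp add: algebra_simps)
    also have "\<dots> = 2 * t + G t - 1" unfolding d by simp
    finally have "2 * t * f x \<le> 2 * t + G t - 1" .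
    moreover have R': "R = t" using False R by simp
    ultimately show ?thesis unfolding R' by (simp add: G_def field_simps)
  qed
qed

section \<open>Existence of the principal square root\<close>

function tri_sqrt :: "complex mat \<Rightarrow> nat \<Rightarrow> nat \<Rightarrow> complex" where
  "tri_sqrt T i j = (if j < i then 0 else if i = j then csqrt (T $$ (i, i))
     else (T $$ (i, j) - (\<Sum>k\<in>{i<..<j}. tri_sqrt T i k * tri_sqrt T k j)) /
       (csqrt (T $$ (i, i)) + csqrt (T $$ (j, j))))"
  by pat_completeness auto
termination by (relation "Wellfounded.measure (\<lambda>(T, i, j). j - i)") auto

declare tri_sqrt.simps [simp del]

text \<open>Reading \<open>U U = T\<close> along one superdiagonal after the other gives a linear
  equation for each entry, with coefficient \<open>csqrt (T(i,i)) + csqrt (T(j,j))\<close>. Its real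
  part is positive off the slit, so the recursion of \<open>tri_sqrt\<close> never divides by
  zero.\<close>

lemma upper_triangular_sqrt:
  assumes T: "T \<in> carrier_mat n n" "upper_triangular T" and diag: "\<And>i. i < n \<Longrightarrow> T $$ (i, i) \<notin> \<real>\<^sub>\<le>\<^sub>0"
  defines "U \<equiv> Matrix.mat n n (\<lambda>(i, j). tri_sqrt T i j)"
  shows "U \<in> carrier_mat n n" "upper_triangular U" "U * U = T" "\<And>i. i < n \<Longrightarrow> 0 < Re (U $$ (i, i))"
proof -
  show U: "U \<in> carrier_mat n n" by (simp add: U_def)
  have low: "tri_sqrt T i j = 0" if "j < i" for i j using that by (subst tri_sqrt.simps) simp
  have dg: "tri_sqrt T i i = csqrt (T $$ (i, i))" for i by (subst tri_sqrt.simps) simp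
  show "upper_triangular U" unfolding upper_triangular_def U_def using low by auto
  show pos: "0 < Re (U $$ (i, i))" if "i < n" for i
    using Re_csqrt_pos[OF diag[OF that]] that by (simp add: U_def dg del: csqrt.simps)
  show "U * U = T"
  proof (rule eq_matI)
    fix i j assume "i < dim_row T" "j < dim_col T"
    then have ij: "i < n" "j < n" using T(1) by auto
    have "(U * U) $$ (i, j) = (\<Sum>k<n. tri_sqrt T i k * tri_sqrt T k j)"
      using ij by (simp add: U_def scalar_prod_def atLeast0LessThan)
    also have "\<dots> = (\<Sum>k\<in>{i..j}. tri_sqrt T i k * tri_sqrt T k j)"
      using ij low by (intro sum.mono_neutral_right) (auto simp: not_le)
    also have "\<dots> = T $$ (i, j)"
    proof (rule linorder_cases[of i j])
      assume "j < i"
      then show ?thesis using T ij by (auto dest: upper_triangularD)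
    next
      assume "i = j"
      then show ?thesis using power2_csqrt[of "T $$ (j, j)"] by (simp add: dg power2_eq_square del: power2_csqrt csqrt.simps)
    next
      assume lt: "i < j"
      have "{i..j} = insert i (insert j {i<..<j})" using lt by auto
      then have "(\<Sum>k\<in>{i..j}. tri_sqrt T i k * tri_sqrt T k j) =
          tri_sqrt T i j * (csqrt (T $$ (i, i)) + csqrt (T $$ (j, j))) + (\<Sum>k\<in>{i<..<j}. tri_sqrt T i k * tri_sqrt T k j)"
        using lt by (simp add: dg algebra_simps del: csqrt.simps)
      moreover have "csqrt (T $$ (i, i)) + csqrt (T $$ (j, j)) \<noteq> 0"
      proof
        assume "csqrt (T $$ (i, i)) + csqrt (T $$ (j, j)) = 0"
        then have "Re (csqrt (T $$ (i, i))) + Re (csqrt (T $$ (j, j))) = 0" by (metis plus_complex.sel(1) zero_complex.sel(1))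
        then show False using Re_csqrt_pos[OF diag[OF ij(1)]] Re_csqrt_pos[OF diag[OF ij(2)]] by linarith
      qed
      ultimately show ?thesis using lt
        by (subst (asm) (2) tri_sqrt.simps) (simp del: csqrt.simps)
    qed
    finally show "(U * U) $$ (i, j) = T $$ (i, j)" .
  qed (use T(1) in \<open>auto simp: U_def\<close>)
qed

lemma principal_sqrt_exists:
  fixes A :: "complex mat"
  assumes A: "A \<in> carrier_mat n n" and spec: "\<And>k. eigenvalue A k \<Longrightarrow> k \<notin> \<real>\<^sub>\<le>\<^sub>0"
  shows "principal_sqrt A \<in> carrier_mat n n" "principal_sqrt A * principal_sqrt A = A"
proof -
  obtain T P Q where w: "T \<in> carrier_mat n n" "P \<in> carrier_mat n n" "Q \<in> carrier_mat n n"
    "upper_triangular T" "P * Q = 1\<^sub>m n" "Q * P = 1\<^sub>m n" "A = P * T * Q" "\<forall>i<n. eigenvalue A (T $$ (i, i))"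
    using schur_triangularisation[OF A] by blast
  have "T $$ (i, i) \<notin> \<real>\<^sub>\<le>\<^sub>0" if "i < n" for i using w(8) spec that by blast
  then obtain U where U: "U \<in> carrier_mat n n" "upper_triangular U" "U * U = T"
    "\<And>i. i < n \<Longrightarrow> 0 < Re (U $$ (i, i))"
    using upper_triangular_sqrt[OF w(1,4)] by blast
  define S where "S = P * U * Q"
  note assocs = assoc_mult_mat[of _ n n _ n _ n] mult_carrier_mat[of _ n n] left_mult_one_mat[of _ n n]
  have S: "S \<in> carrier_mat n n" unfolding S_def using w(2,3) U(1) by (simp add: mult_carrier_mat[of _ n n])
  have "S * S = P * U * (Q * P) * (U * Q)" unfolding S_def using w(2,3) U(1) by (simp add: assocs)
  also have "\<dots> = P * (U * U) * Q" unfolding w(6) using w(2,3) U(1) by (simp add: assocs)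
  finally have SS: "S * S = A" unfolding U(3) w(7) .
  have "similar_mat_wit S U P Q"
    using w(2,3,5,6) U(1) S by (intro similar_mat_witI[of _ _ n]) (auto simp: S_def)
  then have "char_poly S = char_poly U" by (intro char_poly_similar) (auto simp: similar_mat_def)
  then have "0 < Re k" if "eigenvalue S k" for k
  proof -
    have "poly (char_poly U) k = 0" using that unfolding eigenvalue_root_char_poly[OF S] \<open>char_poly S = char_poly U\<close> .
    then have "k \<in> set (diag_mat U)"
      unfolding char_poly_upper_triangular[OF U(1,2)] by (auto simp: poly_prod_list prod_list_zero_iff)
    then show ?thesis using U(1,4) by (auto simp: diag_mat_def)
  qed
  then have "\<exists>S. S \<in> carrier_mat (dim_row A) (dim_row A) \<and> S * S = A \<and> (\<forall>k. eigenvalue S k \<longrightarrow> 0 < Re k)"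
    using S SS A by auto
  from someI_ex[OF this] show "principal_sqrt A \<in> carrier_mat n n" "principal_sqrt A * principal_sqrt A = A"
    unfolding principal_sqrt_def[symmetric] using A by auto
qed

section \<open>Quadratic forms of accretive matrices and of harmonic means\<close>

lemma accretive_qform_pos:
  assumes "accretive n A" "v \<in> carrier_vec n" "v \<noteq> 0\<^sub>v n"
  shows "0 < qform A v"
proof -
  have "0 < qform (re_mat A) v" using assms unfolding accretive_def pos_def_def qform_def by blast
  then show ?thesis using qform_re_mat[of A n v] assms by (simp add: accretive_def)
qed

lemma qform_eq_zero:
  assumes "A *\<^sub>v v = 0\<^sub>v n" "v \<in> carrier_vec n"
  shows "qform A v = 0"
  using assms by (simp add: qform_def)

lemma accretive_eigenvalue:
  assumes A: "accretive n A" and k: "eigenvalue A k"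
  shows "k \<notin> \<real>\<^sub>\<le>\<^sub>0"
proof -
  have Ac: "A \<in> carrier_mat n n" using A by (simp add: accretive_def)
  obtain v where v: "v \<in> carrier_vec n" "v \<noteq> 0\<^sub>v n" "A *\<^sub>v v = k \<cdot>\<^sub>v v"
    using k Ac unfolding eigenvalue_def eigenvector_def by auto
  have "(A *\<^sub>v v) \<bullet>c v = k * (v \<bullet>c v)"
    unfolding v(3) using v(1) by (intro smult_scalar_prod_distrib[of _ n]) auto
  then have "qform A v = Re k * (\<Sum>i<n. (cmod (v $ i))\<^sup>2)"
    by (simp add: qform_def cscalar_prod_self[OF v(1)])
  then have "0 < Re k * (\<Sum>i<n. (cmod (v $ i))\<^sup>2)" using accretive_qform_pos[OF A v(1,2)] by simp
  moreover have "0 \<le> (\<Sum>i<n. (cmod (v $ i))\<^sup>2)" by (intro sum_nonneg) simp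
  ultimately have "0 < Re k" by (simp add: zero_less_mult_iff)
  then show ?thesis by (auto simp: complex_nonpos_Reals_iff)
qed

lemma accretive_segment:
  assumes A: "accretive n A" and B: "accretive n B" and s: "0 \<le> s" "s \<le> 1"
  defines "D \<equiv> of_real s \<cdot>\<^sub>m A + of_real (1 - s) \<cdot>\<^sub>m B"
  shows "D \<in> carrier_mat n n" "inv_mat D \<in> carrier_mat n n" "D * inv_mat D = 1\<^sub>m n" "inv_mat D * D = 1\<^sub>m n"
proof -
  have c: "A \<in> carrier_mat n n" "B \<in> carrier_mat n n" using A B by (auto simp: accretive_def)
  show D: "D \<in> carrier_mat n n" unfolding D_def using c by simp
  have "v = 0\<^sub>v n" if v: "v \<in> carrier_vec n" "D *\<^sub>v v = 0\<^sub>v n" for v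
  proof (rule ccontr)
    assume nz: "v \<noteq> 0\<^sub>v n"
    have "qform D v = s * qform A v + (1 - s) * qform B v"
      unfolding D_def using c v(1) qform_add[OF smult_carrier_mat[OF c(1)] smult_carrier_mat[OF c(2)] v(1)]
        qform_smult[OF c(1) v(1)] qform_smult[OF c(2) v(1)] by (simp del: of_real_diff)
    moreover have "0 < s * qform A v + (1 - s) * qform B v"
      using accretive_qform_pos[OF A v(1) nz] accretive_qform_pos[OF B v(1) nz] s
      by (cases "s = 0") (auto intro: add_pos_nonneg)
    ultimately show False using qform_eq_zero[OF v(2,1)] by simp
  qed
  note inv = inv_mat_injective[OF D this]
  show "inv_mat D \<in> carrier_mat n n" "D * inv_mat D = 1\<^sub>m n" "inv_mat D * D = 1\<^sub>m n" using inv by blast+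
qed

text \<open>
  The weighted harmonic mean \<open>A D\<inverse> B\<close> with \<open>D = sA + (1-s)B\<close>: with \<open>x = D\<inverse>Bv\<close> and \<open>y = D\<inverse>Av\<close> one has
  \<open>v = (1-s)x + sy\<close> and \<open>Ax = By\<close>, which splits the quadratic form.
\<close>

lemma accretive_harmonic_qform:
  assumes A: "accretive n A" and B: "accretive n B" and s: "0 \<le> s" "s \<le> 1" and v: "v \<in> carrier_vec n"
  defines "D \<equiv> of_real s \<cdot>\<^sub>m A + of_real (1 - s) \<cdot>\<^sub>m B"
  obtains x y where "x \<in> carrier_vec n" "y \<in> carrier_vec n"
    "v = of_real (1 - s) \<cdot>\<^sub>v x + of_real s \<cdot>\<^sub>v y"
    "qform (A * inv_mat D * B) v = (1 - s) * qform A x + s * qform B y"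
proof -
  define c where "c = complex_of_real (1 - s)"
  define d where "d = complex_of_real s"
  have cd: "d + c = 1" by (simp add: c_def d_def)
  have Ac: "A \<in> carrier_mat n n" and Bc: "B \<in> carrier_mat n n" using A B by (auto simp: accretive_def)
  note D = accretive_segment[OF A B s, folded D_def]
  define I where "I = inv_mat D"
  have I: "I \<in> carrier_mat n n" "D * I = 1\<^sub>m n" "I * D = 1\<^sub>m n" using D by (simp_all add: I_def)
  have De: "D = d \<cdot>\<^sub>m A + c \<cdot>\<^sub>m B" by (simp add: D_def c_def d_def)
  have AI: "A * I \<in> carrier_mat n n" and BI: "B * I \<in> carrier_mat n n"
    using Ac Bc I(1) by (auto intro: mult_carrier_mat[of _ n n])
  have right: "M * I * D = M" if M: "M \<in> carrier_mat n n" for M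
    unfolding assoc_mult_mat[OF M I(1) D(1)] I(3) by (rule right_mult_one_mat[OF M])
  have expand: "M * D = d \<cdot>\<^sub>m (M * A) + c \<cdot>\<^sub>m (M * B)" if M: "M \<in> carrier_mat n n" for M
    unfolding De mult_add_distrib_mat[OF M smult_carrier_mat[OF Ac] smult_carrier_mat[OF Bc]]
      mult_smult_distrib[OF M Ac] mult_smult_distrib[OF M Bc] ..
  have expand': "D * (I * M) = d \<cdot>\<^sub>m (A * I * M) + c \<cdot>\<^sub>m (B * I * M)" if M: "M \<in> carrier_mat n n" for M
  proof -
    have IM: "I * M \<in> carrier_mat n n" using I(1) M by (rule mult_carrier_mat)
    show ?thesis
      unfolding De add_mult_distrib_mat[OF smult_carrier_mat[OF Ac] smult_carrier_mat[OF Bc] IM]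
        mult_smult_assoc_mat[OF Ac IM] mult_smult_assoc_mat[OF Bc IM]
        assoc_mult_mat[OF Ac I(1) M] assoc_mult_mat[OF Bc I(1) M] ..
  qed
  have left: "D * (I * M) = M" if M: "M \<in> carrier_mat n n" for M
    using assoc_mult_mat[OF D(1) I(1) M] M by (simp add: I(2))
  \<comment> \<open>With \<open>I\<close> the inverse of \<open>D\<close>, expand
    \<open>A = A I D = D I A\<close> and \<open>B = B I D = D I B\<close> in
    \<open>D = d A + c B\<close>. Comparison gives the identity multiplied by \<open>c\<close> and
    by \<open>d\<close>; since \<open>d + c = 1\<close>, adding the two covers the case where one
    weight is zero.\<close>
  have comm: "A * I * B = B * I * A"
  proof (rule eq_matI)
    fix i j assume "i < dim_row (B * I * A)" "j < dim_col (B * I * A)"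
    then have ij: "i < n" "j < n" using Ac Bc by auto
    have c4: "A * I * A \<in> carrier_mat n n" "A * I * B \<in> carrier_mat n n" "B * I * A \<in> carrier_mat n n" "B * I * B \<in> carrier_mat n n"
      using AI BI Ac Bc by (auto intro: mult_carrier_mat[of _ n n])
    define aa ab ba bb where "aa = (A * I * A) $$ (i, j)" and "ab = (A * I * B) $$ (i, j)"
      and "ba = (B * I * A) $$ (i, j)" and "bb = (B * I * B) $$ (i, j)"
    have entry: "(u \<cdot>\<^sub>m M + w \<cdot>\<^sub>m N) $$ (i, j) = u * M $$ (i, j) + w * N $$ (i, j)"
      if "M \<in> carrier_mat n n" "N \<in> carrier_mat n n" for u w and M N :: "complex mat"
      using that ij by simp
    have "d * aa + c * ab = d * aa + c * ba"
      using expand[OF AI] right[OF Ac] expand'[OF Ac] left[OF Ac] entry[OF c4(1,2), of d c] entry[OF c4(1,3), of d c]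
      by (simp add: aa_def ab_def ba_def)
    moreover have "d * ba + c * bb = d * ab + c * bb"
      using expand[OF BI] right[OF Bc] expand'[OF Bc] left[OF Bc] entry[OF c4(3,4), of d c] entry[OF c4(2,4), of d c]
      by (simp add: ab_def ba_def bb_def)
    ultimately have "(d + c) * ab = (d + c) * ba" by (simp only: distrib_right add_left_cancel add_right_cancel)
    then show "(A * I * B) $$ (i, j) = (B * I * A) $$ (i, j)" using cd by (simp add: ab_def ba_def)
  qed (use Ac Bc in auto)
  define x y where "x = I *\<^sub>v (B *\<^sub>v v)" and "y = I *\<^sub>v (A *\<^sub>v v)"
  define h where "h = (A * I * B) *\<^sub>v v"
  have Bv: "B *\<^sub>v v \<in> carrier_vec n" and Av: "A *\<^sub>v v \<in> carrier_vec n"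
    using Ac Bc v by (auto intro: mult_mat_vec_carrier)
  have xy: "x \<in> carrier_vec n" "y \<in> carrier_vec n"
    unfolding x_def y_def using I(1) Av Bv by (auto intro: mult_mat_vec_carrier)
  have hx: "A *\<^sub>v x = h"
    unfolding x_def h_def assoc_mult_mat_vec[OF AI Bc v] assoc_mult_mat_vec[OF Ac I(1) Bv] ..
  have hy: "B *\<^sub>v y = h"
    unfolding y_def h_def comm assoc_mult_mat_vec[OF BI Ac v] assoc_mult_mat_vec[OF Bc I(1) Av] ..
  have h: "h \<in> carrier_vec n" unfolding hx[symmetric] using Ac xy(1) by (rule mult_mat_vec_carrier)
  have "v = I *\<^sub>v (D *\<^sub>v v)" using assoc_mult_mat_vec[OF I(1) D(1) v] v by (simp add: I(3))
  also have "D *\<^sub>v v = d \<cdot>\<^sub>v (A *\<^sub>v v) + c \<cdot>\<^sub>v (B *\<^sub>v v)"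
  proof -
    have "(k \<cdot>\<^sub>m M) *\<^sub>v v = k \<cdot>\<^sub>v (M *\<^sub>v v)" if "M \<in> carrier_mat n n" for k and M :: "complex mat"
      using that v by (intro eq_vecI) (auto simp: scalar_prod_def sum_distrib_left mult_ac)
    then show ?thesis
      unfolding De add_mult_distrib_mat_vec[OF smult_carrier_mat[OF Ac] smult_carrier_mat[OF Bc] v]
      using Ac Bc by simp
  qed
  also have "I *\<^sub>v (d \<cdot>\<^sub>v (A *\<^sub>v v) + c \<cdot>\<^sub>v (B *\<^sub>v v)) = d \<cdot>\<^sub>v y + c \<cdot>\<^sub>v x"
    unfolding mult_add_distrib_mat_vec[OF I(1) smult_carrier_vec[THEN iffD2, OF Av] smult_carrier_vec[THEN iffD2, OF Bv]]
      mult_mat_vec[OF I(1) Av] mult_mat_vec[OF I(1) Bv] x_def y_def ..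
  also have "\<dots> = c \<cdot>\<^sub>v x + d \<cdot>\<^sub>v y"
    using xy by (intro comm_add_vec[of _ n]) auto
  finally have vxy: "v = c \<cdot>\<^sub>v x + d \<cdot>\<^sub>v y" .
  have "h \<bullet>c v = (\<Sum>i<n. h $ i * cnj (c * x $ i + d * y $ i))"
    unfolding vxy using h xy by (simp add: scalar_prod_def atLeast0LessThan)
  also have "\<dots> = cnj c * (\<Sum>i<n. h $ i * cnj (x $ i)) + cnj d * (\<Sum>i<n. h $ i * cnj (y $ i))"
    by (simp add: distrib_left sum.distrib sum_distrib_left mult_ac)
  also have "\<dots> = cnj c * (h \<bullet>c x) + cnj d * (h \<bullet>c y)"
    using h xy by (simp add: scalar_prod_def atLeast0LessThan)
  finally have "h \<bullet>c v = cnj c * (h \<bullet>c x) + cnj d * (h \<bullet>c y)" .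
  then have "Re (h \<bullet>c v) = (1 - s) * Re (h \<bullet>c x) + s * Re (h \<bullet>c y)"
    by (simp add: c_def d_def)
  then have "qform (A * I * B) v = (1 - s) * qform A x + s * qform B y"
    by (simp add: qform_def h_def[symmetric] hx hy)
  with that[OF xy] vxy show thesis by (simp add: I_def c_def d_def)
qed

text \<open>Cauchy-Schwarz in explicit form: with \<open>c = 1 - s\<close>, \<open>(s + c d) (c u^2
  + s d w^2) - d (c u + s w)^2 = c s (d w - u)^2\<close>. It expresses the weighted harmonic mean of
  1 and \<open>d\<close> as the smallest value of a split form.\<close>

lemma weighted_square_le:
  fixes x y :: complex
  assumes "0 \<le> s" "s \<le> 1" "0 < d"
  shows "hker s d * (cmod (of_real (1 - s) * x + of_real s * y))\<^sup>2 \<le>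
    (1 - s) * (cmod x)\<^sup>2 + s * (d * (cmod y)\<^sup>2)"
proof -
  define c where "c = 1 - s"
  define u w where "u = cmod x" and "w = cmod y"
  have c: "0 \<le> c" using assms by (simp add: c_def)
  have e: "0 < s + c * d" using assms c by (cases "s = 0") (auto simp: c_def intro: add_pos_nonneg)
  have "cmod (of_real c * x + of_real s * y) \<le> c * u + s * w"
    using norm_triangle_ineq[of "of_real c * x" "of_real s * y"] c assms(1)
    by (simp add: norm_mult u_def w_def)
  then have "(cmod (of_real c * x + of_real s * y))\<^sup>2 \<le> (c * u + s * w)\<^sup>2" by (intro power_mono) auto
  then have "d * (cmod (of_real c * x + of_real s * y))\<^sup>2 \<le> d * (c * u + s * w)\<^sup>2"
    using assms(3) by (intro mult_left_mono) auto
  also have "\<dots> = (s + c * d) * (c * u\<^sup>2 + s * (d * w\<^sup>2)) - c * s * (d * w - u)\<^sup>2"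
    by (simp add: power2_eq_square algebra_simps)
  also have "\<dots> \<le> (s + c * d) * (c * u\<^sup>2 + s * (d * w\<^sup>2))" using c assms(1) by simp
  finally have "d * (cmod (of_real c * x + of_real s * y))\<^sup>2 / (s + c * d) \<le> c * u\<^sup>2 + s * (d * w\<^sup>2)"
    using e by (simp add: pos_divide_le_eq mult.commute)
  then show ?thesis by (simp add: hker_def c_def u_def w_def)
qed

text \<open>Passing to real parts does not alter the forms of \<open>A\<close> at \<open>x\<close>
  and of \<open>B\<close> at \<open>y\<close>; in the coordinates given by \<open>G\<close> these
  are weighted sums of squares, to which \<open>weighted_square_le\<close> applies termwise.\<close>

lemma harmonic_qform_lower_bound:
  assumes A: "accretive n A" and B: "accretive n B" and s: "0 \<le> s" "s \<le> 1" and v: "v \<in> carrier_vec n"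
    and G: "G \<in> carrier_mat n n" "re_mat A = cdiag n G (\<lambda>i. 1)" "re_mat B = cdiag n G d" "\<And>i. 0 < d i"
  shows "qform (cdiag n G (\<lambda>i. hker s (d i))) v \<le>
    qform (A * inv_mat (of_real s \<cdot>\<^sub>m A + of_real (1 - s) \<cdot>\<^sub>m B) * B) v"
proof -
  have Ac: "A \<in> carrier_mat n n" and Bc: "B \<in> carrier_mat n n" using A B by (auto simp: accretive_def)
  obtain x y where xy: "x \<in> carrier_vec n" "y \<in> carrier_vec n"
    and vxy: "v = of_real (1 - s) \<cdot>\<^sub>v x + of_real s \<cdot>\<^sub>v y"
    and q: "qform (A * inv_mat (of_real s \<cdot>\<^sub>m A + of_real (1 - s) \<cdot>\<^sub>m B) * B) v = (1 - s) * qform A x + s * qform B y"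
    by (rule accretive_harmonic_qform[OF A B s v])
  define W where "W u = mat_adjoint G *\<^sub>v u" for u
  have G': "mat_adjoint G \<in> carrier_mat n n" using G(1) by simp
  have Wxy: "W x \<in> carrier_vec n" "W y \<in> carrier_vec n"
    unfolding W_def using G' xy by (auto intro: mult_mat_vec_carrier)
  have "W v = of_real (1 - s) \<cdot>\<^sub>v W x + of_real s \<cdot>\<^sub>v W y"
    unfolding vxy W_def using xy
    by (simp only: mult_add_distrib_mat_vec[OF G' smult_carrier_vec[THEN iffD2, OF xy(1)] smult_carrier_vec[THEN iffD2, OF xy(2)]]
        mult_mat_vec[OF G' xy(1)] mult_mat_vec[OF G' xy(2)])
  then have Wv: "W v $ i = of_real (1 - s) * W x $ i + of_real s * W y $ i" if "i < n" for i
    using that Wxy by simp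
  have "qform (cdiag n G (\<lambda>i. hker s (d i))) v = (\<Sum>i<n. hker s (d i) * (cmod (W v $ i))\<^sup>2)"
    using qform_cdiag[OF G(1) v] by (simp add: W_def)
  also have "\<dots> \<le> (\<Sum>i<n. (1 - s) * (cmod (W x $ i))\<^sup>2 + s * (d i * (cmod (W y $ i))\<^sup>2))"
    using weighted_square_le[OF s G(4)] Wv by (intro sum_mono) (simp del: of_real_diff)
  also have "\<dots> = (1 - s) * qform (re_mat A) x + s * qform (re_mat B) y"
    unfolding G(2,3) qform_cdiag[OF G(1) xy(1)] qform_cdiag[OF G(1) xy(2)]
    by (simp add: W_def sum.distrib sum_distrib_left)
  also have "\<dots> = (1 - s) * qform A x + s * qform B y"
    using qform_re_mat[OF Ac xy(1)] qform_re_mat[OF Bc xy(2)] by simp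
  finally show ?thesis using q by simp
qed

section \<open>Transition from harmonic means to arbitrary means\<close>

lemma acc_mean_argument:
  assumes A: "accretive n A" and B: "accretive n B"
  defines "S \<equiv> principal_sqrt A"
  defines "X \<equiv> inv_mat S * B * inv_mat S"
  shows "S \<in> carrier_mat n n" "X \<in> carrier_mat n n"
    and "\<And>k. eigenvalue X k \<Longrightarrow> k \<in> - \<real>\<^sub>\<le>\<^sub>0"
    and "\<And>s. 0 \<le> s \<Longrightarrow> s \<le> 1 \<Longrightarrow>
      S * mker s X * S = A * inv_mat (of_real s \<cdot>\<^sub>m A + of_real (1 - s) \<cdot>\<^sub>m B) * B"
proof -
  have Ac: "A \<in> carrier_mat n n" and Bc: "B \<in> carrier_mat n n" using A B by (auto simp: accretive_def)
  show S: "S \<in> carrier_mat n n"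
    unfolding S_def by (rule principal_sqrt_exists[OF Ac accretive_eigenvalue[OF A]])
  have SS: "S * S = A" unfolding S_def by (rule principal_sqrt_exists[OF Ac accretive_eigenvalue[OF A]])
  have "v = 0\<^sub>v n" if v: "v \<in> carrier_vec n" "S *\<^sub>v v = 0\<^sub>v n" for v
  proof (rule ccontr)
    assume nz: "v \<noteq> 0\<^sub>v n"
    have "A *\<^sub>v v = S *\<^sub>v (S *\<^sub>v v)" unfolding SS[symmetric] by (rule assoc_mult_mat_vec[OF S S v(1)])
    also have "\<dots> = 0\<^sub>v n" unfolding v(2) using carrier_matD[OF S] by (intro eq_vecI) (auto simp: scalar_prod_def)
    finally show False using qform_eq_zero[OF _ v(1)] accretive_qform_pos[OF A v(1) nz] by simp
  qed
  define T where "T = inv_mat S"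
  have T: "T \<in> carrier_mat n n" "S * T = 1\<^sub>m n" "T * S = 1\<^sub>m n"
    unfolding T_def using inv_mat_injective[OF S \<open>\<And>v. v \<in> carrier_vec n \<Longrightarrow> S *\<^sub>v v = 0\<^sub>v n \<Longrightarrow> v = 0\<^sub>v n\<close>] by blast+
  note assocs = assoc_mult_mat[of _ n n _ n _ n] mult_carrier_mat[of _ n n] left_mult_one_mat[of _ n n]
    right_mult_one_mat[of _ n n]
  have XT: "X = T * B * T" by (simp add: X_def T_def)
  show X: "X \<in> carrier_mat n n" unfolding XT using T(1) Bc by (simp add: assocs)
  show spec: "k \<in> - \<real>\<^sub>\<le>\<^sub>0" if k: "eigenvalue X k" for k
  \<comment> \<open>An eigenvector \<open>v\<close> of \<open>X\<close> gives
    \<open>u = S^(-1) v\<close> with \<open>B u = k A u\<close>. For real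
    \<open>k = r \<le> 0\<close> this means \<open>qform B u = r * qform A u\<close>, against the
    positivity of both forms.\<close>
  proof
    assume "k \<in> \<real>\<^sub>\<le>\<^sub>0"
    then obtain r where r: "k = complex_of_real r" "r \<le> 0" by (auto simp: nonpos_Reals_def)
    obtain v where v: "v \<in> carrier_vec n" "v \<noteq> 0\<^sub>v n" "X *\<^sub>v v = k \<cdot>\<^sub>v v"
      using k X unfolding eigenvalue_def eigenvector_def by auto
    define u where "u = T *\<^sub>v v"
    have u: "u \<in> carrier_vec n" unfolding u_def using T(1) v(1) by (rule mult_mat_vec_carrier)
    have Su: "S *\<^sub>v u = v" unfolding u_def using assoc_mult_mat_vec[OF S T(1) v(1)] v(1) by (simp add: T(2))
    have "u \<noteq> 0\<^sub>v n"
    proof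
      assume "u = 0\<^sub>v n"
      then have "S *\<^sub>v u = 0\<^sub>v n" using carrier_matD[OF S] by (intro eq_vecI) (auto simp: scalar_prod_def)
      then show False using Su v(2) by simp
    qed
    have "S * X * S = (S * T) * B * (T * S)" unfolding XT using S T(1) Bc by (simp add: assocs)
    then have SXS: "S * X * S = B" using Bc by (simp add: T(2,3) assocs)
    have SX: "S * X \<in> carrier_mat n n" using S X by (rule mult_carrier_mat)
    have "B *\<^sub>v u = S *\<^sub>v (X *\<^sub>v v)"
      unfolding SXS[symmetric] assoc_mult_mat_vec[OF SX S u] Su by (rule assoc_mult_mat_vec[OF S X v(1)])
    also have "\<dots> = k \<cdot>\<^sub>v (S *\<^sub>v v)" unfolding v(3) by (rule mult_mat_vec[OF S v(1)])
    also have "S *\<^sub>v v = A *\<^sub>v u" unfolding SS[symmetric] assoc_mult_mat_vec[OF S S u] Su ..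
    finally have Bu: "B *\<^sub>v u = k \<cdot>\<^sub>v (A *\<^sub>v u)" .
    have Au: "A *\<^sub>v u \<in> carrier_vec n" using Ac u by (rule mult_mat_vec_carrier)
    have "(B *\<^sub>v u) \<bullet>c u = k * ((A *\<^sub>v u) \<bullet>c u)"
      unfolding Bu using Au u by (intro smult_scalar_prod_distrib[of _ n]) auto
    then have "qform B u = r * qform A u" by (simp add: qform_def r(1))
    moreover have "0 < qform B u" "0 < qform A u"
      using accretive_qform_pos[OF _ u \<open>u \<noteq> 0\<^sub>v n\<close>] A B by blast+
    ultimately show False using r(2) by (simp add: zero_less_mult_iff)
  qed
  show "S * mker s X * S = A * inv_mat (of_real s \<cdot>\<^sub>m A + of_real (1 - s) \<cdot>\<^sub>m B) * B" if s: "0 \<le> s" "s \<le> 1" for s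
  proof -
    define D where "D = of_real s \<cdot>\<^sub>m A + of_real (1 - s) \<cdot>\<^sub>m B"
    note D = accretive_segment[OF A B s, folded D_def]
    define DX where "DX = of_real s \<cdot>\<^sub>m 1\<^sub>m n + of_real (1 - s) \<cdot>\<^sub>m X"
    have "T * A * T = (T * S) * (S * T)" unfolding SS[symmetric] using S T(1) by (simp add: assocs)
    then have TAT: "T * A * T = 1\<^sub>m n" by (simp add: T(2,3))
    have TA: "T * A \<in> carrier_mat n n" and TB: "T * B \<in> carrier_mat n n"
      using T(1) Ac Bc by (auto intro: mult_carrier_mat[of _ n n])
    have "T * D * T = of_real s \<cdot>\<^sub>m (T * A * T) + of_real (1 - s) \<cdot>\<^sub>m (T * B * T)"
      unfolding D_def mult_add_distrib_mat[OF T(1) smult_carrier_mat[OF Ac] smult_carrier_mat[OF Bc]]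
        mult_smult_distrib[OF T(1) Ac] mult_smult_distrib[OF T(1) Bc]
        add_mult_distrib_mat[OF smult_carrier_mat[OF TA] smult_carrier_mat[OF TB] T(1)]
        mult_smult_assoc_mat[OF TA T(1)] mult_smult_assoc_mat[OF TB T(1)] ..
    then have DXe: "DX = T * D * T" by (simp add: DX_def TAT XT)
    have DXc: "DX \<in> carrier_mat n n" unfolding DX_def using X by simp
    have E: "S * inv_mat D * S \<in> carrier_mat n n" using S D(2) by (simp add: assocs)
    \<comment> \<open>\<open>DX = T D T\<close> because \<open>T A T\<close> is the identity, so its
      inverse is \<open>S D^(-1) S\<close>; with \<open>S S = A\<close> the outer factors then turn
      the kernel into the harmonic mean.\<close>
    have "DX * (S * inv_mat D * S) = T * D * (T * S) * (inv_mat D * S)"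
      unfolding DXe using S T(1) D(1,2) by (simp add: assocs)
    also have "\<dots> = T * (D * inv_mat D) * S" unfolding T(3) using S T(1) D(1,2) by (simp add: assocs)
    also have "\<dots> = 1\<^sub>m n" unfolding D(3) using T(1) S by (simp add: T(3) assocs)
    finally have "inv_mat DX = S * inv_mat D * S" by (rule inv_mat_eqI[OF DXc E])
    then have "mker s X = S * inv_mat D * S * X" using X by (simp add: mker_def DX_def)
    then have "S * mker s X * S = (S * S) * inv_mat D * (S * T) * B * (T * S)"
      unfolding XT using S T(1) D(2) Bc by (simp add: assocs)
    also have "\<dots> = A * inv_mat D * B" unfolding SS T(2,3) using Ac D(2) Bc by (simp add: assocs)
    finally show ?thesis by (simp add: D_def)
  qed
qed

text \<open>The form becomes the real part of a linear combination of the entries of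
  \<open>H\<close>, so that convex combinations and entrywise limits of \<open>H\<close> pass
  through it.\<close>

lemma qform_sandwich:
  assumes S: "S \<in> carrier_mat n n" and H: "H \<in> carrier_mat n n" and v: "v \<in> carrier_vec n"
  shows "qform (S * H * S) v = Re (\<Sum>a<n. \<Sum>b<n. H $$ (a, b) * ((S *\<^sub>v v) $ b * cnj ((mat_adjoint S *\<^sub>v v) $ a)))"
proof -
  have S': "mat_adjoint S \<in> carrier_mat n n" using S by simp
  have Sv: "S *\<^sub>v v \<in> carrier_vec n" and S'v: "mat_adjoint S *\<^sub>v v \<in> carrier_vec n"
    using S S' v by (auto intro: mult_mat_vec_carrier)
  have HSv: "H *\<^sub>v (S *\<^sub>v v) \<in> carrier_vec n" using H Sv by (rule mult_mat_vec_carrier)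
  have "(S * H * S) *\<^sub>v v = S *\<^sub>v (H *\<^sub>v (S *\<^sub>v v))"
    by (simp only: assoc_mult_mat_vec[OF mult_carrier_mat[OF S H] S v] assoc_mult_mat_vec[OF S H Sv])
  then have "((S * H * S) *\<^sub>v v) \<bullet>c v = (H *\<^sub>v (S *\<^sub>v v)) \<bullet>c (mat_adjoint S *\<^sub>v v)"
    using mult_mat_vec_cscalar[OF S HSv v] by simp
  also have "\<dots> = (\<Sum>a<n. \<Sum>b<n. H $$ (a, b) * ((S *\<^sub>v v) $ b * cnj ((mat_adjoint S *\<^sub>v v) $ a)))"
  proof -
    define p q where "p = S *\<^sub>v v" and "q = mat_adjoint S *\<^sub>v v"
    have "p \<in> carrier_vec n" "q \<in> carrier_vec n" using Sv S'v by (simp_all add: p_def q_def)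
    then have "(H *\<^sub>v p) \<bullet>c q = (\<Sum>a<n. \<Sum>b<n. H $$ (a, b) * (p $ b * cnj (q $ a)))"
      using H by (simp add: scalar_prod_def atLeast0LessThan sum_distrib_right mult.assoc)
    then show ?thesis by (simp only: p_def q_def)
  qed
  finally show ?thesis by (simp add: qform_def)
qed

lemma hol_fun_carrier: "X \<in> carrier_mat n n \<Longrightarrow> hol_fun F X \<in> carrier_mat n n"
  by (simp add: hol_fun_def Let_def)

text \<open>One sequence of convex combinations serves both sides: it approximates \<open>f\<close>
  at the numbers \<open>d i\<close> and the functional calculus at \<open>X\<close>. At each stage
  the inequality is a convex combination of those for harmonic means.\<close>

theorem qform_acc_mean_ge:
  assumes f: "mean_function f" and A: "accretive n A" and B: "accretive n B" and v: "v \<in> carrier_vec n"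
    and G: "G \<in> carrier_mat n n" "re_mat A = cdiag n G (\<lambda>i. 1)" "re_mat B = cdiag n G d" "\<And>i. 0 < d i"
  shows "acc_mean f A B \<in> carrier_mat n n"
    and "qform (cdiag n G (\<lambda>i. f (d i))) v \<le> qform (acc_mean f A B) v"
proof -
  define S where "S = principal_sqrt A"
  define X where "X = inv_mat S * B * inv_mat S"
  note am = acc_mean_argument[OF A B, folded S_def, folded X_def]
  have acc: "acc_mean f A B = S * hol_fun (analytic_ext f) X * S"
    by (simp add: acc_mean_def Let_def S_def X_def)
  have hc: "hol_fun F X \<in> carrier_mat n n" for F by (rule hol_fun_carrier[OF am(2)])
  show "acc_mean f A B \<in> carrier_mat n n"
    unfolding acc using am(1) hc by (simp add: mult_carrier_mat[of _ n n])
  obtain P w where F: "analytic_ext f holomorphic_on (- \<real>\<^sub>\<le>\<^sub>0)"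
    "\<And>x. 0 < x \<Longrightarrow> analytic_ext f (complex_of_real x) = complex_of_real (f x)"
    and P: "\<And>m. conv_wt (P m) (w m)"
    and ul: "\<And>K. compact K \<Longrightarrow> K \<subseteq> - \<real>\<^sub>\<le>\<^sub>0 \<Longrightarrow> uniform_limit K (\<lambda>m. hsum (P m) (w m)) (analytic_ext f) sequentially"
    by (rule analytic_ext_approx[OF f]) (rule that, assumption+)
  define W where "W i = (cmod ((mat_adjoint G *\<^sub>v v) $ i))\<^sup>2" for i
  have "(\<lambda>m. qform (S * hol_fun (hsum (P m) (w m)) X * S) v) \<longlonglongrightarrow> qform (acc_mean f A B) v"
    unfolding acc qform_sandwich[OF am(1) hc v]
    by (intro tendsto_intros hol_fun_tendsto[OF am(2,3)] hsum_holomorphic[OF P] F ul) auto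
  moreover have "(\<lambda>m. \<Sum>i<n. hsum (P m) (w m) (d i) * W i) \<longlonglongrightarrow> (\<Sum>i<n. f (d i) * W i)"
  proof (intro tendsto_intros)
    fix i
    have "uniform_limit {complex_of_real (d i)} (\<lambda>m. hsum (P m) (w m)) (analytic_ext f) sequentially"
      using G(4)[of i] by (intro ul) (auto simp: complex_nonpos_Reals_iff)
    then have "(\<lambda>m. hsum (P m) (w m) (complex_of_real (d i))) \<longlonglongrightarrow> complex_of_real (f (d i))"
      using F(2)[OF G(4)[of i]] by simp
    then show "(\<lambda>m. hsum (P m) (w m) (d i)) \<longlonglongrightarrow> f (d i)"
      by (simp add: hsum_of_real tendsto_of_real_iff)
  qed
  moreover have "(\<Sum>i<n. hsum (P m) (w m) (d i) * W i) \<le> qform (S * hol_fun (hsum (P m) (w m)) X * S) v" for m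
  proof -
    define u where "u a b = (S *\<^sub>v v) $ b * cnj ((mat_adjoint S *\<^sub>v v) $ a)" for a b
    have s: "0 \<le> s" "s \<le> 1" "0 \<le> w m s" if "s \<in> P m" for s using P[of m] that by (auto simp: conv_wt_def)
    have mc: "mker s X \<in> carrier_mat n n" if "s \<in> P m" for s
      using inv_mat_segment(2)[OF am(2,3) s(1,2)[OF that]] am(2)
      by (simp add: mker_def mult_carrier_mat[of _ n n])
    have "(\<Sum>i<n. hsum (P m) (w m) (d i) * W i) = (\<Sum>s\<in>P m. w m s * (\<Sum>i<n. hker s (d i) * W i))"
      unfolding hsum_def sum_distrib_right sum_distrib_left by (subst sum.swap) (simp add: mult.assoc)
    also have "\<dots> = (\<Sum>s\<in>P m. w m s * qform (cdiag n G (\<lambda>i. hker s (d i))) v)"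
      by (simp add: qform_cdiag[OF G(1) v] W_def)
    also have "\<dots> \<le> (\<Sum>s\<in>P m. w m s * qform (S * mker s X * S) v)"
    proof (intro sum_mono mult_left_mono)
      fix s assume sP: "s \<in> P m"
      show "qform (cdiag n G (\<lambda>i. hker s (d i))) v \<le> qform (S * mker s X * S) v"
        unfolding am(4)[OF s(1,2)[OF sP]] by (rule harmonic_qform_lower_bound[OF A B s(1,2)[OF sP] v G])
      show "0 \<le> w m s" by (rule s(3)[OF sP])
    qed
    also have "\<dots> = Re (\<Sum>s\<in>P m. \<Sum>a<n. \<Sum>b<n. of_real (w m s) * mker s X $$ (a, b) * u a b)"
      unfolding Re_sum
      by (intro sum.cong refl) (simp add: qform_sandwich[OF am(1) mc v] u_def sum_distrib_left mult.assoc)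
    also have "(\<Sum>s\<in>P m. \<Sum>a<n. \<Sum>b<n. of_real (w m s) * mker s X $$ (a, b) * u a b) =
        (\<Sum>a<n. \<Sum>b<n. \<Sum>s\<in>P m. of_real (w m s) * mker s X $$ (a, b) * u a b)"
      by (subst sum.swap, intro sum.cong refl, rule sum.swap)
    also have "\<dots> = (\<Sum>a<n. \<Sum>b<n. hol_fun (hsum (P m) (w m)) X $$ (a, b) * u a b)"
      by (intro sum.cong refl) (simp add: hol_fun_hsum[OF am(2,3) P] sum_distrib_right)
    also have "Re \<dots> = qform (S * hol_fun (hsum (P m) (w m)) X * S) v"
      unfolding qform_sandwich[OF am(1) hc v] u_def ..
    finally show ?thesis .
  qed
  ultimately have "(\<Sum>i<n. f (d i) * W i) \<le> qform (acc_mean f A B) v"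
    by (intro LIMSEQ_le) auto
  then show "qform (cdiag n G (\<lambda>i. f (d i))) v \<le> qform (acc_mean f A B) v"
    by (simp add: qform_cdiag[OF G(1) v] W_def)
qed

section \<open>The inequality between quadratic forms\<close>

lemma hermitian_real_combination:
  assumes "hermitian A" "hermitian B" "A \<in> carrier_mat n n" "B \<in> carrier_mat n n"
  shows "hermitian (A + B)" "hermitian (A - B)" "hermitian (complex_of_real c \<cdot>\<^sub>m A)"
  using assms by (auto simp: hermitian_def mat_adjoint_add[of _ n n] mat_adjoint_minus[of _ n n] mat_adjoint_smult)

theorem theorem2p1:
  fixes f :: "real \<Rightarrow> real" and g :: "real \<Rightarrow> real \<Rightarrow> real"
    and n :: nat and A B :: "complex mat" and t R :: real
  assumes "symmetric_mean f"
    and "interpolational_path f g"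
    and "n \<ge> 1"
    and "accretive n A" and "accretive n B"
    and "0 \<le> t" and "t \<le> 1"
    and "R = max t (1 - t)"
  shows "loewner_le n (re_mat (wt_arith_mean t A B))
           (re_mat (acc_mean (g t) A B) +
            complex_of_real (2 * R) \<cdot>\<^sub>m
              (re_mat (arith_mean A B) - pos_mean f (re_mat A) (re_mat B)))"
proof -
  have c: "A \<in> carrier_mat n n" "B \<in> carrier_mat n n" and pd: "pos_def n (re_mat A)" "pos_def n (re_mat B)"
    using assms(4,5) by (auto simp: accretive_def)
  have gt: "mean_function (g t)" using assms(2,6,7) by (simp add: interpolational_path_def)
  \<comment> \<open>One congruence diagonalises both real parts and every mean of them. The lower
    bound for the accretive mean is stated for the same \<open>G\<close>, so all terms are compared
    coordinate by coordinate.\<close>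
  obtain G H d where G: "G \<in> carrier_mat n n" "H \<in> carrier_mat n n" "G * H = 1\<^sub>m n" "\<And>i. 0 < d i"
    "re_mat A = cdiag n G (\<lambda>i. 1)" "re_mat B = cdiag n G d"
    "\<And>f. pos_mean f (re_mat A) (re_mat B) = cdiag n G (\<lambda>i. f (d i))"
    by (rule pos_mean_cdiag[OF pd]) (rule that; assumption)
  note acc = qform_acc_mean_ge[OF gt assms(4,5) _ G(1,5,6,4)]
  have wc: "wt_arith_mean u A B \<in> carrier_mat n n" for u using c by (simp add: wt_arith_mean_def)
  have ac: "acc_mean (g t) A B \<in> carrier_mat n n" by (rule acc(1)[OF zero_carrier_vec])
  have pc: "pos_mean f (re_mat A) (re_mat B) \<in> carrier_mat n n" and ph: "hermitian (pos_mean f (re_mat A) (re_mat B))"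
    unfolding G(7) using cdiag_carrier[OF G(1)] hermitian_cdiag[OF G(1)] by auto
  define E where "E = re_mat (arith_mean A B) - pos_mean f (re_mat A) (re_mat B)"
  have E: "E \<in> carrier_mat n n" "hermitian E"
    unfolding E_def using hermitian_real_combination(2)[OF hermitian_re_mat[OF wc] ph re_mat_carrier[OF wc] pc]
      minus_carrier_mat[OF pc] by auto
  have RE: "complex_of_real (2 * R) \<cdot>\<^sub>m E \<in> carrier_mat n n" "hermitian (complex_of_real (2 * R) \<cdot>\<^sub>m E)"
    by (rule smult_carrier_mat[OF E(1)], rule hermitian_real_combination(3)[OF E(2,2) E(1,1)])
  show ?thesis
    unfolding E_def[symmetric]
  proof (rule loewner_leI)
    show "re_mat (acc_mean (g t) A B) + complex_of_real (2 * R) \<cdot>\<^sub>m E \<in> carrier_mat n n"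
      using RE(1) by (rule add_carrier_mat)
    show "hermitian (re_mat (acc_mean (g t) A B) + complex_of_real (2 * R) \<cdot>\<^sub>m E)"
      by (rule hermitian_real_combination(1)[OF hermitian_re_mat[OF ac] RE(2) re_mat_carrier[OF ac] RE(1)])
    fix v :: "complex vec" assume v: "v \<in> carrier_vec n"
    define W where "W i = (cmod ((mat_adjoint G *\<^sub>v v) $ i))\<^sup>2" for i
    have qA: "qform A v = (\<Sum>i<n. W i)" and qB: "qform B v = (\<Sum>i<n. d i * W i)"
      unfolding qform_re_mat[OF c(1) v, symmetric] qform_re_mat[OF c(2) v, symmetric] G(5,6)
      by (simp_all add: qform_cdiag[OF G(1) v] W_def)
    have qw: "qform (re_mat (wt_arith_mean u A B)) v = (1 - u) * qform A v + u * qform B v" for u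
      unfolding qform_re_mat[OF wc v] unfolding wt_arith_mean_def
      by (simp only: qform_add[OF smult_carrier_mat[OF c(1)] smult_carrier_mat[OF c(2)] v] qform_smult[OF c(1) v] qform_smult[OF c(2) v])
    have "qform (re_mat (wt_arith_mean t A B)) v = (\<Sum>i<n. (1 - t + t * d i) * W i)"
      unfolding qw qA qB sum_distrib_left sum.distrib[symmetric]
      by (intro sum.cong refl) (simp add: algebra_simps)
    \<comment> \<open>The scalar inequality at \<open>x = d i\<close>, summed with the weights
      \<open>W i \<ge> 0\<close>; up to here only the real parts of the two matrices enter.\<close>
    also have "\<dots> \<le> (\<Sum>i<n. (g t (d i) + 2 * R * ((1 + d i) / 2 - f (d i))) * W i)"
      using interpolational_path_le[OF assms(1,2) G(4) assms(6,7,8)]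
      by (intro sum_mono mult_right_mono) (auto simp: W_def)
    also have "\<dots> = qform (cdiag n G (\<lambda>i. g t (d i))) v +
        2 * R * (qform (re_mat (arith_mean A B)) v - qform (pos_mean f (re_mat A) (re_mat B)) v)"
      unfolding qw qA qB G(7) qform_cdiag[OF G(1) v] W_def[symmetric]
      by (simp add: sum_distrib_left sum_distrib_right sum.distrib sum_subtractf algebra_simps sum_divide_distrib add_divide_distrib)
    also have "\<dots> \<le> qform (acc_mean (g t) A B) v +
        2 * R * (qform (re_mat (arith_mean A B)) v - qform (pos_mean f (re_mat A) (re_mat B)) v)"
      using acc(2)[OF v] by simp
    also have "\<dots> = qform (re_mat (acc_mean (g t) A B) + complex_of_real (2 * R) \<cdot>\<^sub>m E) v"
      unfolding E_def[symmetric] qform_add[OF re_mat_carrier[OF ac] RE(1) v] qform_smult[OF E(1) v]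
        qform_re_mat[OF ac v]
      by (simp only: E_def qform_minus[OF re_mat_carrier[OF wc] pc v])
    finally show "qform (re_mat (wt_arith_mean t A B)) v \<le>
        qform (re_mat (acc_mean (g t) A B) + complex_of_real (2 * R) \<cdot>\<^sub>m E) v" .
  qed (use hermitian_re_mat[OF wc] re_mat_carrier[OF wc] in auto)
qed

end
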